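(* Let $(b_n)_{n\ge1},(\tilde b_n)_{n\ge1}\in\ell^2$ with $\|(b_n)\|_2=\|(\tilde b_n)\|_2=1$ and $b_1\ne0\ne\tilde b_1$. Let $f(z)=(b_1z,b_2z^2,b_3z^3,\dots)$ and $\tilde f(z)=(\tilde b_1z,\tilde b_2z^2,\tilde b_3z^3,\dots)$ for $z\in\mathbb{D}$, and let $V=f(\mathbb{D})$, $\tilde V=\tilde f(\mathbb{D})$, which are varieties in $\mathbb{B}_\infty$. Let $(a_n)_{n\ge0}$ and $(\tilde a_n)_{n\ge0}$ be defined by \[ \sum_{n\ge0}a_nz^n=\frac{1}{1-\sum_{n\ge1}|b_n|^2z^n},\qquad \sum_{n\ge0}\tilde a_nz^n=\frac{1}{1-\sum_{n\ge1}|\tilde b_n|^2z^n}\qquad(z\in\mathbb{D}). \] Then the algebras $\mathcal{M}_V$ and $\mathcal{M}_{\tilde V}$ are isomorphic via the natural map of composition with $f\circ\tilde f^{-1}$ if and only if the sequences $(a_n)$ and $(\tilde a_n)$ are comparable. Suppose that $\mathcal{M}_{\tilde V}$ satisfies $\pi^{-1}(\lambda)=\{\rho_\lambda\}$ for every $\lambda\in\tilde V$ and is automorphism invariant. Then $\mathcal{M}_V$ is isomorphic to $\mathcal{M}_{\tilde V}$ if and only if the sequences $(a_n)$ and $(\tilde a_n)$ are comparable. In particular, $\mathcal{M}_V$ is isomorphic to $H^\infty$ if and only if the sequence $(a_n)$ is bounded below (by a positive constant).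
   Context: $\mathbb{B}_\infty$ is the open unit ball of $\ell^2$. The Drury-Arveson space $\mathcal{H}_\infty$ is the reproducing kernel Hilbert space on $\mathbb{B}_\infty$ with kernel $k(x,y)=\frac{1}{1-\langle x,y\rangle}$, $k_y(x)=k(x,y)$, and $\mathcal{M}_\infty$ is its multiplier algebra. A variety in $\mathbb{B}_\infty$ is an intersection of zero sets (in $\mathbb{B}_\infty$) of a family of functions in $\mathcal{M}_\infty$. For a variety $V$, $\mathcal{H}_V=\overline{\operatorname{span}}\{k_y:y\in V\}$, considered as a Hilbert space of functions on $V$, and $\mathcal{M}_V$ is its multiplier algebra (functions on $V$). $M(\mathcal{M}_V)$ is the space of characters (nonzero multiplicative linear functionals) of $\mathcal{M}_V$; $\rho_v(h)=h(v)$ for $v\in V$; and $\pi:M(\mathcal{M}_V)\to\overline{\mathbb{B}_\infty}$ is $\pi(\rho)=(\rho(Z_i))_{i\ge1}$, where $Z_i$ is the restriction to $V$ of the $i$-th coordinate function. Isomorphism means isomorphism of algebras. "Isomorphic via the natural map" means that $h\mapsto h\circ f\circ\tilde f^{-1}$ is an isomorphism of $\mathcal{M}_V$ onto $\mathcal{M}_{\tilde V}$. $\mathcal{M}_{\tilde V}$ is automorphism invariant if for every conformal automorphism (M\"obius map) $\theta$ of $\mathbb{D}$, composition with $\tilde f\circ\theta\circ\tilde f^{-1}$ is an automorphism of $\mathcal{M}_{\tilde V}$. Two positive sequences $(a_n),(\tilde a_n)$ are comparable if there are constants $c,C>0$ with $c\,a_n\le\tilde a_n\le C\,a_n$ for all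 $n$. $H^\infty$ is the algebra of bounded analytic functions on $\mathbb{D}$. *)

theory Defs
  imports "HOL-Complex_Analysis.Complex_Analysis"
begin

section \<open>Functions on a set\<close>

text \<open>A complex function on a set \<open>X\<close> is represented by a function on the ambient type
  that vanishes outside \<open>X\<close>.  Sums, products and scalar multiples of functions on \<open>X\<close> are
  then simply pointwise.\<close>

definition functions_on :: "'a set \<Rightarrow> ('a \<Rightarrow> complex) set" where
  "functions_on X = {F. \<forall>x. x \<notin> X \<longrightarrow> F x = 0}"

definition restr :: "'a set \<Rightarrow> ('a \<Rightarrow> complex) \<Rightarrow> 'a \<Rightarrow> complex" where
  "restr X F = (\<lambda>x. if x \<in> X then F x else 0)"

section \<open>Hilbert spaces of functions\<close>

definition ip_norm :: "(('a \<Rightarrow> complex) \<Rightarrow> ('a \<Rightarrow> complex) \<Rightarrow> complex) \<Rightarrow> ('a \<Rightarrow> complex) \<Rightarrow> real" where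
  "ip_norm ip F = sqrt (Re (ip F F))"

text \<open>The inner product is linear in the first argument; nothing is required of it outside \<open>H\<close>.\<close>

locale hilbert_function_space =
  fixes X :: "'a set"
    and H :: "('a \<Rightarrow> complex) set"
    and ip :: "('a \<Rightarrow> complex) \<Rightarrow> ('a \<Rightarrow> complex) \<Rightarrow> complex"
  assumes subset_functions_on: "H \<subseteq> functions_on X"
    and zero_closed: "(\<lambda>x. 0) \<in> H"
    and add_closed: "\<lbrakk>F \<in> H; G \<in> H\<rbrakk> \<Longrightarrow> (\<lambda>x. F x + G x) \<in> H"
    and scale_closed: "F \<in> H \<Longrightarrow> (\<lambda>x. c * F x) \<in> H"
    and ip_add: "\<lbrakk>F \<in> H; G \<in> H; E \<in> H\<rbrakk> \<Longrightarrow> ip (\<lambda>x. F x + G x) E = ip F E + ip G E"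
    and ip_scale: "\<lbrakk>F \<in> H; G \<in> H\<rbrakk> \<Longrightarrow> ip (\<lambda>x. c * F x) G = c * ip F G"
    and ip_commute: "\<lbrakk>F \<in> H; G \<in> H\<rbrakk> \<Longrightarrow> ip F G = cnj (ip G F)"
    and ip_nonneg: "F \<in> H \<Longrightarrow> 0 \<le> Re (ip F F)"
    and ip_definite: "\<lbrakk>F \<in> H; ip F F = 0\<rbrakk> \<Longrightarrow> F = (\<lambda>x. 0)"
    and complete: "\<lbrakk>\<forall>n. S n \<in> H;
        \<forall>e>0. \<exists>N::nat. \<forall>m\<ge>N. \<forall>n\<ge>N. ip_norm ip (\<lambda>x. S m x - S n x) < e\<rbrakk>
      \<Longrightarrow> \<exists>G\<in>H. (\<lambda>n. ip_norm ip (\<lambda>x. S n x - G x)) \<longlonglongrightarrow> 0"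

definition kernel_fun :: "'a set \<Rightarrow> ('a \<Rightarrow> 'a \<Rightarrow> complex) \<Rightarrow> 'a \<Rightarrow> 'a \<Rightarrow> complex" where
  "kernel_fun X K y = restr X (\<lambda>x. K x y)"

locale reproducing_kernel_hilbert_space = hilbert_function_space X H ip
  for X :: "'a set"
    and K :: "'a \<Rightarrow> 'a \<Rightarrow> complex"
    and H :: "('a \<Rightarrow> complex) set"
    and ip :: "('a \<Rightarrow> complex) \<Rightarrow> ('a \<Rightarrow> complex) \<Rightarrow> complex" +
  assumes kernel_mem: "y \<in> X \<Longrightarrow> kernel_fun X K y \<in> H"
    and reproducing: "\<lbrakk>y \<in> X; F \<in> H\<rbrakk> \<Longrightarrow> ip F (kernel_fun X K y) = F y"

definition multiplier_algebra :: "'a set \<Rightarrow> ('a \<Rightarrow> complex) set \<Rightarrow> ('a \<Rightarrow> complex) set" where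
  "multiplier_algebra X H = {h \<in> functions_on X. \<forall>F\<in>H. (\<lambda>x. h x * F x) \<in> H}"

section \<open>Algebras of functions\<close>

definition algebra_iso ::
  "('a \<Rightarrow> complex) set \<Rightarrow> ('b \<Rightarrow> complex) set \<Rightarrow> (('a \<Rightarrow> complex) \<Rightarrow> 'b \<Rightarrow> complex) \<Rightarrow> bool" where
  "algebra_iso A B \<Phi> \<longleftrightarrow>
     bij_betw \<Phi> A B \<and>
     (\<forall>g\<in>A. \<forall>h\<in>A. \<Phi> (\<lambda>x. g x + h x) = (\<lambda>x. \<Phi> g x + \<Phi> h x)) \<and>
     (\<forall>c. \<forall>h\<in>A. \<Phi> (\<lambda>x. c * h x) = (\<lambda>x. c * \<Phi> h x)) \<and>
     (\<forall>g\<in>A. \<forall>h\<in>A. \<Phi> (\<lambda>x. g x * h x) = (\<lambda>x. \<Phi> g x * \<Phi> h x))"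

definition isomorphic_algebras :: "('a \<Rightarrow> complex) set \<Rightarrow> ('b \<Rightarrow> complex) set \<Rightarrow> bool" where
  "isomorphic_algebras A B \<longleftrightarrow> (\<exists>\<Phi>. algebra_iso A B \<Phi>)"

text \<open>Functionals on \<open>A\<close> are themselves functions on the set \<open>A\<close>, hence zero off \<open>A\<close>.\<close>

definition characters :: "('a \<Rightarrow> complex) set \<Rightarrow> (('a \<Rightarrow> complex) \<Rightarrow> complex) set" where
  "characters A = {\<rho> \<in> functions_on A.
     (\<exists>h\<in>A. \<rho> h \<noteq> 0) \<and>
     (\<forall>g\<in>A. \<forall>h\<in>A. \<rho> (\<lambda>x. g x + h x) = \<rho> g + \<rho> h) \<and>
     (\<forall>c. \<forall>h\<in>A. \<rho> (\<lambda>x. c * h x) = c * \<rho> h) \<and>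
     (\<forall>g\<in>A. \<forall>h\<in>A. \<rho> (\<lambda>x. g x * h x) = \<rho> g * \<rho> h)}"

definition point_eval :: "('a \<Rightarrow> complex) set \<Rightarrow> 'a \<Rightarrow> ('a \<Rightarrow> complex) \<Rightarrow> complex" where
  "point_eval A v = restr A (\<lambda>h. h v)"

section \<open>The Drury-Arveson space and varieties in the ball\<close>

text \<open>Index \<open>i\<close> of a sequence \<open>x :: nat \<Rightarrow> complex\<close> is the mathematical index \<open>i + 1\<close>.\<close>

definition ell2 :: "(nat \<Rightarrow> complex) set" where
  "ell2 = {x. summable (\<lambda>i. (cmod (x i))\<^sup>2)}"

definition ell2_norm :: "(nat \<Rightarrow> complex) \<Rightarrow> real" where
  "ell2_norm x = sqrt (\<Sum>i. (cmod (x i))\<^sup>2)"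

definition ell2_inner :: "(nat \<Rightarrow> complex) \<Rightarrow> (nat \<Rightarrow> complex) \<Rightarrow> complex" where
  "ell2_inner x y = (\<Sum>i. x i * cnj (y i))"

definition ell2_ball :: "(nat \<Rightarrow> complex) set" where
  "ell2_ball = {x \<in> ell2. ell2_norm x < 1}"

definition da_kernel :: "(nat \<Rightarrow> complex) \<Rightarrow> (nat \<Rightarrow> complex) \<Rightarrow> complex" where
  "da_kernel x y = 1 / (1 - ell2_inner x y)"

text \<open>The Drury-Arveson space is the reproducing kernel Hilbert space with this kernel.  By the
  Moore-Aronszajn theorem it exists, and \<open>H\<close> as well as \<open>ip\<close> on \<open>H\<close> are unique.\<close>

definition drury_arveson ::
  "((nat \<Rightarrow> complex) \<Rightarrow> complex) set \<Rightarrow>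
   (((nat \<Rightarrow> complex) \<Rightarrow> complex) \<Rightarrow> ((nat \<Rightarrow> complex) \<Rightarrow> complex) \<Rightarrow> complex) \<Rightarrow> bool" where
  "drury_arveson H ip \<longleftrightarrow> reproducing_kernel_hilbert_space ell2_ball da_kernel H ip"

text \<open>In the following definitions \<open>H\<close> and \<open>ip\<close> stand for the Drury-Arveson space.\<close>

definition variety ::
  "((nat \<Rightarrow> complex) \<Rightarrow> complex) set \<Rightarrow> (nat \<Rightarrow> complex) set \<Rightarrow> bool" where
  "variety H V \<longleftrightarrow>
     (\<exists>E \<subseteq> multiplier_algebra ell2_ball H. V = {x \<in> ell2_ball. \<forall>h\<in>E. h x = 0})"

definition kernel_span :: "(nat \<Rightarrow> complex) set \<Rightarrow> ((nat \<Rightarrow> complex) \<Rightarrow> complex) set" where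
  "kernel_span V = {F. \<exists>S c. finite S \<and> S \<subseteq> V \<and>
     F = (\<lambda>x. \<Sum>y\<in>S. c y * kernel_fun ell2_ball da_kernel y x)}"

definition space_on ::
  "((nat \<Rightarrow> complex) \<Rightarrow> complex) set \<Rightarrow>
   (((nat \<Rightarrow> complex) \<Rightarrow> complex) \<Rightarrow> ((nat \<Rightarrow> complex) \<Rightarrow> complex) \<Rightarrow> complex) \<Rightarrow>
   (nat \<Rightarrow> complex) set \<Rightarrow> ((nat \<Rightarrow> complex) \<Rightarrow> complex) set" where
  "space_on H ip V =
     restr V ` {F \<in> H. \<forall>e>0. \<exists>G\<in>kernel_span V. ip_norm ip (\<lambda>x. F x - G x) < e}"

definition multipliers_on ::
  "((nat \<Rightarrow> complex) \<Rightarrow> complex) set \<Rightarrow>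
   (((nat \<Rightarrow> complex) \<Rightarrow> complex) \<Rightarrow> ((nat \<Rightarrow> complex) \<Rightarrow> complex) \<Rightarrow> complex) \<Rightarrow>
   (nat \<Rightarrow> complex) set \<Rightarrow> ((nat \<Rightarrow> complex) \<Rightarrow> complex) set" where
  "multipliers_on H ip V = multiplier_algebra V (space_on H ip V)"

text \<open>The map \<open>\<pi>\<close> from characters of the multiplier algebra of \<open>V\<close> to sequences.\<close>

definition char_proj ::
  "(nat \<Rightarrow> complex) set \<Rightarrow> (((nat \<Rightarrow> complex) \<Rightarrow> complex) \<Rightarrow> complex) \<Rightarrow> nat \<Rightarrow> complex" where
  "char_proj V \<rho> = (\<lambda>i. \<rho> (restr V (\<lambda>x. x i)))"

section \<open>Embedded discs\<close>

definition disc_embedding :: "(nat \<Rightarrow> complex) \<Rightarrow> complex \<Rightarrow> nat \<Rightarrow> complex" where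
  "disc_embedding b z = (\<lambda>i. b i * z ^ Suc i)"

definition embedded_disc :: "(nat \<Rightarrow> complex) \<Rightarrow> (nat \<Rightarrow> complex) set" where
  "embedded_disc b = disc_embedding b ` ball 0 1"

definition disc_param :: "(nat \<Rightarrow> complex) \<Rightarrow> (nat \<Rightarrow> complex) \<Rightarrow> complex" where
  "disc_param b = inv_into (ball 0 1) (disc_embedding b)"

definition natural_map ::
  "(nat \<Rightarrow> complex) \<Rightarrow> (nat \<Rightarrow> complex) \<Rightarrow> ((nat \<Rightarrow> complex) \<Rightarrow> complex) \<Rightarrow> (nat \<Rightarrow> complex) \<Rightarrow> complex" where
  "natural_map b b' h = restr (embedded_disc b') (h \<circ> disc_embedding b \<circ> disc_param b')"

definition disc_automorphism :: "(complex \<Rightarrow> complex) \<Rightarrow> bool" where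
  "disc_automorphism \<theta> \<longleftrightarrow> \<theta> holomorphic_on ball 0 1 \<and> bij_betw \<theta> (ball 0 1) (ball 0 1)"

definition automorphism_invariant ::
  "(nat \<Rightarrow> complex) \<Rightarrow> ((nat \<Rightarrow> complex) \<Rightarrow> complex) set \<Rightarrow> bool" where
  "automorphism_invariant b A \<longleftrightarrow>
     (\<forall>\<theta>. disc_automorphism \<theta> \<longrightarrow>
        algebra_iso A A
          (\<lambda>h. restr (embedded_disc b) (h \<circ> (disc_embedding b \<circ> \<theta> \<circ> disc_param b))))"

text \<open>The series on the left determines \<open>a\<close> uniquely; on the right \<open>b i\<close> is the mathematical \<open>b\<close> with index
  \<open>i + 1\<close>.\<close>

definition renewal_coeffs :: "(nat \<Rightarrow> complex) \<Rightarrow> (nat \<Rightarrow> real) \<Rightarrow> bool" where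
  "renewal_coeffs b a \<longleftrightarrow>
     (\<forall>z\<in>ball 0 1. (\<lambda>n. of_real (a n) * z ^ n) sums
        (1 / (1 - (\<Sum>i. of_real ((cmod (b i))\<^sup>2) * z ^ Suc i)) :: complex))"

definition comparable :: "(nat \<Rightarrow> real) \<Rightarrow> (nat \<Rightarrow> real) \<Rightarrow> bool" where
  "comparable a a' \<longleftrightarrow> (\<exists>c>0. \<exists>C>0. \<forall>n. c * a n \<le> a' n \<and> a' n \<le> C * a n)"

definition H_infinity :: "(complex \<Rightarrow> complex) set" where
  "H_infinity = {h \<in> functions_on (ball 0 1). h holomorphic_on ball 0 1 \<and> bounded (h ` ball 0 1)}"

end

theory Submission
  imports Defs
begin

text \<open>
  Everything is moved from the varieties to the unit disc.  The Drury-Arveson kernel at the points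
  \<open>f z\<close> and \<open>f w\<close> is \<open>1 / (1 - \<Sum>n. \<bar>b\<^sub>n\<bar>\<^sup>2 (z * cnj w)\<^sup>n) = (\<Sum>n. a\<^sub>n (z * cnj w)\<^sup>n)\<close>, the kernel of the
  space of power series \<open>\<Sum>n. c\<^sub>n z\<^sup>n\<close> with \<open>\<Sum>n. \<bar>c\<^sub>n\<bar>\<^sup>2 / a\<^sub>n\<close> finite.  A function belongs to a
  reproducing kernel Hilbert space if and only if its pairing with the combinations of kernels is
  bounded, a condition on the kernel alone (\<open>mem_iff_dominated\<close>, \<open>closed_kernel_span_iff\<close>).
  Hence composition with \<open>f\<close> identifies \<open>\<H>\<^sub>V\<close> with the weighted Hardy space of \<open>a\<close>, and \<open>\<M>\<^sub>V\<close>
  with its multiplier algebra (\<open>space_on_embedded_disc\<close>, \<open>algebra_iso_pullback\<close>).  The natural map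
  becomes the identity, so it is an isomorphism exactly if the multiplier algebras for \<open>a\<close>
  and \<open>a'\<close> are the same set of functions.

  Comparable weights give the same space and so the same multipliers.  Conversely, \<open>a\<close> is a renewal
  sequence and satisfies \<open>a\<^sub>m a\<^sub>n \<le> a\<^sub>m\<^sub>+\<^sub>n\<close>, whence the multiplier norm of \<open>z\<^sup>n\<close> is at most
  \<open>1 / sqrt a\<^sub>n\<close>, which is its norm in the Hilbert space.  If the ratio \<open>a\<^sub>n / a'\<^sub>n\<close> were unbounded, a lacunary
  series with fast growing ratios would be a multiplier for \<open>a\<close> that is not even in the
  Hilbert space of \<open>a'\<close> (\<open>comparison_of_multipliers\<close>).

  For an arbitrary isomorphism, the image of the coordinate function and its image under the
  inverse isomorphism map the disc to itself, because the spectrum of the coordinate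
  multiplier lies in the closed disc (\<open>iso_coord_self_map\<close>).  The condition on fibres makes the inverse
  isomorphism a composition operator, its symbol is an automorphism of the disc, and
  automorphism invariance yields equality of the two algebras (\<open>iso_imp_multipliers_eq\<close>).

  The constant weight belongs to the classical Hardy space, whose multipliers are the bounded
  analytic functions (\<open>multipliers_one_eq_H_infinity\<close>).  This algebra has one-point fibres over the disc and is
  automorphism invariant, so the last claim is the case \<open>a' = 1\<close> of the same argument.
  That the embedded discs are varieties follows from explicit polynomial equations, as the coordinates
  are multipliers of the Drury-Arveson space.
\<close>

section \<open>Membership in reproducing kernel Hilbert spaces\<close>

context hilbert_function_space
begin

lemma diff_closed:
  assumes "F \<in> H" "G \<in> H"
  shows "(\<lambda>x. F x - G x) \<in> H"
  using add_closed[OF assms(1) scale_closed[OF assms(2), of "-1"]] by simp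

lemma sum_closed:
  assumes "finite S" "\<And>i. i \<in> S \<Longrightarrow> F i \<in> H"
  shows "(\<lambda>x. \<Sum>i\<in>S. c i * F i x) \<in> H"
  using assms
proof (induction S)
  case (insert i S)
  then show ?case
    using add_closed[OF scale_closed[of "F i" "c i"], of "\<lambda>x. \<Sum>i\<in>S. c i * F i x"] by simp
qed (simp add: zero_closed)

lemma ip_add_right:
  assumes "F \<in> H" "G \<in> H" "E \<in> H"
  shows "ip E (\<lambda>x. F x + G x) = ip E F + ip E G"
  using assms by (simp add: ip_commute[of E] ip_add add_closed)

lemma ip_scale_right:
  assumes "F \<in> H" "E \<in> H"
  shows "ip E (\<lambda>x. c * F x) = cnj c * ip E F"
  using assms by (simp add: ip_commute[of E] ip_scale scale_closed)

lemma ip_zero: "G \<in> H \<Longrightarrow> ip (\<lambda>x. 0) G = 0"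
  using ip_scale[OF zero_closed, of G 0] by simp

lemma ip_sum_right:
  assumes "finite S" "\<And>i. i \<in> S \<Longrightarrow> F i \<in> H" "E \<in> H"
  shows "ip E (\<lambda>x. \<Sum>i\<in>S. c i * F i x) = (\<Sum>i\<in>S. cnj (c i) * ip E (F i))"
  using assms
proof (induction S)
  case empty
  then show ?case using ip_commute[OF \<open>E \<in> H\<close> zero_closed] ip_zero by simp
next
  case (insert i S)
  then show ?case
    using ip_add_right[OF scale_closed[of "F i" "c i"] sum_closed[of S F c] \<open>E \<in> H\<close>]
    by (simp add: ip_scale_right)
qed

abbreviation nrm :: "('a \<Rightarrow> complex) \<Rightarrow> real" where
  "nrm \<equiv> ip_norm ip"

lemma nrm_nonneg: "F \<in> H \<Longrightarrow> 0 \<le> nrm F"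
  by (simp add: ip_norm_def ip_nonneg)

lemma nrm_sq: "F \<in> H \<Longrightarrow> (nrm F)\<^sup>2 = Re (ip F F)"
  by (simp add: ip_norm_def ip_nonneg)

lemma ip_self: "F \<in> H \<Longrightarrow> ip F F = of_real ((nrm F)\<^sup>2)"
  using ip_commute[of F F] by (auto simp: nrm_sq complex_eq_iff)

lemma nrm_sq_add:
  assumes "F \<in> H" "G \<in> H"
  shows "(nrm (\<lambda>x. F x + G x))\<^sup>2 = (nrm F)\<^sup>2 + (nrm G)\<^sup>2 + 2 * Re (ip F G)"
proof -
  have "Re (ip G F) = Re (ip F G)"
    using ip_commute[OF assms] by simp
  then show ?thesis
    using assms by (simp add: nrm_sq add_closed ip_add ip_add_right)
qed

lemma nrm_sq_scale: "F \<in> H \<Longrightarrow> (nrm (\<lambda>x. c * F x))\<^sup>2 = (cmod c)\<^sup>2 * (nrm F)\<^sup>2"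
proof -
  assume F: "F \<in> H"
  have "ip (\<lambda>x. c * F x) (\<lambda>x. c * F x) = (c * cnj c) * ip F F"
    using F by (simp add: scale_closed ip_scale ip_scale_right)
  also have "\<dots> = of_real ((cmod c)\<^sup>2 * (nrm F)\<^sup>2)"
    using F by (simp add: ip_self complex_norm_square del: of_real_power)
  finally show ?thesis
    using F by (simp add: nrm_sq scale_closed)
qed

lemma nrm_scale: "F \<in> H \<Longrightarrow> nrm (\<lambda>x. c * F x) = cmod c * nrm F"
  using nrm_sq_scale[of F c] scale_closed[of F c] nrm_nonneg
  by (metis mult_nonneg_nonneg norm_ge_zero power2_eq_imp_eq power_mult_distrib)

lemma nrm_sq_diff:
  assumes "F \<in> H" "G \<in> H"
  shows "(nrm (\<lambda>x. F x - G x))\<^sup>2 = (nrm F)\<^sup>2 + (nrm G)\<^sup>2 - 2 * Re (ip F G)"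
  using nrm_sq_add[OF assms(1) scale_closed[OF assms(2), of "-1"]]
    nrm_sq_scale[OF assms(2), of "-1"] ip_scale_right[OF assms(2,1), of "-1"] by simp

lemma Cauchy_Schwarz:
  assumes F: "F \<in> H" and G: "G \<in> H"
  shows "cmod (ip F G) \<le> nrm F * nrm G"
proof (cases "nrm G = 0")
  case True
  then have "ip G G = 0" using ip_self[OF G] by simp
  then have "G = (\<lambda>x. 0)" using ip_definite G by blast
  then show ?thesis
    using ip_commute[OF F G] ip_zero[OF F] True by simp
next
  case False
  define s where "s = (nrm G)\<^sup>2"
  have s: "s > 0" using False by (simp add: s_def)
  define t where "t = ip F G / of_real s"
  have "0 \<le> (nrm (\<lambda>x. F x - t * G x))\<^sup>2" by simp
  also have "\<dots> = (nrm F)\<^sup>2 + (cmod t)\<^sup>2 * s - 2 * Re (cnj t * ip F G)"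
    using F G by (simp add: nrm_sq_diff scale_closed nrm_sq_scale ip_scale_right s_def)
  also have "cnj t * ip F G = of_real ((cmod (ip F G))\<^sup>2 / s)"
    unfolding t_def of_real_divide complex_norm_square by (simp add: mult.commute)
  also have "(cmod t)\<^sup>2 * s = (cmod (ip F G))\<^sup>2 / s"
    using s by (simp add: t_def norm_divide power_divide power2_eq_square)
  finally have "(cmod (ip F G))\<^sup>2 / s \<le> (nrm F)\<^sup>2" by simp
  then have "(cmod (ip F G))\<^sup>2 \<le> (nrm F * nrm G)\<^sup>2"
    using s by (simp add: s_def field_simps power_mult_distrib)
  then show ?thesis
    by (rule power2_le_imp_le[OF _ mult_nonneg_nonneg[OF nrm_nonneg[OF F] nrm_nonneg[OF G]]])
qed

end

text \<open>For a kernel \<open>K\<close>, the number \<open>kernel_form K S c\<close> is the squared norm of the combination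
  \<open>\<Sum>y\<in>S. c y * k\<^sub>y\<close>.  The predicate \<open>kernel_dominated\<close> says that the pairing of such
  combinations with \<open>g\<close> is a bounded functional.  Both depend on the kernel alone; this makes
  it possible to compare function spaces on different sets, of which only the kernels are known.\<close>

definition kernel_form :: "('a \<Rightarrow> 'a \<Rightarrow> complex) \<Rightarrow> 'a set \<Rightarrow> ('a \<Rightarrow> complex) \<Rightarrow> real" where
  "kernel_form K S c = Re (\<Sum>x\<in>S. \<Sum>y\<in>S. cnj (c x) * c y * K x y)"

definition kernel_dominated :: "'a set \<Rightarrow> ('a \<Rightarrow> 'a \<Rightarrow> complex) \<Rightarrow> ('a \<Rightarrow> complex) \<Rightarrow> bool" where
  "kernel_dominated V K g \<longleftrightarrow> (\<exists>C. \<forall>S c. finite S \<longrightarrow> S \<subseteq> V \<longrightarrow>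
     cmod (\<Sum>y\<in>S. cnj (c y) * g y) \<le> C * sqrt (kernel_form K S c))"

lemma sum_union_coeffs:
  fixes c c' :: "'a \<Rightarrow> complex"
  assumes "finite S" "finite T"
  shows "(\<Sum>y\<in>S. c y * p y) + (\<Sum>y\<in>T. c' y * p y)
    = (\<Sum>y\<in>S \<union> T. ((if y \<in> S then c y else 0) + (if y \<in> T then c' y else 0)) * p y)"
proof -
  have "(\<Sum>y\<in>S. c y * p y) = (\<Sum>y\<in>S \<union> T. (if y \<in> S then c y else 0) * p y)"
    using assms by (intro sum.mono_neutral_cong_left) auto
  moreover have "(\<Sum>y\<in>T. c' y * p y) = (\<Sum>y\<in>S \<union> T. (if y \<in> T then c' y else 0) * p y)"
    using assms by (intro sum.mono_neutral_cong_left) auto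
  ultimately show ?thesis by (simp add: sum.distrib distrib_right)
qed

context reproducing_kernel_hilbert_space
begin

definition comb :: "'a set \<Rightarrow> ('a \<Rightarrow> complex) \<Rightarrow> 'a \<Rightarrow> complex" where
  "comb S c = (\<lambda>x. \<Sum>y\<in>S. c y * kernel_fun X K y x)"

lemma comb_mem: "finite S \<Longrightarrow> S \<subseteq> X \<Longrightarrow> comb S c \<in> H"
  unfolding comb_def using kernel_mem by (intro sum_closed) (simp_all add: subset_iff)

lemma ip_comb:
  assumes "finite S" "S \<subseteq> X" "F \<in> H"
  shows "ip F (comb S c) = (\<Sum>y\<in>S. cnj (c y) * F y)"
  using assms unfolding comb_def
  by (subst ip_sum_right) (auto intro: kernel_mem sum.cong simp: reproducing subset_iff)

lemma nrm_comb:
  assumes "finite S" "S \<subseteq> X"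
  shows "nrm (comb S c) = sqrt (kernel_form K S c)"
proof -
  have "comb S c x = (\<Sum>y\<in>S. c y * K x y)" if "x \<in> S" for x
    using that assms by (auto simp: comb_def kernel_fun_def restr_def)
  then have "ip (comb S c) (comb S c) = (\<Sum>x\<in>S. \<Sum>y\<in>S. cnj (c x) * c y * K x y)"
    using ip_comb[OF assms comb_mem[OF assms]] by (simp add: sum_distrib_left mult.assoc)
  then show ?thesis by (simp add: ip_norm_def kernel_form_def)
qed

lemma kernel_form_nonneg: "finite S \<Longrightarrow> S \<subseteq> X \<Longrightarrow> 0 \<le> kernel_form K S c"
  using nrm_comb[of S c] nrm_nonneg[OF comb_mem, of S c] by simp

lemma pairing_le:
  assumes "finite S" "S \<subseteq> X" "F \<in> H"
  shows "cmod (\<Sum>y\<in>S. cnj (c y) * F y) \<le> nrm F * sqrt (kernel_form K S c)"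
  using Cauchy_Schwarz[OF assms(3) comb_mem[OF assms(1,2), of c]] ip_comb[OF assms, of c] nrm_comb[OF assms(1,2), of c]
  by simp

lemma norm_eval_le:
  assumes "F \<in> H" "y \<in> X"
  shows "cmod (F y) \<le> nrm F * nrm (kernel_fun X K y)"
  using Cauchy_Schwarz[OF assms(1) kernel_mem[OF assms(2)]] reproducing[OF assms(2,1)] by simp

text \<open>The Riesz representation theorem for the
  functional \<open>\<Sum>y\<in>S. c y * k\<^sub>y \<mapsto> \<Sum>y\<in>S. c y * cnj (g y)\<close>, proved by the direct method: the quadratic
  functional \<open>\<parallel>F\<parallel>\<^sup>2 - 2 Re l(F)\<close> is bounded below on the span, by the parallelogram law every
  minimising sequence is Cauchy, and the first variation in the direction \<open>k\<^sub>y\<close> shows that its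
  limit takes the value \<open>g y\<close> at \<open>y\<close>.\<close>

lemma mem_closure_of_dominated:
  assumes VX: "V \<subseteq> X" and dom: "kernel_dominated V K g"
  obtains G where "G \<in> H" "\<And>y. y \<in> V \<Longrightarrow> G y = g y"
    "\<And>e. e > 0 \<Longrightarrow> \<exists>S c. finite S \<and> S \<subseteq> V \<and> nrm (\<lambda>x. G x - comb S c x) < e"
proof -
  \<comment> \<open>Values are attached to combinations by a relation, so that different representations of the same function cause no trouble.\<close>
  define R where "R = {(comb S c, \<Sum>y\<in>S. cnj (c y) * g y) | S c. finite S \<and> S \<subseteq> V}"
  have R_mem: "F \<in> H" if "(F, l) \<in> R" for F l
    using that VX by (auto simp: R_def intro: comb_mem)
  obtain C where C: "\<And>F l. (F, l) \<in> R \<Longrightarrow> cmod l \<le> C * nrm F"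
  proof -
    obtain C where C: "\<And>S c. finite S \<Longrightarrow> S \<subseteq> V \<Longrightarrow>
      cmod (\<Sum>y\<in>S. cnj (c y) * g y) \<le> C * sqrt (kernel_form K S c)"
      using dom unfolding kernel_dominated_def by blast
    have "cmod l \<le> C * nrm F" if Fl: "(F, l) \<in> R" for F l
    proof -
      obtain S c where "F = comb S c" "l = (\<Sum>y\<in>S. cnj (c y) * g y)" "finite S" "S \<subseteq> V"
        using Fl by (auto simp: R_def)
      then show ?thesis using C VX nrm_comb[of S c] by auto
    qed
    then show thesis using that by blast
  qed
  have R_add: "(\<lambda>x. F x + G x, l + m) \<in> R" if FG: "(F, l) \<in> R" "(G, m) \<in> R" for F G l m
  proof -
    obtain S c where S: "F = comb S c" "l = (\<Sum>y\<in>S. cnj (c y) * g y)" "finite S" "S \<subseteq> V"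
      using FG(1) by (auto simp: R_def)
    obtain T d where T: "G = comb T d" "m = (\<Sum>y\<in>T. cnj (d y) * g y)" "finite T" "T \<subseteq> V"
      using FG(2) by (auto simp: R_def)
    define w where "w y = (if y \<in> S then c y else 0) + (if y \<in> T then d y else 0)" for y
    have "(\<lambda>x. F x + G x) = comb (S \<union> T) w"
      unfolding S T comb_def using S(3) T(3) by (simp add: sum_union_coeffs w_def)
    moreover have "cnj (w y) = (if y \<in> S then cnj (c y) else 0) + (if y \<in> T then cnj (d y) else 0)" for y
      by (simp add: w_def)
    then have "l + m = (\<Sum>y\<in>S \<union> T. cnj (w y) * g y)"
      unfolding S T using S(3) T(3) by (simp add: sum_union_coeffs)
    ultimately show ?thesis using S(3,4) T(3,4) unfolding R_def by blast
  qed
  have R_scale: "(\<lambda>x. t * F x, cnj t * l) \<in> R" if Fl: "(F, l) \<in> R" for F l t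
  proof -
    obtain S c where S: "F = comb S c" "l = (\<Sum>y\<in>S. cnj (c y) * g y)" "finite S" "S \<subseteq> V"
      using Fl by (auto simp: R_def)
    have "(\<lambda>x. t * F x) = comb S (\<lambda>y. t * c y)" "cnj t * l = (\<Sum>y\<in>S. cnj (t * c y) * g y)"
      unfolding S comb_def by (simp_all add: sum_distrib_left mult.assoc)
    then show ?thesis using S(3,4) unfolding R_def by blast
  qed
  have R_kernel: "(kernel_fun X K y, g y) \<in> R" if "y \<in> V" for y
  proof -
    have "kernel_fun X K y = comb {y} (\<lambda>_. 1)" "g y = (\<Sum>y\<in>{y}. cnj 1 * g y)"
      by (simp_all add: comb_def)
    then show ?thesis using that unfolding R_def by blast
  qed
  define q where "q = (\<lambda>(F, l). (nrm F)\<^sup>2 - 2 * Re l)"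
  define I where "I = Inf (q ` R)"
  \<comment> \<open>By domination, the functional is at least \<open>n\<^sup>2 - 2 C n\<close> with \<open>n\<close> the norm, and hence at least \<open>- C\<^sup>2\<close>.\<close>
  have lower: "- C\<^sup>2 \<le> q p" if "p \<in> R" for p
  proof -
    obtain F l where p: "p = (F, l)" by force
    have "Re l \<le> C * nrm F" using C that p complex_Re_le_cmod order_trans by blast
    moreover have "0 \<le> (nrm F - C)\<^sup>2" by simp
    ultimately show ?thesis by (simp add: q_def p power2_eq_square algebra_simps)
  qed
  have bdd: "bdd_below (q ` R)" using lower by (auto intro!: bdd_belowI)
  have I_le: "I \<le> q p" if "p \<in> R" for p
    unfolding I_def using bdd that by (auto intro: cInf_lower)
  have ne: "q ` R \<noteq> {}" by (auto simp: R_def)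
  have "\<exists>p\<in>R. q p < I + 1 / real (Suc n)" for n
    using cInf_lessD[OF ne, of "I + 1 / real (Suc n)"] by (auto simp: I_def)
  then obtain p where p: "\<And>n. p n \<in> R" "\<And>n. q (p n) < I + 1 / real (Suc n)"
    by metis
  define Gs where "Gs n = fst (p n)" for n
  define ls where "ls n = snd (p n)" for n
  have Gs: "(Gs n, ls n) \<in> R" "q (Gs n, ls n) < I + 1 / real (Suc n)" for n
    using p[of n] by (simp_all add: Gs_def ls_def)
  have GsH: "Gs n \<in> H" for n using R_mem Gs(1) by blast
  \<comment> \<open>Compare the functional at two terms of the sequence with its value at their midpoint.\<close>
  have close: "(nrm (\<lambda>x. Gs m x - Gs n x))\<^sup>2 \<le> 2 / real (Suc m) + 2 / real (Suc n)" for m n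
  proof -
    have "(\<lambda>x. (1/2) * (Gs m x + Gs n x), cnj (1/2) * (ls m + ls n)) \<in> R"
      using R_scale R_add Gs(1) by blast
    then have "I \<le> q (\<lambda>x. (1/2) * (Gs m x + Gs n x), cnj (1/2) * (ls m + ls n))"
      by (rule I_le)
    also have "\<dots> = (nrm (\<lambda>x. Gs m x + Gs n x))\<^sup>2 / 4 - (Re (ls m) + Re (ls n))"
      using nrm_sq_scale[OF add_closed[OF GsH GsH], of "1/2" m n] by (simp add: q_def power_divide add_divide_distrib)
    finally have *: "I \<le> (nrm (\<lambda>x. Gs m x + Gs n x))\<^sup>2 / 4 - (Re (ls m) + Re (ls n))" .
    have "(nrm (Gs m))\<^sup>2 - 2 * Re (ls m) < I + 1 / real (Suc m)"
      "(nrm (Gs n))\<^sup>2 - 2 * Re (ls n) < I + 1 / real (Suc n)"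
      using Gs(2) by (simp_all add: q_def)
    with * nrm_sq_add[OF GsH GsH, of m n] nrm_sq_diff[OF GsH GsH, of m n] show ?thesis
      by argo
  qed
  have "\<forall>e>0. \<exists>N. \<forall>m\<ge>N. \<forall>n\<ge>N. nrm (\<lambda>x. Gs m x - Gs n x) < e"
  proof (intro allI impI)
    fix e :: real assume e: "e > 0"
    obtain N where N: "4 / e\<^sup>2 < real N" using reals_Archimedean2 by blast
    have N0: "0 < real N" using N e by (meson divide_pos_pos order_less_trans zero_less_numeral zero_less_power)
    have "nrm (\<lambda>x. Gs m x - Gs n x) < e" if mn: "m \<ge> N" "n \<ge> N" for m n
    proof -
      have "2 / real (Suc m) \<le> 2 / real N" "2 / real (Suc n) \<le> 2 / real N"
        using mn N0 by (auto intro!: divide_left_mono mult_pos_pos)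
      then have "(nrm (\<lambda>x. Gs m x - Gs n x))\<^sup>2 \<le> 4 / real N"
        using close[of m n] by linarith
      also have "\<dots> < e\<^sup>2" using N N0 e by (simp add: divide_less_eq mult.commute)
      finally show ?thesis by (rule power_less_imp_less_base) (use e in simp)
    qed
    then show "\<exists>N. \<forall>m\<ge>N. \<forall>n\<ge>N. nrm (\<lambda>x. Gs m x - Gs n x) < e" by blast
  qed
  then obtain G where G: "G \<in> H" and lim: "(\<lambda>n. nrm (\<lambda>x. Gs n x - G x)) \<longlonglongrightarrow> 0"
    using complete[of Gs] GsH by blast
  have "G y = g y" if y: "y \<in> V" for y
  proof -
    have yX: "y \<in> X" using y VX by blast
    define k where "k = kernel_fun X K y"
    have k: "k \<in> H" unfolding k_def using kernel_mem yX by blast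
    define \<kappa> where "\<kappa> = (nrm k)\<^sup>2"
    have \<kappa>: "\<kappa> \<ge> 0" by (simp add: \<kappa>_def)
    \<comment> \<open>First variation: move from \<open>Gs n\<close> in the direction \<open>k\<close>, by the step for which the decrease of the functional would exceed its distance to the infimum if \<open>Gs n y\<close> were far from \<open>g y\<close>.\<close>
    have small: "(cmod (Gs n y - g y))\<^sup>2 \<le> (\<kappa> + 1) / real (Suc n)" for n
    proof -
      define d where "d = Gs n y - g y"
      define s where "s = 1 / (\<kappa> + 1)"
      define t where "t = - of_real s * d"
      have s: "0 < s" "s * \<kappa> \<le> 1" using \<kappa> by (auto simp: s_def field_simps)
      have "(\<lambda>x. Gs n x + t * k x, ls n + cnj t * g y) \<in> R"
        using R_add[OF Gs(1) R_scale[OF R_kernel[OF y]]] by (simp add: k_def)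
      then have "I \<le> q (\<lambda>x. Gs n x + t * k x, ls n + cnj t * g y)" by (rule I_le)
      also have "\<dots> = q (Gs n, ls n) + 2 * Re (cnj t * d) + (cmod t)\<^sup>2 * \<kappa>"
      proof -
        have "ip (Gs n) (\<lambda>x. t * k x) = cnj t * Gs n y"
          using ip_scale_right[OF k GsH] reproducing[OF yX GsH] by (simp add: k_def)
        then have "(nrm (\<lambda>x. Gs n x + t * k x))\<^sup>2
            = (nrm (Gs n))\<^sup>2 + (cmod t)\<^sup>2 * \<kappa> + 2 * Re (cnj t * Gs n y)"
          using nrm_sq_add[OF GsH scale_closed[OF k], of n t] nrm_sq_scale[OF k, of t]
          unfolding \<kappa>_def by metis
        then show ?thesis unfolding q_def d_def prod.case by (simp add: right_diff_distrib)
      qed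
      also have "Re (cnj t * d) = - s * (cmod d)\<^sup>2"
        by (simp add: t_def cmod_power2) (simp add: power2_eq_square algebra_simps)
      also have "(cmod t)\<^sup>2 = s\<^sup>2 * (cmod d)\<^sup>2"
        using s by (simp add: t_def norm_mult power_mult_distrib)
      finally have "2 * s * (cmod d)\<^sup>2 - (s * \<kappa>) * (s * (cmod d)\<^sup>2) \<le> 1 / real (Suc n)"
        using Gs(2)[of n] by (simp add: power2_eq_square algebra_simps)
      moreover have "(s * \<kappa>) * (s * (cmod d)\<^sup>2) \<le> 1 * (s * (cmod d)\<^sup>2)"
        using s by (intro mult_right_mono) auto
      ultimately have "s * (cmod d)\<^sup>2 \<le> 1 / real (Suc n)" by linarith
      then show ?thesis using \<kappa> by (simp add: s_def d_def field_simps)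
    qed
    have "(\<lambda>n. (\<kappa> + 1) / real (Suc n)) \<longlonglongrightarrow> 0"
      using tendsto_mult_right_zero[OF lim_inverse_n', of "\<kappa> + 1"]
      by (intro LIMSEQ_Suc) (simp add: field_simps)
    then have "(\<lambda>n. (cmod (Gs n y - g y))\<^sup>2) \<longlonglongrightarrow> 0"
      by (rule Lim_null_comparison[rotated]) (use small in auto)
    then have "(\<lambda>n. cmod (Gs n y - g y)) \<longlonglongrightarrow> 0"
      using tendsto_real_sqrt by fastforce
    then have 1: "(\<lambda>n. Gs n y) \<longlonglongrightarrow> g y"
      using LIM_zero_iff tendsto_norm_zero_iff by blast
    have "(\<lambda>n. nrm (\<lambda>x. Gs n x - G x) * nrm k) \<longlonglongrightarrow> 0"
      using tendsto_mult_left_zero[OF lim] by simp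
    then have "(\<lambda>n. Gs n y - G y) \<longlonglongrightarrow> 0"
      by (rule Lim_null_comparison[rotated])
        (use norm_eval_le[OF diff_closed[OF GsH G] yX] in \<open>auto simp: k_def\<close>)
    then have "(\<lambda>n. Gs n y) \<longlonglongrightarrow> G y" using LIM_zero_iff by blast
    with 1 show ?thesis using LIMSEQ_unique by blast
  qed
  moreover have "\<exists>S c. finite S \<and> S \<subseteq> V \<and> nrm (\<lambda>x. G x - comb S c x) < e" if "e > 0" for e
  proof -
    obtain n where n: "nrm (\<lambda>x. Gs n x - G x) < e"
      using order_tendstoD(2)[OF lim \<open>e > 0\<close>] by (meson eventually_at_top_linorder order_refl)
    obtain S c where S: "Gs n = comb S c" "finite S" "S \<subseteq> V"
      using Gs(1)[of n] by (auto simp: R_def)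
    have "nrm (\<lambda>x. G x - Gs n x) = nrm (\<lambda>x. Gs n x - G x)"
      using nrm_scale[OF diff_closed[OF GsH G], of "-1" n] by simp
    then show ?thesis using n S by metis
  qed
  ultimately show thesis using that G by blast
qed

text \<open>The restrictions to \<open>V\<close> of the functions in the closed span of the kernels at points of \<open>V\<close>
  form the function space on \<open>V\<close> that belongs to the restricted kernel; the right-hand side does
  not mention the ambient space any more.\<close>

lemma closed_kernel_span_iff:
  assumes "V \<subseteq> X"
  shows "restr V ` {F \<in> H. \<forall>e>0. \<exists>G\<in>{comb S c | S c. finite S \<and> S \<subseteq> V}. nrm (\<lambda>x. F x - G x) < e}
    = {g \<in> functions_on V. kernel_dominated V K g}"
    (is "restr V ` ?N = ?B")
proof (intro equalityI subsetI)
  fix g assume "g \<in> restr V ` ?N"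
  then obtain F where F: "F \<in> H" "g = restr V F" by blast
  have "cmod (\<Sum>y\<in>S. cnj (c y) * g y) \<le> nrm F * sqrt (kernel_form K S c)" if "finite S" "S \<subseteq> V" for S c
  proof -
    have "(\<Sum>y\<in>S. cnj (c y) * g y) = (\<Sum>y\<in>S. cnj (c y) * F y)"
      using that by (intro sum.cong) (auto simp: F restr_def)
    then show ?thesis using pairing_le[of S F c] that assms F by auto
  qed
  then show "g \<in> ?B" unfolding kernel_dominated_def F by (auto simp: functions_on_def restr_def)
next
  fix g assume g: "g \<in> ?B"
  obtain G where G: "G \<in> H" "\<And>y. y \<in> V \<Longrightarrow> G y = g y"
    "\<And>e. e > 0 \<Longrightarrow> \<exists>S c. finite S \<and> S \<subseteq> V \<and> nrm (\<lambda>x. G x - comb S c x) < e"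
    using mem_closure_of_dominated[OF assms, of g] g by blast
  have "g = restr V G" using G(2) g by (auto simp: restr_def functions_on_def)
  moreover have "G \<in> ?N" using G(1,3) by blast
  ultimately show "g \<in> restr V ` ?N" by blast
qed

lemma mem_iff_dominated: "F \<in> H \<longleftrightarrow> F \<in> functions_on X \<and> kernel_dominated X K F"
proof
  assume "F \<in> H"
  then show "F \<in> functions_on X \<and> kernel_dominated X K F"
    using subset_functions_on pairing_le unfolding kernel_dominated_def by blast
next
  assume F: "F \<in> functions_on X \<and> kernel_dominated X K F"
  then obtain G where G: "G \<in> H" "\<And>y. y \<in> X \<Longrightarrow> G y = F y"
    using mem_closure_of_dominated[OF subset_refl, of F] by metis
  have "G x = F x" for x
    using G F subset_functions_on by (cases "x \<in> X") (auto simp: functions_on_def)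
  then have "G = F" by blast
  then show "F \<in> H" using G by simp
qed

text \<open>The dominating constants of the terms add up to one of the
  sum, so pointwise convergence is enough.\<close>

lemma series_mem:
  assumes F: "\<And>n::nat. F n \<in> H" and summ: "summable (\<lambda>n. nrm (F n))"
    and G: "G \<in> functions_on X" and sums: "\<And>x. x \<in> X \<Longrightarrow> (\<lambda>n. F n x) sums G x"
  shows "G \<in> H"
proof -
  have "cmod (\<Sum>y\<in>S. cnj (c y) * G y) \<le> (\<Sum>n. nrm (F n)) * sqrt (kernel_form K S c)"
    if S: "finite S" "S \<subseteq> X" for S c
  proof -
    have *: "(\<lambda>n. \<Sum>y\<in>S. cnj (c y) * F n y) sums (\<Sum>y\<in>S. cnj (c y) * G y)"
      using S sums by (intro sums_sum sums_mult) auto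
    have le: "cmod (\<Sum>y\<in>S. cnj (c y) * F n y) \<le> nrm (F n) * sqrt (kernel_form K S c)" for n
      using pairing_le S F by blast
    have sm: "summable (\<lambda>n. nrm (F n) * sqrt (kernel_form K S c))" using summ by (rule summable_mult2)
    have sc: "summable (\<lambda>n. cmod (\<Sum>y\<in>S. cnj (c y) * F n y))"
      using sm le by (intro summable_comparison_test'[OF sm, of 0]) auto
    have "cmod (\<Sum>y\<in>S. cnj (c y) * G y) \<le> (\<Sum>n. cmod (\<Sum>y\<in>S. cnj (c y) * F n y))"
      using summable_norm[OF sc] sums_unique[OF *] by simp
    also have "\<dots> \<le> (\<Sum>n. nrm (F n) * sqrt (kernel_form K S c))"
      by (intro suminf_le le sc sm)
    also have "\<dots> = (\<Sum>n. nrm (F n)) * sqrt (kernel_form K S c)"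
      using suminf_mult2[OF summ] by simp
    finally show ?thesis .
  qed
  then show ?thesis using G by (subst mem_iff_dominated) (auto simp: kernel_dominated_def)
qed

end

section \<open>Multipliers of the Drury-Arveson space and embedded discs as varieties\<close>

context hilbert_function_space
begin

lemma multiplier_one: "restr X (\<lambda>x. 1) \<in> multiplier_algebra X H"
proof -
  have "(\<lambda>x. restr X (\<lambda>x. 1) x * F x) = F" if "F \<in> H" for F
    using that subset_functions_on by (intro ext) (auto simp: restr_def functions_on_def)
  then show ?thesis by (auto simp: multiplier_algebra_def functions_on_def restr_def)
qed

lemma multiplier_add:
  assumes "g \<in> multiplier_algebra X H" "h \<in> multiplier_algebra X H"
  shows "(\<lambda>x. g x + h x) \<in> multiplier_algebra X H"
proof -
  have "(\<lambda>x. (g x + h x) * F x) \<in> H" if "F \<in> H" for F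
    using add_closed[of "\<lambda>x. g x * F x" "\<lambda>x. h x * F x"] assms that
    by (simp add: multiplier_algebra_def distrib_right)
  then show ?thesis using assms by (auto simp: multiplier_algebra_def functions_on_def)
qed

lemma multiplier_scale:
  assumes "h \<in> multiplier_algebra X H"
  shows "(\<lambda>x. c * h x) \<in> multiplier_algebra X H"
proof -
  have "(\<lambda>x. (c * h x) * F x) \<in> H" if "F \<in> H" for F
    using scale_closed[of "\<lambda>x. h x * F x" c] assms that
    by (simp add: multiplier_algebra_def mult.assoc)
  then show ?thesis using assms by (auto simp: multiplier_algebra_def functions_on_def)
qed

lemma multiplier_mult:
  assumes "g \<in> multiplier_algebra X H" "h \<in> multiplier_algebra X H"
  shows "(\<lambda>x. g x * h x) \<in> multiplier_algebra X H"
proof -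
  have "(\<lambda>x. g x * (h x * F x)) \<in> H" if "F \<in> H" for F
    using assms that by (simp add: multiplier_algebra_def)
  then show ?thesis using assms by (auto simp: multiplier_algebra_def functions_on_def mult.assoc)
qed

lemma multiplier_power:
  assumes "restr X p \<in> multiplier_algebra X H"
  shows "restr X (\<lambda>x. p x ^ n) \<in> multiplier_algebra X H"
proof (induction n)
  case 0
  then show ?case using multiplier_one by simp
next
  case (Suc n)
  have "restr X (\<lambda>x. p x ^ Suc n) = (\<lambda>x. restr X p x * restr X (\<lambda>x. p x ^ n) x)"
    by (auto simp: restr_def)
  then show ?case using multiplier_mult[OF assms Suc] by simp
qed

end

context reproducing_kernel_hilbert_space
begin

text \<open>The hypothesis says that \<open>k\<^sub>y \<mapsto> cnj (h y) * k\<^sub>y\<close> is contractive on combinations of kernels; this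
  map is the adjoint of multiplication by \<open>h\<close>.\<close>

lemma multiplier_of_kernel_form_le:
  assumes h: "h \<in> functions_on X"
    and le: "\<And>S c. finite S \<Longrightarrow> S \<subseteq> X \<Longrightarrow> kernel_form K S (\<lambda>y. cnj (h y) * c y) \<le> kernel_form K S c"
  shows "h \<in> multiplier_algebra X H"
proof -
  have "(\<lambda>x. h x * F x) \<in> H" if F: "F \<in> H" for F
  proof (subst mem_iff_dominated, intro conjI)
    show "(\<lambda>x. h x * F x) \<in> functions_on X" using h by (simp add: functions_on_def)
    have "cmod (\<Sum>y\<in>S. cnj (c y) * (h y * F y)) \<le> nrm F * sqrt (kernel_form K S c)"
      if S: "finite S" "S \<subseteq> X" for S c
    proof -
      have "cmod (\<Sum>y\<in>S. cnj (cnj (h y) * c y) * F y)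
          \<le> nrm F * sqrt (kernel_form K S (\<lambda>y. cnj (h y) * c y))"
        by (rule pairing_le[OF S F])
      also have "\<dots> \<le> nrm F * sqrt (kernel_form K S c)"
        using le[OF S] nrm_nonneg[OF F] by (intro mult_left_mono) auto
      finally show ?thesis by (simp add: mult_ac)
    qed
    then show "kernel_dominated X K (\<lambda>x. h x * F x)" unfolding kernel_dominated_def by blast
  qed
  then show ?thesis using h by (simp add: multiplier_algebra_def)
qed

end

lemma ell2_ball_sums:
  assumes "x \<in> ell2_ball"
  shows "summable (\<lambda>i. (cmod (x i))\<^sup>2)" "(\<Sum>i. (cmod (x i))\<^sup>2) < 1"
  using assms by (auto simp: ell2_ball_def ell2_def ell2_norm_def)

lemma ell2_inner_ball:
  assumes x: "x \<in> ell2_ball" and y: "y \<in> ell2_ball"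
  shows "(\<lambda>i. x i * cnj (y i)) sums ell2_inner x y" "cmod (ell2_inner x y) < 1"
proof -
  note sx = ell2_ball_sums[OF x] and sy = ell2_ball_sums[OF y]
  define m where "m i = ((cmod (x i))\<^sup>2 + (cmod (y i))\<^sup>2) / 2" for i
  have le: "cmod (x i * cnj (y i)) \<le> m i" for i
    using sum_squares_bound[of "cmod (x i)" "cmod (y i)"] by (simp add: m_def norm_mult)
  have m: "summable m" unfolding m_def by (intro summable_divide summable_add sx sy)
  have sc: "summable (\<lambda>i. cmod (x i * cnj (y i)))"
    by (rule summable_comparison_test'[OF m, of 0]) (use le in simp)
  show "(\<lambda>i. x i * cnj (y i)) sums ell2_inner x y"
    unfolding ell2_inner_def by (intro summable_sums summable_norm_cancel[OF sc])
  have "cmod (ell2_inner x y) \<le> (\<Sum>i. cmod (x i * cnj (y i)))"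
    unfolding ell2_inner_def by (rule summable_norm[OF sc])
  also have "\<dots> \<le> suminf m" by (intro suminf_le le sc m)
  also have "\<dots> = ((\<Sum>i. (cmod (x i))\<^sup>2) + (\<Sum>i. (cmod (y i))\<^sup>2)) / 2"
    unfolding m_def by (simp add: suminf_divide suminf_add sx sy summable_add)
  also have "\<dots> < 1" using sx sy by simp
  finally show "cmod (ell2_inner x y) < 1" .
qed

text \<open>Coordinate multiplications are contractive, even jointly as a row.  Indeed \<open>k = 1 + \<langle>x, y\<rangle> k\<close> for the
  Drury-Arveson kernel, and expanding \<open>\<langle>x, y\<rangle>\<close> gives
  \<open>\<parallel>\<Sum> c\<^sub>y k\<^sub>y\<parallel>\<^sup>2 = \<bar>\<Sum> c\<^sub>y\<bar>\<^sup>2 + (\<Sum>j. \<parallel>\<Sum> cnj (y j) c\<^sub>y k\<^sub>y\<parallel>\<^sup>2)\<close>, where all terms are nonnegative;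
  the left-hand side of the claim is one of them.\<close>

lemma da_kernel_coord_le:
  assumes "drury_arveson H ip" and S: "finite S" "S \<subseteq> ell2_ball"
  shows "kernel_form da_kernel S (\<lambda>y. cnj (y i) * c y) \<le> kernel_form da_kernel S c"
proof -
  interpret reproducing_kernel_hilbert_space ell2_ball da_kernel H ip
    using assms(1) by (simp add: drury_arveson_def)
  let ?w = "\<lambda>j y. cnj (y j) * c y"
  have entry: "(\<lambda>j. cnj (?w j x) * ?w j y * da_kernel x y) sums (cnj (c x) * c y * da_kernel x y - cnj (c x) * c y)"
    if "x \<in> S" "y \<in> S" for x y
  proof -
    have xy: "x \<in> ell2_ball" "y \<in> ell2_ball" using that S by auto
    have "ell2_inner x y \<noteq> 1" using ell2_inner_ball(2)[OF xy] by auto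
    then have "ell2_inner x y * da_kernel x y = da_kernel x y - 1"
      by (simp add: da_kernel_def field_simps)
    define A where "A = cnj (c x) * c y"
    have "A * da_kernel x y * ell2_inner x y = A * (ell2_inner x y * da_kernel x y)"
      by (simp only: mult_ac)
    also have "\<dots> = A * da_kernel x y - A"
      unfolding \<open>ell2_inner x y * da_kernel x y = da_kernel x y - 1\<close> by (simp add: right_diff_distrib)
    finally have eq: "A * da_kernel x y * ell2_inner x y = A * da_kernel x y - A" .
    have "(\<lambda>j. A * da_kernel x y * (x j * cnj (y j))) sums (A * da_kernel x y - A)"
      using sums_mult[OF ell2_inner_ball(1)[OF xy], of "A * da_kernel x y"] unfolding eq .
    moreover have "A * da_kernel x y * (x j * cnj (y j)) = cnj (?w j x) * ?w j y * da_kernel x y" for j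
      by (simp add: A_def)
    ultimately have "(\<lambda>j. cnj (?w j x) * ?w j y * da_kernel x y) sums (A * da_kernel x y - A)"
      by (simp only:)
    then show ?thesis unfolding A_def .
  qed
  have "(\<lambda>j. \<Sum>x\<in>S. \<Sum>y\<in>S. cnj (?w j x) * ?w j y * da_kernel x y)
      sums (\<Sum>x\<in>S. \<Sum>y\<in>S. cnj (c x) * c y * da_kernel x y - cnj (c x) * c y)"
    by (rule sums_sum, rule sums_sum, rule entry)
  then have "(\<lambda>j. Re (\<Sum>x\<in>S. \<Sum>y\<in>S. cnj (?w j x) * ?w j y * da_kernel x y))
      sums Re (\<Sum>x\<in>S. \<Sum>y\<in>S. cnj (c x) * c y * da_kernel x y - cnj (c x) * c y)"
    by (rule sums_Re)
  moreover have "Re (\<Sum>x\<in>S. \<Sum>y\<in>S. cnj (c x) * c y * da_kernel x y - cnj (c x) * c y)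
      = kernel_form da_kernel S c - (cmod (\<Sum>y\<in>S. c y))\<^sup>2"
  proof -
    have "(\<Sum>x\<in>S. \<Sum>y\<in>S. cnj (c x) * c y) = cnj (\<Sum>y\<in>S. c y) * (\<Sum>y\<in>S. c y)"
      by (simp add: sum_product)
    also have "\<dots> = of_real ((cmod (\<Sum>y\<in>S. c y))\<^sup>2)"
      unfolding complex_norm_square by (simp add: mult.commute)
    finally have "Re (\<Sum>x\<in>S. \<Sum>y\<in>S. cnj (c x) * c y) = (cmod (\<Sum>y\<in>S. c y))\<^sup>2"
      by (simp only: Re_complex_of_real)
    then show ?thesis by (simp only: kernel_form_def sum_subtractf minus_complex.sel)
  qed
  ultimately have sums: "(\<lambda>j. kernel_form da_kernel S (?w j)) sums (kernel_form da_kernel S c - (cmod (\<Sum>y\<in>S. c y))\<^sup>2)"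
    by (simp only: kernel_form_def)
  have "kernel_form da_kernel S (?w i) = (\<Sum>j\<in>{i}. kernel_form da_kernel S (?w j))" by simp
  also have "\<dots> \<le> (\<Sum>j. kernel_form da_kernel S (?w j))"
    using sums S by (intro sum_le_suminf) (auto simp: sums_iff intro: kernel_form_nonneg)
  also have "\<dots> \<le> kernel_form da_kernel S c"
    using sums_unique[OF sums] zero_le_power2[of "cmod (\<Sum>y\<in>S. c y)"] by linarith
  finally show ?thesis .
qed

lemma coordinate_multiplier:
  assumes "drury_arveson H ip"
  shows "restr ell2_ball (\<lambda>x. x i) \<in> multiplier_algebra ell2_ball H"
proof -
  interpret reproducing_kernel_hilbert_space ell2_ball da_kernel H ip
    using assms(1) by (simp add: drury_arveson_def)
  show ?thesis
  proof (rule multiplier_of_kernel_form_le)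
    show "restr ell2_ball (\<lambda>x. x i) \<in> functions_on ell2_ball" by (simp add: functions_on_def restr_def)
    fix S and c :: "(nat \<Rightarrow> complex) \<Rightarrow> complex" assume S: "finite S" "S \<subseteq> ell2_ball"
    have "kernel_form da_kernel S (\<lambda>y. cnj (restr ell2_ball (\<lambda>x. x i) y) * c y)
        = kernel_form da_kernel S (\<lambda>y. cnj (y i) * c y)"
      unfolding kernel_form_def using S by (intro arg_cong[of _ _ Re] sum.cong) (auto simp: restr_def)
    then show "kernel_form da_kernel S (\<lambda>y. cnj (restr ell2_ball (\<lambda>x. x i) y) * c y) \<le> kernel_form da_kernel S c"
      using da_kernel_coord_le[OF assms S] by simp
  qed
qed

lemma inj_disc_embedding: "b 0 \<noteq> 0 \<Longrightarrow> inj (disc_embedding b)"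
proof (rule injI)
  fix z w assume "b 0 \<noteq> 0" "disc_embedding b z = disc_embedding b w"
  then show "z = w" by (auto simp: disc_embedding_def dest!: fun_cong[of _ _ 0])
qed

lemma unit_ell2_sums:
  assumes "b \<in> ell2" "ell2_norm b = 1"
  shows "(\<lambda>i. (cmod (b i))\<^sup>2) sums 1"
  using assms by (auto simp: ell2_def ell2_norm_def sums_iff)

lemma disc_embedding_in_ball:
  assumes b: "b \<in> ell2" "ell2_norm b = 1" and z: "z \<in> ball 0 1"
  shows "disc_embedding b z \<in> ell2_ball"
proof -
  note b1 = unit_ell2_sums[OF b]
  have le: "(cmod (disc_embedding b z i))\<^sup>2 \<le> (cmod z)\<^sup>2 * (cmod (b i))\<^sup>2" for i
  proof -
    have "cmod z ^ Suc i \<le> cmod z ^ 1" using z by (intro power_decreasing) auto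
    then have "cmod (disc_embedding b z i) \<le> cmod z * cmod (b i)"
      using mult_right_mono[of "cmod z ^ Suc i" "cmod z" "cmod (b i)"]
      by (simp add: disc_embedding_def norm_mult norm_power mult.commute)
    then have "(cmod (disc_embedding b z i))\<^sup>2 \<le> (cmod z * cmod (b i))\<^sup>2" by (rule power_mono) simp
    then show ?thesis by (simp add: power_mult_distrib)
  qed
  have sm: "(\<lambda>i. (cmod z)\<^sup>2 * (cmod (b i))\<^sup>2) sums ((cmod z)\<^sup>2 * 1)" by (intro sums_mult b1)
  have s: "summable (\<lambda>i. (cmod (disc_embedding b z i))\<^sup>2)"
    by (rule summable_comparison_test'[OF sums_summable[OF sm], of 0]) (use le in simp)
  have "(\<Sum>i. (cmod (disc_embedding b z i))\<^sup>2) \<le> (\<Sum>i. (cmod z)\<^sup>2 * (cmod (b i))\<^sup>2)"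
    by (intro suminf_le le s sums_summable[OF sm])
  also have "\<dots> = (cmod z)\<^sup>2" using sums_unique[OF sm] by simp
  also have "\<dots> < 1" using z by (simp add: power_less_one_iff abs_square_less_1)
  finally show ?thesis using s by (simp add: ell2_ball_def ell2_def ell2_norm_def real_sqrt_lt_1_iff)
qed

lemma embedded_disc_subset: "b \<in> ell2 \<Longrightarrow> ell2_norm b = 1 \<Longrightarrow> embedded_disc b \<subseteq> ell2_ball"
  using disc_embedding_in_ball by (auto simp: embedded_disc_def)

text \<open>The disc is cut out by the equations \<open>b\<^sub>1\<^sup>n x\<^sub>n = b\<^sub>n x\<^sub>1\<^sup>n\<close>.  They force \<open>x\<^sub>n = b\<^sub>n z\<^sup>n\<close> with
  \<open>z = x\<^sub>1 / b\<^sub>1\<close>, and \<open>\<parallel>b\<parallel> = 1\<close> excludes \<open>\<bar>z\<bar> \<ge> 1\<close> for points of the ball.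
  Indices are counted from one here.\<close>

lemma embedded_disc_variety:
  assumes DA: "drury_arveson H ip" and b: "b \<in> ell2" "ell2_norm b = 1" "b 0 \<noteq> 0"
  shows "variety H (embedded_disc b)"
proof -
  interpret reproducing_kernel_hilbert_space ell2_ball da_kernel H ip
    using DA by (simp add: drury_arveson_def)
  define h where "h n = restr ell2_ball (\<lambda>x. b 0 ^ Suc n * x n - b n * x 0 ^ Suc n)" for n
  have h: "h n \<in> multiplier_algebra ell2_ball H" for n
  proof -
    have "h n = (\<lambda>x. b 0 ^ Suc n * restr ell2_ball (\<lambda>x. x n) x + (- b n) * restr ell2_ball (\<lambda>x. x 0 ^ Suc n) x)"
      by (auto simp: h_def restr_def)
    then show ?thesis
      using multiplier_add[OF multiplier_scale[OF coordinate_multiplier[OF DA]]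
          multiplier_scale[OF multiplier_power[OF coordinate_multiplier[OF DA]]], of "b 0 ^ Suc n" n "- b n" 0 "Suc n"]
      by (simp only:)
  qed
  have "embedded_disc b = {x \<in> ell2_ball. \<forall>g\<in>range h. g x = 0}"
  proof (intro equalityI subsetI)
    fix x assume x: "x \<in> embedded_disc b"
    then have "x \<in> ell2_ball" using embedded_disc_subset b by blast
    moreover obtain z where "x = disc_embedding b z" using x by (auto simp: embedded_disc_def)
    ultimately show "x \<in> {x \<in> ell2_ball. \<forall>g\<in>range h. g x = 0}"
      by (auto simp: h_def restr_def disc_embedding_def power_mult_distrib)
  next
    fix x assume "x \<in> {x \<in> ell2_ball. \<forall>g\<in>range h. g x = 0}"
    then have x: "x \<in> ell2_ball" and eq: "\<And>n. b 0 ^ Suc n * x n = b n * x 0 ^ Suc n"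
      by (auto simp: h_def restr_def)
    define z where "z = x 0 / b 0"
    have xz: "x n = b n * z ^ Suc n" for n
      using eq[of n] b(3) by (simp add: z_def power_divide field_simps)
    have "cmod z < 1"
    proof (rule ccontr)
      assume "\<not> cmod z < 1"
      then have z1: "1 \<le> cmod z ^ Suc i" for i by (intro one_le_power) simp
      have "cmod (b i) * 1 \<le> cmod (x i)" for i
        unfolding xz norm_mult norm_power using z1 by (intro mult_left_mono) auto
      then have "(cmod (b i))\<^sup>2 \<le> (cmod (x i))\<^sup>2" for i by (simp add: power_mono)
      then have "(\<Sum>i. (cmod (b i))\<^sup>2) \<le> (\<Sum>i. (cmod (x i))\<^sup>2)"
        using unit_ell2_sums[OF b(1,2)] ell2_ball_sums[OF x] by (intro suminf_le) (auto simp: sums_iff)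
      then show False using unit_ell2_sums[OF b(1,2)] ell2_ball_sums[OF x] by (simp add: sums_iff)
    qed
    then show "x \<in> embedded_disc b"
      unfolding embedded_disc_def by (intro image_eqI[of _ _ z]) (auto simp: disc_embedding_def xz)
  qed
  then show ?thesis unfolding variety_def using h by (intro exI[of _ "range h"]) auto
qed

lemma kernel_dominated_cong:
  assumes "\<And>x. x \<in> V \<Longrightarrow> g x = h x"
  shows "kernel_dominated V K g \<longleftrightarrow> kernel_dominated V K h"
proof -
  have "(\<Sum>y\<in>S. cnj (c y) * g y) = (\<Sum>y\<in>S. cnj (c y) * h y)" if "S \<subseteq> V" for S and c :: "'a \<Rightarrow> complex"
    using that assms by (intro sum.cong) auto
  then show ?thesis unfolding kernel_dominated_def by simp
qed

lemma kernel_dominated_pullback: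
  assumes inj: "inj_on f D" and L: "\<And>z w. z \<in> D \<Longrightarrow> w \<in> D \<Longrightarrow> K (f z) (f w) = L z w"
  shows "kernel_dominated (f ` D) K g \<longleftrightarrow> kernel_dominated D L (g \<circ> f)"
proof -
  have sum_eq: "(\<Sum>y\<in>f ` T. cnj (c y) * g y) = (\<Sum>z\<in>T. cnj (c (f z)) * (g \<circ> f) z)"
    and form_eq: "kernel_form K (f ` T) c = kernel_form L T (c \<circ> f)" if "T \<subseteq> D" for T c
  proof -
    have "inj_on f T" using inj that inj_on_subset by blast
    then show "(\<Sum>y\<in>f ` T. cnj (c y) * g y) = (\<Sum>z\<in>T. cnj (c (f z)) * (g \<circ> f) z)"
      "kernel_form K (f ` T) c = kernel_form L T (c \<circ> f)"
      using that L by (auto simp: kernel_form_def sum.reindex subset_iff intro!: arg_cong[of _ _ Re] sum.cong)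
  qed
  show ?thesis
  proof
    assume "kernel_dominated (f ` D) K g"
    then obtain C where C: "\<And>S c. finite S \<Longrightarrow> S \<subseteq> f ` D \<Longrightarrow>
        cmod (\<Sum>y\<in>S. cnj (c y) * g y) \<le> C * sqrt (kernel_form K S c)"
      unfolding kernel_dominated_def by blast
    have "cmod (\<Sum>z\<in>T. cnj (c z) * (g \<circ> f) z) \<le> C * sqrt (kernel_form L T c)" if T: "finite T" "T \<subseteq> D" for T c
    proof -
      define d where "d = c \<circ> inv_into D f"
      have d: "d (f z) = c z" if "z \<in> T" for z using that T inj by (auto simp: d_def)
      have "(\<Sum>z\<in>T. cnj (d (f z)) * (g \<circ> f) z) = (\<Sum>z\<in>T. cnj (c z) * (g \<circ> f) z)"
        using d by (intro sum.cong) auto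
      moreover have "kernel_form L T (d \<circ> f) = kernel_form L T c"
        unfolding kernel_form_def using d by (intro arg_cong[of _ _ Re] sum.cong) auto
      ultimately show ?thesis using C[of "f ` T" d] sum_eq[OF T(2), of d] form_eq[OF T(2), of d] T by auto
    qed
    then show "kernel_dominated D L (g \<circ> f)" unfolding kernel_dominated_def by blast
  next
    assume "kernel_dominated D L (g \<circ> f)"
    then obtain C where C: "\<And>T c. finite T \<Longrightarrow> T \<subseteq> D \<Longrightarrow>
        cmod (\<Sum>z\<in>T. cnj (c z) * (g \<circ> f) z) \<le> C * sqrt (kernel_form L T c)"
      unfolding kernel_dominated_def by blast
    have "cmod (\<Sum>y\<in>S. cnj (c y) * g y) \<le> C * sqrt (kernel_form K S c)" if S: "finite S" "S \<subseteq> f ` D" for S c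
    proof -
      obtain T where T: "finite T" "T \<subseteq> D" "S = f ` T" using S by (meson finite_subset_image)
      then show ?thesis using C[of T "c \<circ> f"] sum_eq[OF T(2), of c] form_eq[OF T(2), of c] by auto
    qed
    then show "kernel_dominated (f ` D) K g" unfolding kernel_dominated_def by blast
  qed
qed

lemma space_on_iff:
  assumes DA: "drury_arveson H ip" and V: "V \<subseteq> ell2_ball"
  shows "space_on H ip V = {g \<in> functions_on V. kernel_dominated V da_kernel g}"
proof -
  interpret reproducing_kernel_hilbert_space ell2_ball da_kernel H ip
    using DA by (simp add: drury_arveson_def)
  have "kernel_span V = {comb S c | S c. finite S \<and> S \<subseteq> V}"
    unfolding kernel_span_def comb_def by blast
  then show ?thesis using closed_kernel_span_iff[OF V] by (simp add: space_on_def)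
qed

section \<open>Weighted Hardy spaces of the disc\<close>

abbreviation \<D> :: "complex set" where "\<D> \<equiv> ball 0 1"

definition taylor :: "(complex \<Rightarrow> complex) \<Rightarrow> nat \<Rightarrow> complex" where
  "taylor F n = (deriv ^^ n) F 0 / fact n"

lemma taylor_sums:
  assumes "F holomorphic_on \<D>" "z \<in> \<D>"
  shows "(\<lambda>n. taylor F n * z ^ n) sums F z"
  using holomorphic_power_series[OF assms] by (simp add: taylor_def)

lemma taylor_unique:
  assumes "\<And>z. z \<in> \<D> \<Longrightarrow> (\<lambda>n. c n * z ^ n) sums F z"
  shows "F holomorphic_on \<D>" "taylor F = c"
proof -
  show "F holomorphic_on \<D>"
    using power_series_holomorphic[of 0 1 c F] assms by simp
  have "eventually (\<lambda>u. u \<in> \<D>) (nhds (0::complex))"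
    by (intro eventually_nhds_in_open) auto
  then have "F has_fps_expansion (Abs_fps c)"
    by (intro has_fps_expansionI) (auto elim!: eventually_mono intro: assms)
  from fps_nth_fps_expansion[OF this] show "taylor F = c"
    by (intro ext) (simp add: taylor_def)
qed

lemma taylor_add:
  assumes "F holomorphic_on \<D>" "G holomorphic_on \<D>"
  shows "taylor (\<lambda>z. F z + G z) n = taylor F n + taylor G n"
proof -
  have "taylor (\<lambda>z. F z + G z) = (\<lambda>n. taylor F n + taylor G n)"
    using sums_add[OF taylor_sums[OF assms(1)] taylor_sums[OF assms(2)]]
    by (intro taylor_unique) (simp add: distrib_right)
  then show ?thesis by simp
qed

lemma taylor_scale:
  assumes "F holomorphic_on \<D>"
  shows "taylor (\<lambda>z. c * F z) n = c * taylor F n"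
proof -
  have "taylor (\<lambda>z. c * F z) = (\<lambda>n. c * taylor F n)"
    using sums_mult[OF taylor_sums[OF assms]]
    by (intro taylor_unique) (simp add: mult.assoc)
  then show ?thesis by simp
qed

lemma taylor_diff:
  assumes "F holomorphic_on \<D>" "G holomorphic_on \<D>"
  shows "taylor (\<lambda>z. F z - G z) n = taylor F n - taylor G n"
  using taylor_add[OF assms(1), of "\<lambda>z. - 1 * G z" n] taylor_scale[OF assms(2), of "-1" n] assms
  by (simp add: holomorphic_on_minus)

lemma taylor_shift:
  assumes "F holomorphic_on \<D>"
  shows "taylor (\<lambda>z. z ^ k * F z) n = (if n < k then 0 else taylor F (n - k))"
proof -
  have "taylor (\<lambda>z. z ^ k * F z) = (\<lambda>n. if n < k then 0 else taylor F (n - k))"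
  proof (rule taylor_unique)
    fix z :: complex assume z: "z \<in> \<D>"
    have "(\<lambda>n. z ^ k * (taylor F n * z ^ n)) sums (z ^ k * F z)"
      by (intro sums_mult taylor_sums assms z)
    also have "(\<lambda>n. z ^ k * (taylor F n * z ^ n))
        = (\<lambda>n. (if n + k < k then 0 else taylor F (n + k - k)) * z ^ (n + k))"
      by (auto simp: power_add)
    finally have "(\<lambda>n. (if n + k < k then 0 else taylor F (n + k - k)) * z ^ (n + k)) sums (z ^ k * F z)" .
    then show "(\<lambda>n. (if n < k then 0 else taylor F (n - k)) * z ^ n) sums (z ^ k * F z)"
      by (subst (asm) sums_zero_iff_shift) auto
  qed
  then show ?thesis by simp
qed

text \<open>The properties of a renewal sequence on which everything below rests.  The inequality
  \<open>supermult\<close> bounds the multiplier norm of the monomial \<open>z\<^sup>n\<close> by \<open>1 / sqrt (a n)\<close>, and \<open>subexp\<close>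
  keeps the spectrum of the coordinate multiplication inside the closed unit disc.\<close>

locale renewal_weight =
  fixes a :: "nat \<Rightarrow> real"
  assumes pos: "0 < a n"
    and le_one: "a n \<le> 1"
    and supermult: "a m * a n \<le> a (m + n)"
    and subexp: "\<lbrakk>0 < r; r < 1\<rbrakk> \<Longrightarrow> summable (\<lambda>n. r ^ n / sqrt (a n))"

definition weighted_hardy :: "(nat \<Rightarrow> real) \<Rightarrow> (complex \<Rightarrow> complex) set" where
  "weighted_hardy a = {F \<in> functions_on \<D>. F holomorphic_on \<D> \<and> summable (\<lambda>n. (cmod (taylor F n))\<^sup>2 / a n)}"

definition weighted_ip :: "(nat \<Rightarrow> real) \<Rightarrow> (complex \<Rightarrow> complex) \<Rightarrow> (complex \<Rightarrow> complex) \<Rightarrow> complex" where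
  "weighted_ip a F G = (\<Sum>n. taylor F n * cnj (taylor G n) / of_real (a n))"

definition weighted_kernel :: "(nat \<Rightarrow> real) \<Rightarrow> complex \<Rightarrow> complex \<Rightarrow> complex" where
  "weighted_kernel a z w = (\<Sum>n. of_real (a n) * (z * cnj w) ^ n)"

context renewal_weight
begin

lemma weighted_hardyD:
  assumes "F \<in> weighted_hardy a"
  shows "F holomorphic_on \<D>" "summable (\<lambda>n. (cmod (taylor F n))\<^sup>2 / a n)" "F \<in> functions_on \<D>"
  using assms by (auto simp: weighted_hardy_def)

lemma cs_summable:
  fixes c d :: "nat \<Rightarrow> complex"
  assumes "summable (\<lambda>n. (cmod (c n))\<^sup>2 / a n)" "summable (\<lambda>n. (cmod (d n))\<^sup>2 / a n)"
  shows "summable (\<lambda>n. c n * cnj (d n) / of_real (a n))"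
proof (rule summable_comparison_test'[of _ 0])
  show "summable (\<lambda>n. (cmod (c n))\<^sup>2 / a n + (cmod (d n))\<^sup>2 / a n)"
    by (intro summable_add assms)
  fix n
  have "cmod (c n) * cmod (d n) \<le> (cmod (c n))\<^sup>2 + (cmod (d n))\<^sup>2"
  proof -
    have "0 \<le> cmod (c n) * cmod (d n)" by simp
    then show ?thesis using sum_squares_bound[of "cmod (c n)" "cmod (d n)"] by linarith
  qed
  then have "cmod (c n) * cmod (d n) / a n \<le> ((cmod (c n))\<^sup>2 + (cmod (d n))\<^sup>2) / a n"
    using pos[of n] by (simp add: divide_right_mono)
  then show "norm (c n * cnj (d n) / of_real (a n)) \<le> (cmod (c n))\<^sup>2 / a n + (cmod (d n))\<^sup>2 / a n"
    using pos[of n] by (simp add: norm_divide norm_mult add_divide_distrib)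
qed

lemma add_summable:
  fixes c d :: "nat \<Rightarrow> complex"
  assumes "summable (\<lambda>n. (cmod (c n))\<^sup>2 / a n)" "summable (\<lambda>n. (cmod (d n))\<^sup>2 / a n)"
  shows "summable (\<lambda>n. (cmod (c n + d n))\<^sup>2 / a n)"
proof (rule summable_comparison_test'[of _ 0])
  show "summable (\<lambda>n. 2 * ((cmod (c n))\<^sup>2 / a n + (cmod (d n))\<^sup>2 / a n))"
    by (intro summable_mult summable_add assms)
  fix n
  have "(cmod (c n + d n))\<^sup>2 \<le> (cmod (c n) + cmod (d n))\<^sup>2"
    by (intro power_mono norm_triangle_ineq) auto
  also have "\<dots> \<le> 2 * ((cmod (c n))\<^sup>2 + (cmod (d n))\<^sup>2)"
    using sum_squares_bound[of "cmod (c n)" "cmod (d n)"] by (simp add: power2_sum)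
  finally have "(cmod (c n + d n))\<^sup>2 / a n \<le> 2 * ((cmod (c n))\<^sup>2 + (cmod (d n))\<^sup>2) / a n"
    using pos[of n] by (simp only: divide_right_mono less_imp_le)
  then show "norm ((cmod (c n + d n))\<^sup>2 / a n) \<le> 2 * ((cmod (c n))\<^sup>2 / a n + (cmod (d n))\<^sup>2 / a n)"
    using pos[of n] by (simp add: add_divide_distrib)
qed

text \<open>Since \<open>a n \<le> 1\<close>, square summability against \<open>1 / a n\<close> bounds the coefficients, so that the power
  series converges in the whole disc.\<close>

lemma series_in_weighted_hardy:
  fixes d :: "nat \<Rightarrow> complex"
  assumes d: "summable (\<lambda>n. (cmod (d n))\<^sup>2 / a n)"
  defines "G \<equiv> restr \<D> (\<lambda>z. \<Sum>n. d n * z ^ n)"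
  shows "G \<in> weighted_hardy a" "taylor G = d" "\<And>z. z \<in> \<D> \<Longrightarrow> (\<lambda>n. d n * z ^ n) sums G z"
proof -
  have "summable (\<lambda>n. (cmod (d n))\<^sup>2)"
  proof (rule summable_comparison_test'[OF d, of 0])
    fix n show "norm ((cmod (d n))\<^sup>2) \<le> (cmod (d n))\<^sup>2 / a n"
      using pos[of n] le_one[of n] by (simp add: pos_le_divide_eq mult_left_le)
  qed
  then have "(\<lambda>n. (cmod (d n))\<^sup>2) \<longlonglongrightarrow> 0" by (rule summable_LIMSEQ_zero)
  then have "Bseq (\<lambda>n. (cmod (d n))\<^sup>2)" using convergentI convergent_imp_Bseq by blast
  then obtain B where B: "\<And>n. (cmod (d n))\<^sup>2 \<le> B" by (auto simp: Bseq_def)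
  have bound: "cmod (d n) \<le> sqrt B" for n using B real_le_rsqrt by blast
  show sums: "(\<lambda>n. d n * z ^ n) sums G z" if z: "z \<in> \<D>" for z
  proof -
    have "summable (\<lambda>n. d n * z ^ n)"
    proof (rule summable_comparison_test'[of "\<lambda>n. sqrt B * cmod z ^ n" 0])
      show "summable (\<lambda>n. sqrt B * cmod z ^ n)" using z by (intro summable_mult summable_geometric) simp
      show "norm (d n * z ^ n) \<le> sqrt B * cmod z ^ n" for n
        using bound[of n] by (simp add: norm_mult norm_power mult_right_mono)
    qed
    then show ?thesis using z by (simp add: G_def restr_def summable_sums)
  qed
  from taylor_unique[OF this] show t: "taylor G = d" and "G \<in> weighted_hardy a"
    using d by (auto simp: weighted_hardy_def functions_on_def G_def restr_def)
qed

lemma weighted_norm: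
  assumes "F \<in> weighted_hardy a"
  shows "ip_norm (weighted_ip a) F = sqrt (\<Sum>n. (cmod (taylor F n))\<^sup>2 / a n)"
    "weighted_ip a F F = of_real (\<Sum>n. (cmod (taylor F n))\<^sup>2 / a n)"
proof -
  have "taylor F n * cnj (taylor F n) / of_real (a n) = of_real ((cmod (taylor F n))\<^sup>2 / a n)" for n
    unfolding of_real_divide complex_norm_square ..
  then show *: "weighted_ip a F F = of_real (\<Sum>n. (cmod (taylor F n))\<^sup>2 / a n)"
    unfolding weighted_ip_def using weighted_hardyD(2)[OF assms] by (simp only: suminf_of_real)
  show "ip_norm (weighted_ip a) F = sqrt (\<Sum>n. (cmod (taylor F n))\<^sup>2 / a n)"
    unfolding ip_norm_def * by simp
qed

text \<open>Completeness is that of a weighted \<open>\<ell>\<^sup>2\<close> space of Taylor coefficients: a Cauchy sequence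
  converges coefficientwise, and the estimates for finite partial sums pass to the limit.\<close>

lemma hilbert: "hilbert_function_space \<D> (weighted_hardy a) (weighted_ip a)"
proof
  show "weighted_hardy a \<subseteq> functions_on \<D>" by (auto simp: weighted_hardy_def)
  have "taylor (\<lambda>x. 0) = (\<lambda>n. 0)" by (intro taylor_unique) auto
  then show "(\<lambda>x. 0) \<in> weighted_hardy a" by (simp add: weighted_hardy_def functions_on_def)
next
  fix F G assume "F \<in> weighted_hardy a" "G \<in> weighted_hardy a"
  note F = weighted_hardyD[OF this(1)] and G = weighted_hardyD[OF this(2)]
  show "(\<lambda>x. F x + G x) \<in> weighted_hardy a"
    using F G add_summable[OF F(2) G(2)]
    by (auto simp: weighted_hardy_def functions_on_def taylor_add intro!: holomorphic_intros)
next
  fix F and c :: complex assume "F \<in> weighted_hardy a"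
  note F = weighted_hardyD[OF this]
  show "(\<lambda>x. c * F x) \<in> weighted_hardy a"
    using F summable_mult[OF F(2), of "(cmod c)\<^sup>2"]
    by (auto simp: weighted_hardy_def functions_on_def taylor_scale norm_mult power_mult_distrib intro!: holomorphic_intros)
next
  fix F G E assume "F \<in> weighted_hardy a" "G \<in> weighted_hardy a" "E \<in> weighted_hardy a"
  note F = weighted_hardyD[OF this(1)] and G = weighted_hardyD[OF this(2)] and E = weighted_hardyD[OF this(3)]
  show "weighted_ip a (\<lambda>x. F x + G x) E = weighted_ip a F E + weighted_ip a G E"
    unfolding weighted_ip_def taylor_add[OF F(1) G(1)]
    by (simp add: distrib_right add_divide_distrib suminf_add cs_summable F G E)
next
  fix F G and c :: complex assume "F \<in> weighted_hardy a" "G \<in> weighted_hardy a"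
  note F = weighted_hardyD[OF this(1)] and G = weighted_hardyD[OF this(2)]
  show "weighted_ip a (\<lambda>x. c * F x) G = c * weighted_ip a F G"
    unfolding weighted_ip_def taylor_scale[OF F(1)]
    using suminf_mult[OF cs_summable[OF F(2) G(2)], of c] by (simp add: mult.assoc)
next
  fix F G assume "F \<in> weighted_hardy a" "G \<in> weighted_hardy a"
  note F = weighted_hardyD[OF this(1)] and G = weighted_hardyD[OF this(2)]
  have "(\<lambda>n. cnj (taylor G n * cnj (taylor F n) / of_real (a n))) sums cnj (weighted_ip a G F)"
    unfolding weighted_ip_def sums_cnj by (intro summable_sums cs_summable F G)
  then show "weighted_ip a F G = cnj (weighted_ip a G F)"
    by (auto simp: weighted_ip_def mult.commute sums_iff)
next
  fix F assume F: "F \<in> weighted_hardy a"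
  have nn: "0 \<le> (cmod (taylor F n))\<^sup>2 / a n" for n using pos[of n] by simp
  then show "0 \<le> Re (weighted_ip a F F)"
    unfolding weighted_norm[OF F] using weighted_hardyD[OF F] by (simp add: suminf_nonneg)
  assume "weighted_ip a F F = 0"
  then have "(\<Sum>n. (cmod (taylor F n))\<^sup>2 / a n) = 0" unfolding weighted_norm[OF F] by simp
  then have "(cmod (taylor F n))\<^sup>2 / a n = 0" for n
    using suminf_eq_zero_iff[OF weighted_hardyD(2)[OF F]] nn by blast
  then have "taylor F = (\<lambda>n. 0)" using pos by (auto simp: less_le)
  then have "F z = 0" if "z \<in> \<D>" for z
    using taylor_sums[OF weighted_hardyD(1)[OF F] that] by (simp add: sums_iff)
  then show "F = (\<lambda>x. 0)" using weighted_hardyD(3)[OF F] by (auto simp: functions_on_def)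
next
  fix S :: "nat \<Rightarrow> complex \<Rightarrow> complex"
  assume S: "\<forall>n. S n \<in> weighted_hardy a"
    and Cauchy: "\<forall>e>0. \<exists>N. \<forall>m\<ge>N. \<forall>n\<ge>N. ip_norm (weighted_ip a) (\<lambda>x. S m x - S n x) < e"
  define c where "c m = taylor (S m)" for m
  have hol: "S m holomorphic_on \<D>" for m using S weighted_hardyD by blast
  have csum: "summable (\<lambda>n. (cmod (c m n))\<^sup>2 / a n)" for m using S weighted_hardyD by (simp add: c_def)
  have dsum: "summable (\<lambda>n. (cmod (c m n - c k n))\<^sup>2 / a n)" for m k
    using add_summable[OF csum[of m], of "\<lambda>n. - c k n"] csum[of k] by simp
  have diff_mem: "(\<lambda>x. S m x - S k x) \<in> weighted_hardy a" for m k
    using S hol dsum[of m k] weighted_hardyD(3)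
    by (auto simp: weighted_hardy_def functions_on_def taylor_diff c_def intro!: holomorphic_intros)
  have nn: "0 \<le> (cmod (x))\<^sup>2 / a n" for n x using pos[of n] by simp
  have tail: "(\<Sum>n\<in>I. (cmod (c m n - c k n))\<^sup>2 / a n) \<le> (ip_norm (weighted_ip a) (\<lambda>x. S m x - S k x))\<^sup>2"
    if "finite I" for I m k
  proof -
    have "(ip_norm (weighted_ip a) (\<lambda>x. S m x - S k x))\<^sup>2 = (\<Sum>n. (cmod (c m n - c k n))\<^sup>2 / a n)"
      unfolding weighted_norm(1)[OF diff_mem] using suminf_nonneg[OF dsum nn]
      by (simp add: taylor_diff hol c_def)
    then show ?thesis using sum_le_suminf[OF dsum that] nn by simp
  qed
  have "Cauchy (\<lambda>m. c m n)" for n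
  proof (rule CauchyI)
    fix e :: real assume e: "0 < e"
    then have "0 < e / sqrt (1 / a n)" using pos[of n] by simp
    then obtain N where N: "\<And>m k. m \<ge> N \<Longrightarrow> k \<ge> N \<Longrightarrow> ip_norm (weighted_ip a) (\<lambda>x. S m x - S k x) < e / sqrt (1 / a n)"
      using Cauchy by blast
    have "norm (c m n - c k n) < e" if "m \<ge> N" "k \<ge> N" for m k
    proof -
      have "(cmod (c m n - c k n))\<^sup>2 / a n \<le> (ip_norm (weighted_ip a) (\<lambda>x. S m x - S k x))\<^sup>2"
        using tail[of "{n}" m k] by simp
      also have "\<dots> < (e / sqrt (1 / a n))\<^sup>2"
        using N[OF that] weighted_norm(1)[OF diff_mem, of m k] suminf_nonneg[OF dsum nn, of m k]
        by (intro power_strict_mono) (auto simp: taylor_diff hol c_def)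
      also have "\<dots> = e\<^sup>2 * a n" using pos[of n] by (simp add: power_divide)
      finally have "(cmod (c m n - c k n))\<^sup>2 < e\<^sup>2 * (a n * a n)"
        using pos[of n] by (simp add: divide_less_eq mult.assoc)
      also have "\<dots> \<le> e\<^sup>2 * (1 * 1)" using pos[of n] le_one[of n] by (intro mult_left_mono mult_mono) auto
      finally show ?thesis using e by (simp add: power2_less_imp_less)
    qed
    then show "\<exists>M. \<forall>m\<ge>M. \<forall>k\<ge>M. norm (c m n - c k n) < e" by blast
  qed
  then have "\<exists>d. \<forall>n. (\<lambda>m. c m n) \<longlonglongrightarrow> d n"
    by (intro choice allI) (auto simp: Cauchy_convergent_iff convergent_def)
  then obtain d where d: "\<And>n. (\<lambda>m. c m n) \<longlonglongrightarrow> d n" by blast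
  \<comment> \<open>The Cauchy estimate with index \<open>k\<close> is kept for finite partial sums while \<open>k\<close> tends to infinity.\<close>
  have small: "summable (\<lambda>n. (cmod (c m n - d n))\<^sup>2 / a n) \<and> (\<Sum>n. (cmod (c m n - d n))\<^sup>2 / a n) \<le> e\<^sup>2"
    if e: "e > 0" and m: "\<And>k. k \<ge> N \<Longrightarrow> ip_norm (weighted_ip a) (\<lambda>x. S m x - S k x) < e" for m N e
  proof -
    have part: "(\<Sum>n<M. (cmod (c m n - d n))\<^sup>2 / a n) \<le> e\<^sup>2" for M
    proof (rule LIMSEQ_le_const2)
      show "(\<lambda>k. \<Sum>n<M. (cmod (c m n - c k n))\<^sup>2 / a n) \<longlonglongrightarrow> (\<Sum>n<M. (cmod (c m n - d n))\<^sup>2 / a n)"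
        using pos by (intro tendsto_intros d) (auto simp: less_le)
      have "(\<Sum>n<M. (cmod (c m n - c k n))\<^sup>2 / a n) \<le> e\<^sup>2" if "k \<ge> N" for k
      proof -
        have "(ip_norm (weighted_ip a) (\<lambda>x. S m x - S k x))\<^sup>2 \<le> e\<^sup>2"
          using m[OF that] weighted_norm(1)[OF diff_mem, of m k] suminf_nonneg[OF dsum nn, of m k]
          by (intro power_mono) (auto simp: taylor_diff hol c_def)
        then show ?thesis using tail[of "{..<M}" m k] by simp
      qed
      then show "\<exists>N. \<forall>n\<ge>N. (\<Sum>na<M. (cmod (c m na - c n na))\<^sup>2 / a na) \<le> e\<^sup>2" by blast
    qed
    have "summable (\<lambda>n. (cmod (c m n - d n))\<^sup>2 / a n)"
      by (rule bounded_imp_summable[where B = "e\<^sup>2"]) (use part[of "Suc _"] nn in \<open>auto simp: lessThan_Suc_atMost\<close>)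
    then show ?thesis using part by (auto intro: suminf_le_const)
  qed
  obtain N1 where "\<And>m k. m \<ge> N1 \<Longrightarrow> k \<ge> N1 \<Longrightarrow> ip_norm (weighted_ip a) (\<lambda>x. S m x - S k x) < 1"
    using Cauchy zero_less_one by blast
  then have "summable (\<lambda>n. (cmod (c N1 n - d n))\<^sup>2 / a n)" using small[of 1 N1 N1] by auto
  then have "summable (\<lambda>n. (cmod (d n - c N1 n))\<^sup>2 / a n)" by (simp add: norm_minus_commute)
  then have dsum': "summable (\<lambda>n. (cmod (d n))\<^sup>2 / a n)"
    using add_summable[OF _ csum[of N1], of "\<lambda>n. d n - c N1 n"] by simp
  define G where "G = restr \<D> (\<lambda>z. \<Sum>n. d n * z ^ n)"
  have G: "G \<in> weighted_hardy a" "taylor G = d"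
    using series_in_weighted_hardy[OF dsum'] by (simp_all add: G_def)
  have dG: "(\<lambda>x. S m x - G x) \<in> weighted_hardy a" for m
  proof -
    have "summable (\<lambda>n. (cmod (c m n - d n))\<^sup>2 / a n)"
      using add_summable[OF csum[of m], of "\<lambda>n. - d n"] dsum' by simp
    then have "summable (\<lambda>n. (cmod (taylor (\<lambda>x. S m x - G x) n))\<^sup>2 / a n)"
      by (simp add: taylor_diff[OF hol weighted_hardyD(1)[OF G(1)]] G(2) c_def)
    moreover have "(\<lambda>x. S m x - G x) holomorphic_on \<D>"
      by (intro holomorphic_intros hol weighted_hardyD(1)[OF G(1)])
    moreover have "S m \<in> functions_on \<D>" "G \<in> functions_on \<D>"
      using S G(1) weighted_hardyD(3) by blast+
    ultimately show ?thesis by (simp add: weighted_hardy_def functions_on_def)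
  qed
  have "(\<lambda>m. ip_norm (weighted_ip a) (\<lambda>x. S m x - G x)) \<longlonglongrightarrow> 0"
  proof (rule LIMSEQ_I)
    fix e :: real assume e: "0 < e"
    then have e2: "0 < e / 2" by simp
    then obtain N where N: "\<And>m k. m \<ge> N \<Longrightarrow> k \<ge> N \<Longrightarrow> ip_norm (weighted_ip a) (\<lambda>x. S m x - S k x) < e / 2"
      using Cauchy by blast
    have "norm (ip_norm (weighted_ip a) (\<lambda>x. S m x - G x) - 0) < e" if "m \<ge> N" for m
    proof -
      have "(\<Sum>n. (cmod (c m n - d n))\<^sup>2 / a n) \<le> (e/2)\<^sup>2" "summable (\<lambda>n. (cmod (c m n - d n))\<^sup>2 / a n)"
        using small[OF e2, of N m] N[OF that] by auto
      moreover have "ip_norm (weighted_ip a) (\<lambda>x. S m x - G x) = sqrt (\<Sum>n. (cmod (c m n - d n))\<^sup>2 / a n)"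
        unfolding weighted_norm(1)[OF dG] using weighted_hardyD[OF G(1)] by (simp add: taylor_diff hol c_def G)
      moreover have "0 \<le> (\<Sum>n. (cmod (c m n - d n))\<^sup>2 / a n)" using calculation(2) nn by (rule suminf_nonneg)
      moreover have "sqrt (\<Sum>n. (cmod (c m n - d n))\<^sup>2 / a n) \<le> e / 2"
        using calculation(1) e by (intro real_le_lsqrt) simp_all
      ultimately have "ip_norm (weighted_ip a) (\<lambda>x. S m x - G x) \<le> e / 2"
        "0 \<le> ip_norm (weighted_ip a) (\<lambda>x. S m x - G x)"
        by simp_all
      then show ?thesis using e by simp
    qed
    then show "\<exists>no. \<forall>n\<ge>no. norm (ip_norm (weighted_ip a) (\<lambda>x. S n x - G x) - 0) < e" by blast
  qed
  then show "\<exists>G\<in>weighted_hardy a. (\<lambda>n. ip_norm (weighted_ip a) (\<lambda>x. S n x - G x)) \<longlonglongrightarrow> 0"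
    using G(1) by blast
qed

lemma kernel_fun_weighted:
  assumes w: "w \<in> \<D>"
  shows "kernel_fun \<D> (weighted_kernel a) w \<in> weighted_hardy a"
    and "taylor (kernel_fun \<D> (weighted_kernel a) w) = (\<lambda>n. of_real (a n) * cnj w ^ n)"
proof -
  have "summable (\<lambda>n. (cmod (of_real (a n) * cnj w ^ n))\<^sup>2 / a n)"
  proof (rule summable_comparison_test'[of "\<lambda>n. cmod w ^ n" 0])
    show "summable (\<lambda>n. cmod w ^ n)" using w by (intro summable_geometric) simp
    fix n
    have "(cmod (of_real (a n) * cnj w ^ n))\<^sup>2 / a n = a n * (cmod w ^ n * cmod w ^ n)"
      using pos[of n] by (simp add: norm_mult norm_power power2_eq_square)
    also have "\<dots> \<le> 1 * (cmod w ^ n * 1)"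
      using pos[of n] le_one[of n] w by (intro mult_mono power_le_one) auto
    finally show "norm ((cmod (of_real (a n) * cnj w ^ n))\<^sup>2 / a n) \<le> cmod w ^ n"
      using pos[of n] by simp
  qed
  from series_in_weighted_hardy[OF this]
  show "kernel_fun \<D> (weighted_kernel a) w \<in> weighted_hardy a"
    "taylor (kernel_fun \<D> (weighted_kernel a) w) = (\<lambda>n. of_real (a n) * cnj w ^ n)"
    by (simp_all add: kernel_fun_def weighted_kernel_def power_mult_distrib mult_ac)
qed

lemma rkhs: "reproducing_kernel_hilbert_space \<D> (weighted_kernel a) (weighted_hardy a) (weighted_ip a)"
proof (intro reproducing_kernel_hilbert_space.intro hilbert reproducing_kernel_hilbert_space_axioms.intro)
  fix w F assume w: "w \<in> \<D>" and F: "F \<in> weighted_hardy a"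
  have "taylor F n * cnj (of_real (a n) * cnj w ^ n) / of_real (a n) = taylor F n * w ^ n" for n
    using pos[of n] by simp
  then show "weighted_ip a F (kernel_fun \<D> (weighted_kernel a) w) = F w"
    using taylor_sums[OF weighted_hardyD(1)[OF F] w]
    by (simp only: weighted_ip_def kernel_fun_weighted[OF w] sums_iff)
qed (rule kernel_fun_weighted)

end

section \<open>Multipliers of weighted Hardy spaces\<close>

context reproducing_kernel_hilbert_space
begin

text \<open>A gliding hump in which positivity of the kernel replaces orthogonality.  If \<open>h\<close> exceeds \<open>4\<^sup>k\<close> at
  \<open>w k\<close>, the sum \<open>G\<close> of the normalised kernels at the points \<open>w k\<close> with weights \<open>2\<^sup>-\<^sup>k\<close> is in the
  space.  All terms have nonnegative real part, so at \<open>w j\<close> the \<open>j\<close>-th term is a lower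
  bound for \<open>\<bar>G\<bar>\<close>; hence \<open>h * G\<close> is too large at \<open>w j\<close>
  for a function of the space.\<close>

lemma multiplier_bounded:
  assumes Re_nonneg: "\<And>x y. x \<in> X \<Longrightarrow> y \<in> X \<Longrightarrow> 0 \<le> Re (K x y)"
    and diag: "\<And>y. y \<in> X \<Longrightarrow> K y y \<noteq> 0"
    and h: "h \<in> multiplier_algebra X H"
  shows "bounded (h ` X)"
proof (rule ccontr)
  assume "\<not> bounded (h ` X)"
  then have "\<exists>w\<in>X. 4 ^ k < cmod (h w)" for k :: nat
    unfolding bounded_iff by (force simp: not_le)
  then obtain w where w: "\<And>k. w k \<in> X" "\<And>k. 4 ^ k < cmod (h (w k))" by metis
  define kf where "kf y = kernel_fun X K y" for y
  have kf: "kf y \<in> H" if "y \<in> X" for y using kernel_mem that by (simp add: kf_def)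
  have kf_val: "kf y x = K x y" if "x \<in> X" for x y using that by (simp add: kf_def kernel_fun_def restr_def)
  have nsq: "K y y = of_real ((nrm (kf y))\<^sup>2)" if "y \<in> X" for y
    using ip_self[OF kf[OF that]] reproducing[OF that kf[OF that]] kf_val[OF that] by (simp add: kf_def)
  have n0: "nrm (kf y) > 0" if "y \<in> X" for y
    using nsq[OF that] diag[OF that] nrm_nonneg[OF kf[OF that]] by (auto simp: less_le)
  define t where "t k = (1/2) ^ k / nrm (kf (w k))" for k
  have t: "0 \<le> t k" for k using n0[OF w(1)] by (simp add: t_def less_imp_le)
  define F where "F k = (\<lambda>x. of_real (t k) * kf (w k) x)" for k
  have F: "F k \<in> H" for k unfolding F_def by (intro scale_closed kf w)
  have nF: "nrm (F k) = (1/2) ^ k" for k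
    unfolding F_def using n0[OF w(1), of k] by (subst nrm_scale[OF kf[OF w(1)]]) (simp add: t_def norm_divide norm_power)
  have summF: "summable (\<lambda>k. nrm (F k))" by (simp add: nF)
  define G where "G = restr X (\<lambda>x. \<Sum>k. F k x)"
  have sums: "(\<lambda>k. F k x) sums G x" if x: "x \<in> X" for x
  proof -
    have "summable (\<lambda>k. F k x)"
      by (rule summable_comparison_test'[OF summable_mult2[OF summF, of "nrm (kf x)"], of 0])
        (use norm_eval_le[OF F x] in \<open>simp add: kf_def\<close>)
    then show ?thesis using x by (simp add: G_def restr_def summable_sums)
  qed
  have G: "G \<in> H"
    by (rule series_mem[OF F summF _ sums]) (auto simp: G_def functions_on_def restr_def)
  have hG: "(\<lambda>x. h x * G x) \<in> H" using h G by (simp add: multiplier_algebra_def)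
  have bound: "2 ^ j \<le> nrm (\<lambda>x. h x * G x)" for j :: nat
  proof -
    have "(\<lambda>k. Re (F k (w j))) sums Re (G (w j))" by (intro sums_Re sums w)
    moreover have "0 \<le> Re (F k (w j))" for k
      using t[of k] Re_nonneg[OF w(1) w(1), of j k] by (simp add: F_def kf_val[OF w(1)])
    ultimately have "Re (F j (w j)) \<le> Re (G (w j))"
      using sum_le_suminf[of "\<lambda>k. Re (F k (w j))" "{j}"] by (auto simp: sums_iff)
    moreover have "Re (F j (w j)) = (1/2) ^ j * nrm (kf (w j))"
      using n0[OF w(1), of j]
      by (simp add: F_def kf_val[OF w(1)] nsq[OF w(1)] t_def power2_eq_square del: of_real_power)
    ultimately have "(1/2) ^ j * nrm (kf (w j)) \<le> cmod (G (w j))"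
      using complex_Re_le_cmod order_trans by metis
    then have "4 ^ j * ((1/2) ^ j * nrm (kf (w j))) \<le> cmod (h (w j)) * cmod (G (w j))"
      using w(2)[of j] n0[OF w(1), of j] by (intro mult_mono) auto
    also have "\<dots> \<le> nrm (\<lambda>x. h x * G x) * nrm (kf (w j))"
      using norm_eval_le[OF hG w(1), of j] by (simp add: norm_mult kf_def)
    finally have "(4 ^ j * (1/2) ^ j) * nrm (kf (w j)) \<le> nrm (\<lambda>x. h x * G x) * nrm (kf (w j))"
      by (simp only: mult.assoc)
    then have "4 ^ j * (1/2) ^ j \<le> nrm (\<lambda>x. h x * G x)"
      using n0[OF w(1), of j] by (rule mult_right_le_imp_le)
    then show ?thesis by (simp flip: power_mult_distrib)
  qed
  obtain j where "nrm (\<lambda>x. h x * G x) < 2 ^ j"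
    using real_arch_pow[of 2] by auto
  with bound[of j] show False by simp
qed

end

abbreviation weighted_multipliers :: "(nat \<Rightarrow> real) \<Rightarrow> (complex \<Rightarrow> complex) set" where
  "weighted_multipliers a \<equiv> multiplier_algebra \<D> (weighted_hardy a)"

context renewal_weight
begin

sublocale R: reproducing_kernel_hilbert_space \<D> "weighted_kernel a" "weighted_hardy a" "weighted_ip a"
  by (rule rkhs)

text \<open>The \<open>n\<close>-th coefficient moves to place \<open>n + k\<close>, and \<open>1 / a (n + k) \<le> 1 / (a n * a k)\<close> by
  supermultiplicativity.\<close>

lemma shift_mem:
  assumes F: "F \<in> weighted_hardy a"
  shows "(\<lambda>z. z ^ k * F z) \<in> weighted_hardy a"
    and "R.nrm (\<lambda>z. z ^ k * F z) \<le> R.nrm F / sqrt (a k)"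
proof -
  note F' = weighted_hardyD[OF F]
  have t: "taylor (\<lambda>z. z ^ k * F z) (n + k) = taylor F n" for n
    by (simp add: taylor_shift[OF F'(1)])
  have le: "(cmod (taylor F n))\<^sup>2 / a (n + k) \<le> (cmod (taylor F n))\<^sup>2 / a n * (1 / a k)" for n
    using supermult[of n k] pos[of n] pos[of k] pos[of "n+k"] by (auto intro!: divide_left_mono mult_pos_pos)
  have rs: "(\<lambda>n. (cmod (taylor F n))\<^sup>2 / a n * (1 / a k)) sums ((\<Sum>n. (cmod (taylor F n))\<^sup>2 / a n) * (1 / a k))"
    by (intro sums_mult2 summable_sums F')
  have s: "summable (\<lambda>n. (cmod (taylor F n))\<^sup>2 / a (n + k))"
    by (rule summable_comparison_test'[OF sums_summable[OF rs], of 0]) (use le pos in \<open>auto simp: less_imp_le\<close>)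
  have z: "(\<lambda>n. (cmod (taylor (\<lambda>z. z ^ k * F z) n))\<^sup>2 / a n) sums (\<Sum>n. (cmod (taylor F n))\<^sup>2 / a (n + k))"
  proof (subst sums_zero_iff_shift[of k, symmetric])
    show "(\<lambda>n. (cmod (taylor (\<lambda>z. z ^ k * F z) (n + k)))\<^sup>2 / a (n + k)) sums (\<Sum>n. (cmod (taylor F n))\<^sup>2 / a (n + k))"
      unfolding t by (rule summable_sums[OF s])
  qed (simp add: taylor_shift[OF F'(1)])
  show mem: "(\<lambda>z. z ^ k * F z) \<in> weighted_hardy a"
    using F' sums_summable[OF z] by (auto simp: weighted_hardy_def functions_on_def intro!: holomorphic_intros)
  have "(\<Sum>n. (cmod (taylor F n))\<^sup>2 / a (n + k)) \<le> (\<Sum>n. (cmod (taylor F n))\<^sup>2 / a n * (1 / a k))"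
    by (intro suminf_le le s sums_summable[OF rs])
  also have "\<dots> = (\<Sum>n. (cmod (taylor F n))\<^sup>2 / a n) * (1 / a k)" using sums_unique[OF rs] by simp
  finally show "R.nrm (\<lambda>z. z ^ k * F z) \<le> R.nrm F / sqrt (a k)"
    unfolding weighted_norm(1)[OF mem] weighted_norm(1)[OF F] using sums_unique[OF z]
    by (simp flip: real_sqrt_divide)
qed

lemma one_mem: "restr \<D> (\<lambda>z. 1) \<in> weighted_hardy a"
proof -
  have "(\<lambda>n. (if n = 0 then 1 else 0) * z ^ n) sums 1" for z :: complex
    using sums_finite[of "{0}" "\<lambda>n. (if n = 0 then 1 else 0) * z ^ n"] by simp
  then have *: "(\<lambda>n. (if n = 0 then 1 else 0) * z ^ n) sums restr \<D> (\<lambda>z. 1) z" if "z \<in> \<D>" for z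
    using that by (simp add: restr_def)
  have "summable (\<lambda>n. (cmod (if n = 0 then 1 else 0))\<^sup>2 / a n)"
    by (rule summable_finite[of "{0}"]) auto
  then show ?thesis
    using taylor_unique[OF *] by (auto simp: weighted_hardy_def functions_on_def restr_def)
qed

lemma multiplier_mem:
  assumes "h \<in> weighted_multipliers a"
  shows "h \<in> weighted_hardy a"
proof -
  have "(\<lambda>z. h z * restr \<D> (\<lambda>z. 1) z) = h"
    using assms by (intro ext) (auto simp: multiplier_algebra_def functions_on_def restr_def)
  then show ?thesis using assms one_mem by (auto simp: multiplier_algebra_def)
qed

lemma series_multiplier:
  fixes c :: "nat \<Rightarrow> complex"
  assumes c: "summable (\<lambda>n. cmod (c n) / sqrt (a n))"
  defines "h \<equiv> restr \<D> (\<lambda>z. \<Sum>n. c n * z ^ n)"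
  shows "h \<in> weighted_multipliers a" "taylor h = c" "\<And>z. z \<in> \<D> \<Longrightarrow> (\<lambda>n. c n * z ^ n) sums h z"
proof -
  show sums: "(\<lambda>n. c n * z ^ n) sums h z" if z: "z \<in> \<D>" for z
  proof -
    have "summable (\<lambda>n. c n * z ^ n)"
    proof (rule summable_comparison_test'[OF c, of 0])
      fix n
      have "cmod (c n) * (cmod z ^ n * sqrt (a n)) \<le> cmod (c n) * (1 * 1)"
        using z le_one[of n] pos[of n] by (intro mult_left_mono mult_mono power_le_one) auto
      then show "norm (c n * z ^ n) \<le> cmod (c n) / sqrt (a n)"
        using pos[of n] by (simp add: norm_mult norm_power field_simps)
    qed
    then show ?thesis using z by (simp add: h_def restr_def summable_sums)
  qed
  show "taylor h = c" by (rule taylor_unique[OF sums])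
  have "(\<lambda>z. h z * F z) \<in> weighted_hardy a" if F: "F \<in> weighted_hardy a" for F
  proof (rule R.series_mem)
    show mem: "(\<lambda>z. c n * (z ^ n * F z)) \<in> weighted_hardy a" for n
      by (intro R.scale_closed shift_mem F)
    show "summable (\<lambda>n. R.nrm (\<lambda>z. c n * (z ^ n * F z)))"
    proof (rule summable_comparison_test'[OF summable_mult2[OF c, of "R.nrm F"], of 0])
      fix n
      have "cmod (c n) * R.nrm (\<lambda>z. z ^ n * F z) \<le> cmod (c n) * (R.nrm F / sqrt (a n))"
        by (intro mult_left_mono shift_mem F) auto
      then show "norm (R.nrm (\<lambda>z. c n * (z ^ n * F z))) \<le> cmod (c n) / sqrt (a n) * R.nrm F"
        using R.nrm_nonneg[OF mem, of n] by (simp add: R.nrm_scale[OF shift_mem(1)[OF F]])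
    qed
    show "(\<lambda>z. h z * F z) \<in> functions_on \<D>" using F by (auto simp: weighted_hardy_def functions_on_def)
    show "(\<lambda>n. c n * (z ^ n * F z)) sums (h z * F z)" if "z \<in> \<D>" for z
      using sums_mult2[OF sums[OF that], of "F z"] by (simp add: mult.assoc)
  qed
  then show "h \<in> weighted_multipliers a"
    by (auto simp: multiplier_algebra_def functions_on_def h_def restr_def)
qed

end

lemma weighted_hardy_mono:
  assumes "renewal_weight a" "renewal_weight a'" and le: "\<And>n. a n \<le> C * a' n"
  shows "weighted_hardy a \<subseteq> weighted_hardy a'"
proof
  interpret A: renewal_weight a by fact
  interpret A': renewal_weight a' by fact
  fix F assume F: "F \<in> weighted_hardy a"
  have "summable (\<lambda>n. (cmod (taylor F n))\<^sup>2 / a' n)"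
  proof (rule summable_comparison_test'[of "\<lambda>n. C * ((cmod (taylor F n))\<^sup>2 / a n)" 0])
    show "summable (\<lambda>n. C * ((cmod (taylor F n))\<^sup>2 / a n))"
      by (intro summable_mult A.weighted_hardyD F)
    fix n
    have "(cmod (taylor F n))\<^sup>2 * a n \<le> (cmod (taylor F n))\<^sup>2 * (C * a' n)"
      by (intro mult_left_mono le) auto
    then show "norm ((cmod (taylor F n))\<^sup>2 / a' n) \<le> C * ((cmod (taylor F n))\<^sup>2 / a n)"
      using A.pos[of n] A'.pos[of n] by (simp add: field_simps)
  qed
  then show "F \<in> weighted_hardy a'" using F by (simp add: weighted_hardy_def)
qed

text \<open>The lacunary series \<open>\<Sum>k. 2\<^sup>-\<^sup>k * sqrt (a (g k)) * z ^ g k\<close> is a multiplier for the weight \<open>a\<close>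
  whatever the distinct exponents \<open>g k\<close> are.  If \<open>a / a'\<close> were unbounded, the exponents could be chosen with
  \<open>a (g k) > 16\<^sup>k * a' (g k)\<close>, and then its coefficients would violate even membership in the
  Hilbert space for \<open>a'\<close>.  Every multiplier is in that space, as its product with \<open>1\<close>.\<close>

lemma comparison_of_multipliers:
  assumes "renewal_weight a" "renewal_weight a'"
    and sub: "weighted_multipliers a \<subseteq> weighted_multipliers a'"
  shows "\<exists>C>0. \<forall>n. a n \<le> C * a' n"
proof (rule ccontr)
  interpret A: renewal_weight a by fact
  interpret A': renewal_weight a' by fact
  assume contra: "\<not> ?thesis"
  \<comment> \<open>An initial segment can only change the constant, so violations occur arbitrarily far out; this makes the exponents distinct.\<close>
  have large: "\<exists>n>N. C * a' n < a n" if "C > 0" for C N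
  proof (rule ccontr)
    assume "\<not> ?thesis"
    then have tail: "a n \<le> C * a' n" if "n > N" for n using that by (metis not_less)
    define B where "B = C + (\<Sum>n\<le>N. a n / a' n)"
    have nn: "0 \<le> a n / a' n" for n using A.pos[of n] A'.pos[of n] by simp
    have "a n \<le> B * a' n" for n
    proof (cases "n > N")
      case True
      have "C * a' n \<le> B * a' n"
        using A'.pos[of n] sum_nonneg[of "{..N}" "\<lambda>n. a n / a' n"] nn by (intro mult_right_mono) (auto simp: B_def)
      then show ?thesis using tail[OF True] by simp
    next
      case False
      have "a n / a' n \<le> (\<Sum>n\<le>N. a n / a' n)"
        by (rule member_le_sum) (use False nn in auto)
      then have "a n / a' n \<le> B" using that by (simp add: B_def)
      then show ?thesis using A'.pos[of n] by (simp add: pos_divide_le_eq)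
    qed
    moreover have "B > 0" using that sum_nonneg[of "{..N}" "\<lambda>n. a n / a' n"] nn by (simp add: B_def add_pos_nonneg)
    ultimately show False using contra by blast
  qed
  have "\<exists>g. \<forall>k::nat. 16 ^ k * a' (g k) < a (g k) \<and> g k < g (Suc k)"
  proof (rule dependent_nat_choice)
    show "\<exists>n. 16 ^ 0 * a' n < a n" using large[of 1] by auto
    show "\<exists>m. 16 ^ Suc k * a' m < a m \<and> n < m" if "16 ^ k * a' n < a n" for n k
      using large[of "16 ^ Suc k" n] by auto
  qed
  then obtain g :: "nat \<Rightarrow> nat" where g: "\<And>k. 16 ^ k * a' (g k) < a (g k)" "strict_mono g"
    by (auto simp: strict_mono_Suc_iff)
  have inj: "inj g" using g(2) by (simp add: strict_mono_imp_inj_on)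
  define t :: "nat \<Rightarrow> real" where "t n = (if n \<in> range g then (1/2) ^ inv g n else 0)" for n
  have tg: "t (g k) = (1/2) ^ k" for k using inj by (simp add: t_def)
  have t0: "0 \<le> t n" for n by (simp add: t_def)
  have "summable (\<lambda>k. t (g k))" by (simp add: tg)
  then have "summable t"
    using summable_mono_reindex[OF g(2), of t] by (auto simp: t_def)
  define c where "c n = complex_of_real (t n * sqrt (a n))" for n
  have "cmod (c n) / sqrt (a n) = t n" for n
    using t0[of n] A.pos[of n] by (simp add: c_def norm_mult)
  then have sc: "summable (\<lambda>n. cmod (c n) / sqrt (a n))" using \<open>summable t\<close> by simp
  define h where "h = restr \<D> (\<lambda>z. \<Sum>n. c n * z ^ n)"
  have "h \<in> weighted_multipliers a" "taylor h = c"
    using A.series_multiplier[OF sc] by (simp_all add: h_def)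
  then have "h \<in> weighted_hardy a'" using sub A'.multiplier_mem by blast
  then have S: "summable (\<lambda>n. (cmod (c n))\<^sup>2 / a' n)"
    using A'.weighted_hardyD(2) \<open>taylor h = c\<close> by force
  obtain k :: nat where k: "(\<Sum>n. (cmod (c n))\<^sup>2 / a' n) < 4 ^ k"
    using real_arch_pow[of 4] by auto
  have "cmod (c (g k)) = (1/2) ^ k * sqrt (a (g k))"
    using A.pos[of "g k"] by (simp add: c_def tg norm_mult norm_divide norm_power)
  moreover have "((1/2::real) ^ k)\<^sup>2 = (1/4) ^ k"
    by (simp add: power2_eq_square flip: power_mult_distrib)
  ultimately have "(cmod (c (g k)))\<^sup>2 = (1/4) ^ k * a (g k)"
    using A.pos[of "g k"] by (simp only: power_mult_distrib real_sqrt_pow2 less_imp_le)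
  moreover have "(1/4) ^ k * (16 ^ k * a' (g k)) \<le> (1/4) ^ k * a (g k)"
    using g(1)[of k] by (intro mult_left_mono) auto
  moreover have "(1/4) ^ k * (16 ^ k * a' (g k)) = 4 ^ k * a' (g k)"
    by (simp add: mult.assoc[symmetric] flip: power_mult_distrib)
  ultimately have "4 ^ k \<le> (cmod (c (g k)))\<^sup>2 / a' (g k)"
    using A'.pos[of "g k"] by (simp add: pos_le_divide_eq)
  also have "\<dots> \<le> (\<Sum>n. (cmod (c n))\<^sup>2 / a' n)"
    using sum_le_suminf[OF S, of "{g k}"] A'.pos by (auto simp: less_imp_le)
  finally show False using k by simp
qed

lemma multipliers_eq_iff_comparable:
  assumes "renewal_weight a" "renewal_weight a'"
  shows "weighted_multipliers a = weighted_multipliers a' \<longleftrightarrow> comparable a a'"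
proof
  assume eq: "weighted_multipliers a = weighted_multipliers a'"
  obtain C where C: "C > 0" "\<And>n. a n \<le> C * a' n" using comparison_of_multipliers assms eq by blast
  obtain C' where C': "C' > 0" "\<And>n. a' n \<le> C' * a n" using comparison_of_multipliers assms eq by blast
  have "1 / C * a n \<le> a' n" for n using C by (simp add: field_simps)
  then show "comparable a a'"
    unfolding comparable_def using C(1) C' by (intro exI[of _ "1 / C"] conjI exI[of _ C']) auto
next
  assume "comparable a a'"
  then obtain c C where c: "c > 0" "C > 0" "\<And>n. c * a n \<le> a' n" "\<And>n. a' n \<le> C * a n"
    unfolding comparable_def by blast
  have "a n \<le> 1 / c * a' n" for n using c by (simp add: field_simps)
  then have "weighted_hardy a = weighted_hardy a'"
    using weighted_hardy_mono assms c by (intro equalityI) blast+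
  then show "weighted_multipliers a = weighted_multipliers a'" by simp
qed

section \<open>Renewal sequences and the transfer to the disc\<close>

text \<open>In probabilistic terms \<open>p i\<close> is the probability that the first renewal happens at time \<open>i + 1\<close> and \<open>a n\<close>
  the probability of a renewal at time \<open>n\<close>.  Supermultiplicativity follows from the recursion
  by induction.  For subexponential decay with ratio \<open>r\<close>, some \<open>N\<close> satisfies \<open>r ^ N \<le> a N\<close>:
  otherwise \<open>a\<close> would be summable, and summing the recursion would give \<open>suminf a - 1 = suminf a\<close>.
  Supermultiplicativity then propagates the bound from \<open>N\<close> to all indices, up to a constant.\<close>

lemma renewal_weight_of_recursion:
  fixes p a :: "nat \<Rightarrow> real"
  assumes p: "p sums 1" "\<And>i. 0 \<le> p i" "0 < p 0"
    and a0: "a 0 = 1" and rec: "\<And>n. a (Suc n) = (\<Sum>i\<le>n. p i * a (n - i))"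
  shows "renewal_weight a"
proof
  show pos: "0 < a n" for n
  proof (induction n rule: less_induct)
    case (less n)
    show ?case
    proof (cases n)
      case (Suc m)
      have "0 < p 0 * a m" using less[of m] Suc p(3) by simp
      also have "\<dots> \<le> (\<Sum>i\<le>m. p i * a (m - i))"
        using member_le_sum[of 0 "{..m}" "\<lambda>i. p i * a (m - i)"] less Suc p(2) by (auto simp: less_imp_le)
      finally show ?thesis by (simp add: Suc rec)
    qed (simp add: a0)
  qed
  show "a n \<le> 1" for n
  proof (induction n rule: less_induct)
    case (less n)
    show ?case
    proof (cases n)
      case (Suc m)
      have "(\<Sum>i\<le>m. p i * a (m - i)) \<le> (\<Sum>i\<le>m. p i)"
        using less Suc p(2) by (intro sum_mono mult_left_le) auto
      also have "\<dots> \<le> 1" using sum_le_suminf[OF sums_summable[OF p(1)], of "{..m}"] p by (auto simp: sums_iff)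
      finally show ?thesis by (simp add: Suc rec)
    qed (simp add: a0)
  qed
  show super: "a m * a n \<le> a (m + n)" for m n
  proof (induction m rule: less_induct)
    case (less m)
    show ?case
    proof (cases m)
      case (Suc k)
      have "a m * a n = (\<Sum>i\<le>k. p i * (a (k - i) * a n))"
        by (simp add: Suc rec sum_distrib_right mult.assoc)
      also have "\<dots> \<le> (\<Sum>i\<le>k. p i * a (k - i + n))"
        by (intro sum_mono mult_left_mono less p(2)) (simp add: Suc)
      also have "\<dots> = (\<Sum>i\<le>k. p i * a (k + n - i))"
        by (intro sum.cong) auto
      also have "\<dots> \<le> (\<Sum>i\<le>k + n. p i * a (k + n - i))"
        using p(2) pos by (intro sum_mono2) (auto simp: less_imp_le)
      finally show ?thesis by (simp add: Suc rec)
    qed (simp add: a0)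
  qed
  show "summable (\<lambda>n. r ^ n / sqrt (a n))" if r: "0 < r" "r < 1" for r
  proof -
    have "\<exists>N\<ge>1. r ^ N \<le> a N"
    proof (rule ccontr)
      assume neg: "\<not> ?thesis"
      have "summable a"
      proof (rule summable_comparison_test'[of "\<lambda>n. r ^ n" 1])
        show "summable (\<lambda>n. r ^ n)" using r by (intro summable_geometric) simp
        show "norm (a n) \<le> r ^ n" if "n \<ge> 1" for n
        proof -
          have "\<not> r ^ n \<le> a n" using neg that by blast
          then show ?thesis using pos[of n] by simp
        qed
      qed
      then have "(\<lambda>n. \<Sum>i\<le>n. p i * a (n - i)) sums (suminf p * suminf a)"
        using p pos by (intro Cauchy_product_sums) (auto simp: sums_iff less_imp_le)
      then have "(\<lambda>n. a (Suc n)) sums (suminf a)" using p(1) by (simp add: rec sums_iff)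
      then have "a sums (suminf a + 1)" using sums_Suc[of a "suminf a"] a0 by simp
      then show False by (simp add: sums_iff)
    qed
    then obtain N where N: "N \<ge> 1" "r ^ N \<le> a N" by blast
    define \<delta> where "\<delta> = Min (a ` {..<N})"
    have \<delta>: "0 < \<delta>" "\<And>n. n < N \<Longrightarrow> \<delta> \<le> a n"       using N pos by (auto simp: \<delta>_def Min_gr_iff lessThan_empty_iff)
    have low: "\<delta> * r ^ n \<le> a n" for n
    proof (induction n rule: less_induct)
      case (less n)
      show ?case
      proof (cases "n < N")
        case True
        have "\<delta> * r ^ n \<le> \<delta> * 1" using r \<delta> by (intro mult_left_mono power_le_one) auto
        then show ?thesis using \<delta>(2)[OF True] by simp
      next
        case False
        have "\<delta> * r ^ n = r ^ N * (\<delta> * r ^ (n - N))"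
          using False by (simp flip: power_add)
        also have "\<dots> \<le> a N * a (n - N)"
          using less[of "n - N"] N False r \<delta> pos by (intro mult_mono) (auto simp: less_imp_le)
        also have "\<dots> \<le> a n" using super[of N "n - N"] False by simp
        finally show ?thesis .
      qed
    qed
    show ?thesis
    proof (rule summable_comparison_test'[of "\<lambda>n. sqrt r ^ n / sqrt \<delta>" 0])
      show "summable (\<lambda>n. sqrt r ^ n / sqrt \<delta>)"
        using r by (intro summable_divide summable_geometric) (simp add: real_sqrt_lt_1_iff)
      fix n
      have "sqrt \<delta> * sqrt r ^ n \<le> sqrt (a n)"
        using low[of n] by (simp flip: real_sqrt_mult real_sqrt_power)
      then have "r ^ n / sqrt (a n) \<le> r ^ n / (sqrt \<delta> * sqrt r ^ n)"
        using r \<delta> pos[of n] by (intro divide_left_mono) auto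
      also have "\<dots> = sqrt r ^ n / sqrt \<delta>"
        using r \<delta> by (simp add: field_simps flip: power_mult_distrib)
      finally show "norm (r ^ n / sqrt (a n)) \<le> sqrt r ^ n / sqrt \<delta>"
        using r pos[of n] by simp
    qed
  qed
qed

lemma step_series:
  assumes b: "b \<in> ell2" "ell2_norm b = 1" and z: "z \<in> \<D>"
  shows "summable (\<lambda>i. cmod (of_real ((cmod (b i))\<^sup>2) * z ^ i))"
    and "cmod (\<Sum>i. of_real ((cmod (b i))\<^sup>2) * z ^ Suc i) < 1"
    and "(\<Sum>i. of_real ((cmod (b i))\<^sup>2) * z ^ Suc i) = z * (\<Sum>i. of_real ((cmod (b i))\<^sup>2) * z ^ i)"
proof -
  note p = unit_ell2_sums[OF b]
  have le: "cmod (of_real ((cmod (b i))\<^sup>2) * z ^ i) \<le> (cmod (b i))\<^sup>2" for i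
    using z by (simp add: norm_mult norm_power mult_left_le power_le_one)
  show s: "summable (\<lambda>i. cmod (of_real ((cmod (b i))\<^sup>2) * z ^ i))"
    by (rule summable_comparison_test'[OF sums_summable[OF p], of 0]) (use le in simp)
  show eq: "(\<Sum>i. of_real ((cmod (b i))\<^sup>2) * z ^ Suc i) = z * (\<Sum>i. of_real ((cmod (b i))\<^sup>2) * z ^ i)"
    using suminf_mult[OF summable_norm_cancel[OF s], of z] by (simp add: mult_ac)
  have "cmod (\<Sum>i. of_real ((cmod (b i))\<^sup>2) * z ^ i) \<le> (\<Sum>i. cmod (of_real ((cmod (b i))\<^sup>2) * z ^ i))"
    by (rule summable_norm[OF s])
  also have "\<dots> \<le> (\<Sum>i. (cmod (b i))\<^sup>2)" by (intro suminf_le le s sums_summable[OF p])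
  also have "\<dots> = 1" using p by (simp add: sums_iff)
  finally have "cmod z * cmod (\<Sum>i. of_real ((cmod (b i))\<^sup>2) * z ^ i) \<le> cmod z * 1"
    by (intro mult_left_mono) auto
  then show "cmod (\<Sum>i. of_real ((cmod (b i))\<^sup>2) * z ^ Suc i) < 1"
    using z unfolding eq by (simp add: norm_mult)
qed

text \<open>Compare coefficients in \<open>A(z) = 1 + z P(z) A(z)\<close>, where \<open>A\<close> is the given generating function
  and \<open>z P(z)\<close> the series in its denominator.\<close>

lemma renewal_coeffs_recursion:
  assumes b: "b \<in> ell2" "ell2_norm b = 1" and a: "renewal_coeffs b a"
  shows "a 0 = 1" "a (Suc n) = (\<Sum>i\<le>n. (cmod (b i))\<^sup>2 * a (n - i))"
proof -
  define p where "p i = complex_of_real ((cmod (b i))\<^sup>2)" for i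
  define A where "A z = 1 / (1 - (\<Sum>i. p i * z ^ Suc i))" for z
  have A: "(\<lambda>n. of_real (a n) * z ^ n) sums A z" if "z \<in> \<D>" for z
    using a that by (simp add: renewal_coeffs_def A_def p_def)
  define d where "d n = (case n of 0 \<Rightarrow> 1 | Suc m \<Rightarrow> \<Sum>i\<le>m. p i * of_real (a (m - i)))" for n
  have "(\<lambda>n. d n * z ^ n) sums A z" if z: "z \<in> \<D>" for z
  proof -
    define P where "P = (\<Sum>i. p i * z ^ i)"
    have ps: "summable (\<lambda>i. norm (p i * z ^ i))" using step_series[OF b z] by (simp add: p_def)
    obtain x :: real where x: "cmod z < x" "x < 1" using z dense[of "cmod z" 1] by auto
    have "0 \<le> x" using x(1) norm_ge_zero[of z] by linarith
    then have "complex_of_real x \<in> \<D>" using x by simp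
    then have "summable (\<lambda>n. of_real (a n) * complex_of_real x ^ n)" using A sums_summable by blast
    then have as: "summable (\<lambda>n. norm (of_real (a n) * z ^ n))"
      by (rule powser_insidea) (use x \<open>0 \<le> x\<close> in simp)
    have "(\<lambda>n. \<Sum>i\<le>n. (p i * z ^ i) * (of_real (a (n - i)) * z ^ (n - i))) sums (P * A z)"
      using Cauchy_product_sums[OF ps as] A[OF z] by (simp add: P_def sums_iff)
    also have "(\<lambda>n. \<Sum>i\<le>n. (p i * z ^ i) * (of_real (a (n - i)) * z ^ (n - i))) = (\<lambda>n. d (Suc n) * z ^ n)"
    proof
      fix n
      have "(p i * z ^ i) * (of_real (a (n - i)) * z ^ (n - i)) = p i * of_real (a (n - i)) * z ^ n" if "i \<le> n" for i
        using that by (simp add: mult_ac flip: power_add)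
      then show "(\<Sum>i\<le>n. (p i * z ^ i) * (of_real (a (n - i)) * z ^ (n - i))) = d (Suc n) * z ^ n"
        by (auto simp: d_def sum_distrib_right intro: sum.cong)
    qed
    finally have "(\<lambda>n. z * (d (Suc n) * z ^ n)) sums (z * (P * A z))" by (rule sums_mult)
    then have "(\<lambda>n. d (Suc n) * z ^ Suc n) sums (z * P * A z)" by (simp add: mult_ac)
    then have "(\<lambda>n. d n * z ^ n) sums (z * P * A z + 1)"
      using sums_Suc[of "\<lambda>n. d n * z ^ n"] by (simp add: d_def)
    also have "z * P * A z + 1 = A z"
    proof -
      have "(\<Sum>i. p i * z ^ Suc i) = z * P" "cmod (\<Sum>i. p i * z ^ Suc i) < 1"
        using step_series[OF b z] by (simp_all add: p_def P_def)
      then have "A z = 1 / (1 - z * P)" "1 - z * P \<noteq> 0" by (auto simp: A_def)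
      then show ?thesis by (simp add: field_simps)
    qed
    finally show ?thesis .
  qed
  then have "(\<lambda>n. of_real (a n)) = d"
    using taylor_unique(2)[of "\<lambda>n. of_real (a n)" A] taylor_unique(2)[of d A] A by simp
  then have ad: "complex_of_real (a n) = d n" for n by (rule fun_cong)
  show "a 0 = 1" using ad[of 0] by (simp add: d_def)
  have "complex_of_real (a (Suc n)) = of_real (\<Sum>i\<le>n. (cmod (b i))\<^sup>2 * a (n - i))"
    unfolding ad by (simp add: d_def p_def)
  then show "a (Suc n) = (\<Sum>i\<le>n. (cmod (b i))\<^sup>2 * a (n - i))" by (simp only: of_real_eq_iff)
qed

lemma renewal_weight_of_coeffs:
  assumes b: "b \<in> ell2" "ell2_norm b = 1" "b 0 \<noteq> 0" and a: "renewal_coeffs b a"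
  shows "renewal_weight a"
  using unit_ell2_sums[OF b(1,2)] b(3) renewal_coeffs_recursion[OF b(1,2) a]
  by (intro renewal_weight_of_recursion[of "\<lambda>i. (cmod (b i))\<^sup>2"]) auto

text \<open>The defining series of the sequence \<open>a\<close> at \<open>z * cnj w\<close> is the Drury-Arveson kernel at the two
  points of the disc; this is how \<open>a\<close> enters.\<close>

lemma da_kernel_disc:
  assumes b: "b \<in> ell2" "ell2_norm b = 1" and a: "renewal_coeffs b a"
    and zw: "z \<in> \<D>" "w \<in> \<D>"
  shows "da_kernel (disc_embedding b z) (disc_embedding b w) = weighted_kernel a z w"
proof -
  have "cmod z * cmod w < 1 * 1" using zw by (intro mult_strict_mono) auto
  then have u: "z * cnj w \<in> \<D>" by (simp add: norm_mult)
  have "disc_embedding b z i * cnj (disc_embedding b w i) = of_real ((cmod (b i))\<^sup>2) * (z * cnj w) ^ Suc i" for i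
    unfolding complex_norm_square disc_embedding_def by (simp add: power_mult_distrib mult_ac)
  then have "da_kernel (disc_embedding b z) (disc_embedding b w)
      = 1 / (1 - (\<Sum>i. of_real ((cmod (b i))\<^sup>2) * (z * cnj w) ^ Suc i))"
    by (simp only: da_kernel_def ell2_inner_def)
  also have "\<dots> = (\<Sum>n. of_real (a n) * (z * cnj w) ^ n)"
    using a u unfolding renewal_coeffs_def by (intro sums_unique) blast
  finally show ?thesis by (simp add: weighted_kernel_def)
qed

lemma space_on_embedded_disc:
  assumes DA: "drury_arveson H ip" and b: "b \<in> ell2" "ell2_norm b = 1" "b 0 \<noteq> 0"
    and a: "renewal_coeffs b a" and g: "g \<in> functions_on (embedded_disc b)"
  shows "g \<in> space_on H ip (embedded_disc b) \<longleftrightarrow> restr \<D> (g \<circ> disc_embedding b) \<in> weighted_hardy a"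
proof -
  interpret renewal_weight a by (rule renewal_weight_of_coeffs[OF b a])
  have "g \<in> space_on H ip (embedded_disc b) \<longleftrightarrow> kernel_dominated (embedded_disc b) da_kernel g"
    using space_on_iff[OF DA embedded_disc_subset[OF b(1,2)]] g by simp
  also have "\<dots> \<longleftrightarrow> kernel_dominated \<D> (weighted_kernel a) (g \<circ> disc_embedding b)"
    unfolding embedded_disc_def
    by (intro kernel_dominated_pullback inj_on_subset[OF inj_disc_embedding[of b, OF b(3)]] da_kernel_disc[OF b(1,2) a]) auto
  also have "\<dots> \<longleftrightarrow> kernel_dominated \<D> (weighted_kernel a) (restr \<D> (g \<circ> disc_embedding b))"
    by (intro kernel_dominated_cong) (simp add: restr_def)
  also have "\<dots> \<longleftrightarrow> restr \<D> (g \<circ> disc_embedding b) \<in> weighted_hardy a"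
    unfolding R.mem_iff_dominated by (auto simp: functions_on_def restr_def)
  finally show ?thesis .
qed

text \<open>Algebra isomorphisms are constrained on their source alone, so inverting one requires that the
  source contains the results of its operations.\<close>

definition closed_algebra :: "('a \<Rightarrow> complex) set \<Rightarrow> bool" where
  "closed_algebra A \<longleftrightarrow> (\<forall>g\<in>A. \<forall>h\<in>A. (\<lambda>x. g x + h x) \<in> A \<and> (\<lambda>x. g x * h x) \<in> A) \<and> (\<forall>c. \<forall>h\<in>A. (\<lambda>x. c * h x) \<in> A)"

lemma (in hilbert_function_space) closed_multiplier_algebra: "closed_algebra (multiplier_algebra X H)"
  unfolding closed_algebra_def using multiplier_add multiplier_mult multiplier_scale by blast

lemma algebra_isoD:
  assumes "algebra_iso A B \<Phi>"
  shows "bij_betw \<Phi> A B" "\<And>g h. g \<in> A \<Longrightarrow> h \<in> A \<Longrightarrow> \<Phi> (\<lambda>x. g x + h x) = (\<lambda>x. \<Phi> g x + \<Phi> h x)"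
    "\<And>c h. h \<in> A \<Longrightarrow> \<Phi> (\<lambda>x. c * h x) = (\<lambda>x. c * \<Phi> h x)"
    "\<And>g h. g \<in> A \<Longrightarrow> h \<in> A \<Longrightarrow> \<Phi> (\<lambda>x. g x * h x) = (\<lambda>x. \<Phi> g x * \<Phi> h x)"
  using assms by (auto simp: algebra_iso_def)

lemma algebra_iso_inverse:
  assumes A: "closed_algebra A" and iso: "algebra_iso A B \<Phi>"
  shows "algebra_iso B A (inv_into A \<Phi>)"
proof -
  note \<Phi> = algebra_isoD[OF iso]
  let ?\<Psi> = "inv_into A \<Phi>"
  have bij: "bij_betw ?\<Psi> B A" by (rule bij_betw_inv_into[OF \<Phi>(1)])
  have mem: "?\<Psi> h \<in> A" "\<Phi> (?\<Psi> h) = h" if "h \<in> B" for h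
    using that \<Phi>(1) bij by (auto simp: bij_betw_def f_inv_into_f)
  have eq: "?\<Psi> h = u" if "u \<in> A" "\<Phi> u = h" for h u
    using that \<Phi>(1) by (auto simp: bij_betw_def)
  show ?thesis
    unfolding algebra_iso_def
  proof (intro conjI ballI allI bij)
    fix g h assume gh: "g \<in> B" "h \<in> B"
    show "?\<Psi> (\<lambda>x. g x + h x) = (\<lambda>x. ?\<Psi> g x + ?\<Psi> h x)"
      using A mem gh \<Phi>(2)[OF mem(1) mem(1)] by (intro eq) (auto simp: closed_algebra_def)
    show "?\<Psi> (\<lambda>x. g x * h x) = (\<lambda>x. ?\<Psi> g x * ?\<Psi> h x)"
      using A mem gh \<Phi>(4)[OF mem(1) mem(1)] by (intro eq) (auto simp: closed_algebra_def)
  next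
    fix c h assume "h \<in> B"
    then show "?\<Psi> (\<lambda>x. c * h x) = (\<lambda>x. c * ?\<Psi> h x)"
      using A mem \<Phi>(3)[OF mem(1)] by (intro eq) (auto simp: closed_algebra_def)
  qed
qed

lemma algebra_iso_compose:
  assumes "algebra_iso A B \<Phi>" "algebra_iso B C \<Psi>"
  shows "algebra_iso A C (\<Psi> \<circ> \<Phi>)"
proof -
  note \<Phi> = algebra_isoD[OF assms(1)] and \<Psi> = algebra_isoD[OF assms(2)]
  have "\<Phi> h \<in> B" if "h \<in> A" for h using that \<Phi>(1) by (auto simp: bij_betw_def)
  then show ?thesis
    unfolding algebra_iso_def using bij_betw_trans[OF \<Phi>(1) \<Psi>(1)] by (simp add: \<Phi>(2-4) \<Psi>(2-4))
qed

lemma algebra_iso_pullback: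
  assumes f: "bij_betw f D V" and HV: "HV \<subseteq> functions_on V" and HD: "HD \<subseteq> functions_on D"
    and mem: "\<And>g. g \<in> functions_on V \<Longrightarrow> g \<in> HV \<longleftrightarrow> restr D (g \<circ> f) \<in> HD"
  defines "T \<equiv> \<lambda>h. restr D (h \<circ> f)"
  shows "\<And>h. h \<in> functions_on V \<Longrightarrow> h \<in> multiplier_algebra V HV \<longleftrightarrow> T h \<in> multiplier_algebra D HD"
    and "algebra_iso (multiplier_algebra V HV) (multiplier_algebra D HD) T"
proof -
  define S where "S u = restr V (u \<circ> inv_into D f)" for u :: "'a \<Rightarrow> complex"
  have fV: "f x \<in> V" if "x \<in> D" for x using f that by (auto simp: bij_betw_def)
  have inv: "inv_into D f (f x) = x" if "x \<in> D" for x using f that by (auto simp: bij_betw_def)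
  have inv': "inv_into D f y \<in> D" "f (inv_into D f y) = y" if "y \<in> V" for y
    using f that by (auto simp: bij_betw_def f_inv_into_f inv_into_into)
  have TS: "T (S u) = u" if "u \<in> functions_on D" for u
    using that fV inv by (intro ext) (auto simp: T_def S_def restr_def functions_on_def)
  have ST: "S (T h) = h" if "h \<in> functions_on V" for h
    using that inv' by (intro ext) (auto simp: T_def S_def restr_def functions_on_def)
  have SV: "S u \<in> functions_on V" and TD: "T h \<in> functions_on D" for u h
    by (auto simp: T_def S_def restr_def functions_on_def)
  have Tmult: "T (\<lambda>x. g x * h x) = (\<lambda>x. T g x * T h x)" for g h by (auto simp: T_def restr_def)
  show iff: "h \<in> multiplier_algebra V HV \<longleftrightarrow> T h \<in> multiplier_algebra D HD" if h: "h \<in> functions_on V" for h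
  proof
    assume m: "h \<in> multiplier_algebra V HV"
    have "(\<lambda>x. T h x * F x) \<in> HD" if F: "F \<in> HD" for F
    proof -
      have "T (S F) \<in> HD" using TS F HD by auto
      then have "S F \<in> HV" using mem[OF SV] by (simp add: T_def)
      then have "(\<lambda>x. h x * S F x) \<in> HV" using m by (simp add: multiplier_algebra_def)
      then have "T (\<lambda>x. h x * S F x) \<in> HD" using mem HV unfolding T_def by blast
      then show ?thesis using TS F HD by (auto simp: Tmult)
    qed
    then show "T h \<in> multiplier_algebra D HD" using TD by (simp add: multiplier_algebra_def)
  next
    assume m: "T h \<in> multiplier_algebra D HD"
    have "(\<lambda>x. h x * g x) \<in> HV" if g: "g \<in> HV" for g
    proof -
      have "T g \<in> HD" using mem g HV unfolding T_def by blast
      then have "T (\<lambda>x. h x * g x) \<in> HD" using m by (simp add: multiplier_algebra_def Tmult)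
      moreover have "(\<lambda>x. h x * g x) \<in> functions_on V" using h by (simp add: functions_on_def)
      ultimately show ?thesis using mem unfolding T_def by blast
    qed
    then show "h \<in> multiplier_algebra V HV" using h by (simp add: multiplier_algebra_def)
  qed
  have sub: "multiplier_algebra V HV \<subseteq> functions_on V" "multiplier_algebra D HD \<subseteq> functions_on D"
    by (auto simp: multiplier_algebra_def)
  have "bij_betw T (multiplier_algebra V HV) (multiplier_algebra D HD)"
  proof (rule bij_betw_byWitness[where f' = S])
    show "\<forall>h\<in>multiplier_algebra V HV. S (T h) = h" using ST sub by blast
    show "\<forall>u\<in>multiplier_algebra D HD. T (S u) = u" using TS sub by blast
    show "T ` multiplier_algebra V HV \<subseteq> multiplier_algebra D HD" using iff sub by blast
    show "S ` multiplier_algebra D HD \<subseteq> multiplier_algebra V HV" using iff[OF SV] TS sub by force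
  qed
  then show "algebra_iso (multiplier_algebra V HV) (multiplier_algebra D HD) T"
    unfolding algebra_iso_def by (auto simp: T_def restr_def)
qed

section \<open>Isomorphisms of multiplier algebras on the disc\<close>

abbreviation disc_one :: "complex \<Rightarrow> complex" where "disc_one \<equiv> restr \<D> (\<lambda>z. 1)"

abbreviation disc_coord :: "complex \<Rightarrow> complex" where "disc_coord \<equiv> restr \<D> (\<lambda>z. z)"

lemma disc_one_mult:
  assumes "h \<in> functions_on \<D>"
  shows "(\<lambda>z. disc_one z * h z) = h" "(\<lambda>z. h z * disc_one z) = h"
  using assms by (auto simp: restr_def functions_on_def intro!: ext)

lemma multiplier_on_disc: "h \<in> weighted_multipliers a \<Longrightarrow> h \<in> functions_on \<D>"
  by (simp add: multiplier_algebra_def)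

lemma charactersD:
  assumes "\<rho> \<in> characters A"
  shows "\<exists>h\<in>A. \<rho> h \<noteq> 0"
    and "\<And>g h. g \<in> A \<Longrightarrow> h \<in> A \<Longrightarrow> \<rho> (\<lambda>x. g x + h x) = \<rho> g + \<rho> h"
    and "\<And>c h. h \<in> A \<Longrightarrow> \<rho> (\<lambda>x. c * h x) = c * \<rho> h"
    and "\<And>g h. g \<in> A \<Longrightarrow> h \<in> A \<Longrightarrow> \<rho> (\<lambda>x. g x * h x) = \<rho> g * \<rho> h"
  using assms unfolding characters_def by blast+

lemma character_unit:
  assumes \<rho>: "\<rho> \<in> characters A" and e: "e \<in> A" "\<And>h. h \<in> A \<Longrightarrow> (\<lambda>x. e x * h x) = h"
  shows "\<rho> e = 1"
proof -
  obtain k where k: "k \<in> A" "\<rho> k \<noteq> 0" using charactersD(1)[OF \<rho>] by blast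
  have "\<rho> (\<lambda>x. e x * k x) = \<rho> e * \<rho> k" by (rule charactersD(4)[OF \<rho> e(1) k(1)])
  then show ?thesis using e(2)[OF k(1)] k(2) by simp
qed

lemma disc_iso_unit:
  assumes iso: "algebra_iso A B \<Phi>" and A: "disc_one \<in> A" "A \<subseteq> functions_on \<D>"
    and B: "disc_one \<in> B" "B \<subseteq> functions_on \<D>"
  shows "\<Phi> disc_one = disc_one"
proof -
  note \<Phi> = algebra_isoD[OF iso]
  obtain u where u: "u \<in> A" "\<Phi> u = disc_one" using \<Phi>(1) B(1) by (auto simp: bij_betw_def)
  have "\<Phi> disc_one \<in> functions_on \<D>" using \<Phi>(1) A(1) B(2) by (auto simp: bij_betw_def)
  then have "\<Phi> disc_one = (\<lambda>z. \<Phi> disc_one z * \<Phi> u z)" unfolding u(2) by (simp add: disc_one_mult)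
  also have "\<dots> = \<Phi> (\<lambda>z. disc_one z * u z)" using \<Phi>(4) A(1) u(1) by simp
  also have "(\<lambda>z. disc_one z * u z) = u" using disc_one_mult u(1) A(2) by blast
  finally show ?thesis using u(2) by simp
qed

context renewal_weight
begin

lemma closed_multipliers: "closed_algebra (weighted_multipliers a)"
  by (rule R.closed_multiplier_algebra)

lemma coord_multiplier: "disc_coord \<in> weighted_multipliers a"
proof -
  have "(\<lambda>z. disc_coord z * F z) = (\<lambda>z. z ^ 1 * F z)" if "F \<in> weighted_hardy a" for F
    using weighted_hardyD(3)[OF that] by (auto simp: restr_def functions_on_def)
  then show ?thesis
    using shift_mem(1)[of _ 1] by (simp add: multiplier_algebra_def functions_on_def restr_def)
qed

text \<open>The geometric series for \<open>1 / (l - z)\<close> converges in multiplier norm, by the subexponential decay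
  of the weight.\<close>

lemma resolvent_multiplier:
  assumes l: "1 < cmod l"
  obtains u where "u \<in> weighted_multipliers a" "\<And>z. z \<in> \<D> \<Longrightarrow> (l - z) * u z = 1"
proof -
  define c where "c n = (1 / l) ^ Suc n" for n
  have "summable (\<lambda>n. (1 / cmod l) ^ n / sqrt (a n))" using l by (intro subexp) (auto simp: divide_less_eq)
  then have "summable (\<lambda>n. (1 / cmod l) * ((1 / cmod l) ^ n / sqrt (a n)))" by (rule summable_mult)
  then have "summable (\<lambda>n. cmod (c n) / sqrt (a n))"
    by (simp add: c_def norm_mult norm_divide norm_power power_divide mult.assoc)
  note h = series_multiplier[OF this]
  have "(l - z) * restr \<D> (\<lambda>z. \<Sum>n. c n * z ^ n) z = 1" if z: "z \<in> \<D>" for z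
  proof -
    have l0: "l \<noteq> 0" using l by auto
    have "cmod (z / l) < 1" using z l by (simp add: norm_divide divide_less_eq)
    then have "(\<lambda>n. (1 / l) * (z / l) ^ n) sums ((1 / l) * (1 / (1 - z / l)))"
      by (intro sums_mult geometric_sums)
    moreover have "(1 / l) * (z / l) ^ n = c n * z ^ n" for n
      by (simp add: c_def power_divide)
    moreover have "(1 / l) * (1 / (1 - z / l)) = 1 / (l - z)" using l0 by (simp add: field_simps)
    ultimately have "restr \<D> (\<lambda>z. \<Sum>n. c n * z ^ n) z = 1 / (l - z)"
      using h(3)[OF z] by (simp add: sums_unique2)
    moreover have "l \<noteq> z" using z l by auto
    ultimately show ?thesis by simp
  qed
  with h(1) show thesis by (rule that)
qed

end

text \<open>If the image of the coordinate took a value \<open>l\<close> with \<open>\<bar>l\<bar> > 1\<close>, then \<open>l - z\<close> would be invertible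
  in the source, while its image vanishes at a point.  So the image is bounded by one; by the
  maximum principle a unimodular value would make it constant, against injectivity.\<close>

lemma iso_coord_self_map:
  assumes "renewal_weight a" "renewal_weight a'"
    and iso: "algebra_iso (weighted_multipliers a) (weighted_multipliers a') \<Phi>"
  shows "\<Phi> disc_coord holomorphic_on \<D>" "\<And>w. w \<in> \<D> \<Longrightarrow> \<Phi> disc_coord w \<in> \<D>"
proof -
  interpret A: renewal_weight a by fact
  interpret A': renewal_weight a' by fact
  note \<Phi> = algebra_isoD[OF iso]
  define \<phi> where "\<phi> = \<Phi> disc_coord"
  note one = A.R.multiplier_one and one' = A'.R.multiplier_one
  have unit: "\<Phi> disc_one = disc_one"
    by (rule disc_iso_unit[OF iso one _ one']) (use multiplier_on_disc in blast)+
  have \<phi>: "\<phi> \<in> weighted_multipliers a'"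
    using \<Phi>(1) A.coord_multiplier by (auto simp: \<phi>_def bij_betw_def)
  show hol: "\<Phi> disc_coord holomorphic_on \<D>"
    using A'.weighted_hardyD(1)[OF A'.multiplier_mem[OF \<phi>]] by (simp add: \<phi>_def)
  have le: "cmod (\<phi> w) \<le> 1" if w: "w \<in> \<D>" for w
  proof (rule ccontr)
    assume "\<not> cmod (\<phi> w) \<le> 1"
    then obtain u where u: "u \<in> weighted_multipliers a" "\<And>z. z \<in> \<D> \<Longrightarrow> (\<phi> w - z) * u z = 1"
      using A.resolvent_multiplier[of "\<phi> w"] by auto
    define q where "q = (\<lambda>z. \<phi> w * disc_one z + (- 1) * disc_coord z)"
    have q: "q \<in> weighted_multipliers a"
      unfolding q_def by (intro A.R.multiplier_add A.R.multiplier_scale one A.coord_multiplier)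
    have "(\<lambda>z. q z * u z) = disc_one"
      using u(2) by (auto simp: q_def restr_def)
    then have "disc_one = (\<lambda>z. \<Phi> q z * \<Phi> u z)" using \<Phi>(4)[OF q u(1)] unit by simp
    moreover have "\<Phi> q = (\<lambda>z. \<phi> w * disc_one z + (- 1) * \<phi> z)"
      unfolding q_def
      using \<Phi>(2)[OF A.R.multiplier_scale[OF one] A.R.multiplier_scale[OF A.coord_multiplier], of "\<phi> w" "-1"]
        \<Phi>(3)[OF one, of "\<phi> w"] \<Phi>(3)[OF A.coord_multiplier, of "-1"] unit by (simp add: \<phi>_def)
    ultimately have "disc_one w = (\<phi> w * disc_one w + (- 1) * \<phi> w) * \<Phi> u w" by metis
    then show False using w by (simp add: restr_def)
  qed
  show "\<Phi> disc_coord w \<in> \<D>" if w: "w \<in> \<D>" for w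
  proof (rule ccontr)
    assume "\<Phi> disc_coord w \<notin> \<D>"
    then have "cmod (\<phi> z) \<le> cmod (\<phi> w)" if "z \<in> \<D>" for z
      using le[OF that] by (simp add: \<phi>_def)
    then have "\<phi> constant_on \<D>"
      using maximum_modulus_principle[of \<phi> \<D> \<D> w] hol w by (auto simp: \<phi>_def)
    then obtain c where c: "\<And>z. z \<in> \<D> \<Longrightarrow> \<phi> z = c" by (auto simp: constant_on_def)
    have "\<phi> = (\<lambda>z. c * disc_one z)"
      using c multiplier_on_disc[OF \<phi>] by (auto simp: restr_def functions_on_def)
    also have "\<dots> = \<Phi> (\<lambda>z. c * disc_one z)" using \<Phi>(3)[OF one] unit by simp
    finally have "disc_coord = (\<lambda>z. c * disc_one z)"
      unfolding \<phi>_def using \<Phi>(1) A.coord_multiplier A.R.multiplier_scale[OF one, of c]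
      by (auto simp: bij_betw_def inj_on_def)
    from fun_cong[OF this, of 0] fun_cong[OF this, of "1/2"] show False by (simp add: restr_def)
  qed
qed

text \<open>A map with a holomorphic left inverse is injective, so its image is open, and the left inverse
  is a right inverse on this image.  The identity theorem extends this to the whole disc.\<close>

lemma disc_automorphism_of_left_inverse:
  assumes hol: "\<phi> holomorphic_on \<D>" "\<psi> holomorphic_on \<D>"
    and maps: "\<And>z. z \<in> \<D> \<Longrightarrow> \<phi> z \<in> \<D>" "\<And>z. z \<in> \<D> \<Longrightarrow> \<psi> z \<in> \<D>"
    and inv: "\<And>z. z \<in> \<D> \<Longrightarrow> \<psi> (\<phi> z) = z"
  shows "disc_automorphism \<phi>" "disc_automorphism \<psi>"
proof -
  have inj: "inj_on \<phi> \<D>" using inv by (metis inj_onI)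
  have "(\<phi> \<circ> \<psi>) z = z" if "z \<in> \<D>" for z
  proof (rule analytic_continuation_open[of "\<phi> ` \<D>" \<D> "\<phi> \<circ> \<psi>" "\<lambda>z. z"])
    show "open (\<phi> ` \<D>)" by (rule open_mapping_thm3[OF hol(1) _ inj]) simp
    show "(\<phi> \<circ> \<psi>) holomorphic_on \<D>"
      by (rule holomorphic_on_compose_gen[OF hol(2,1)]) (use maps in blast)
    show "(\<phi> \<circ> \<psi>) z = z" if "z \<in> \<phi> ` \<D>" for z using that inv by auto
  qed (use maps that in auto)
  then have inv': "\<phi> (\<psi> z) = z" if "z \<in> \<D>" for z using that by simp
  have "bij_betw \<phi> \<D> \<D>" by (rule bij_betw_byWitness[where f' = \<psi>]) (use inv inv' maps in auto)
  moreover have "bij_betw \<psi> \<D> \<D>" by (rule bij_betw_byWitness[where f' = \<phi>]) (use inv inv' maps in auto)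
  ultimately show "disc_automorphism \<phi>" "disc_automorphism \<psi>"
    using hol by (simp_all add: disc_automorphism_def)
qed

text \<open>Let \<open>\<phi>\<close> and \<open>\<psi>\<close> be the images of the coordinate under the inverse isomorphism \<open>\<Psi>\<close> and under
  \<open>\<Phi>\<close>.  Evaluating \<open>\<Psi> h\<close> at \<open>w\<close> is a character of the target algebra over the point \<open>\<phi> w\<close> of
  the disc, hence \<open>\<Psi> h = h \<circ> \<phi>\<close> by the condition on the fibres.  For \<open>h = \<psi>\<close> this reads
  \<open>\<psi> \<circ> \<phi> = id\<close>, so both are automorphisms of the disc, and by automorphism invariance
  \<open>\<Psi>\<close> maps the target algebra onto itself.\<close>

lemma iso_imp_multipliers_eq:
  assumes wa: "renewal_weight a" and wa': "renewal_weight a'"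
    and iso: "algebra_iso (weighted_multipliers a) (weighted_multipliers a') \<Phi>"
    and fibre: "\<And>\<rho> l h. \<rho> \<in> characters (weighted_multipliers a') \<Longrightarrow> \<rho> disc_coord = l \<Longrightarrow> l \<in> \<D> \<Longrightarrow>
      h \<in> weighted_multipliers a' \<Longrightarrow> \<rho> h = h l"
    and aut: "\<And>\<theta> h. disc_automorphism \<theta> \<Longrightarrow> h \<in> weighted_multipliers a' \<Longrightarrow>
      restr \<D> (h \<circ> \<theta>) \<in> weighted_multipliers a'"
  shows "weighted_multipliers a = weighted_multipliers a'"
proof -
  interpret A: renewal_weight a by fact
  interpret A': renewal_weight a' by fact
  define \<Psi> where "\<Psi> = inv_into (weighted_multipliers a) \<Phi>"
  have iso': "algebra_iso (weighted_multipliers a') (weighted_multipliers a) \<Psi>"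
    unfolding \<Psi>_def by (rule algebra_iso_inverse[OF A.closed_multipliers iso])
  note \<Phi> = algebra_isoD[OF iso] and \<Psi> = algebra_isoD[OF iso']
  define \<phi> where "\<phi> = \<Psi> disc_coord"
  define \<psi> where "\<psi> = \<Phi> disc_coord"
  note \<phi> = iso_coord_self_map[OF wa' wa iso', folded \<phi>_def]
  note \<psi> = iso_coord_self_map[OF wa wa' iso, folded \<psi>_def]
  have \<Psi>_mem: "\<Psi> h \<in> weighted_multipliers a" if "h \<in> weighted_multipliers a'" for h
    using \<Psi>(1) that by (auto simp: bij_betw_def)
  have unit: "\<Psi> disc_one = disc_one"
    by (rule disc_iso_unit[OF iso' A'.R.multiplier_one _ A.R.multiplier_one]) (use multiplier_on_disc in blast)+
  have comp: "\<Psi> h w = h (\<phi> w)" if h: "h \<in> weighted_multipliers a'" and w: "w \<in> \<D>" for h w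
  proof -
    define \<rho> where "\<rho> = restr (weighted_multipliers a') (\<lambda>h. \<Psi> h w)"
    have "\<rho> \<in> characters (weighted_multipliers a')"
      unfolding characters_def
    proof (intro CollectI conjI ballI allI)
      show "\<rho> \<in> functions_on (weighted_multipliers a')" by (simp add: \<rho>_def functions_on_def restr_def)
      show "\<exists>h\<in>weighted_multipliers a'. \<rho> h \<noteq> 0"
      proof (rule bexI[OF _ A'.R.multiplier_one])
        have "\<rho> disc_one = \<Psi> disc_one w"
          using A'.R.multiplier_one by (simp add: \<rho>_def restr_def[of "weighted_multipliers a'"])
        then show "\<rho> disc_one \<noteq> 0" using w unfolding unit by (simp add: restr_def)
      qed
    next
      fix g h assume "g \<in> weighted_multipliers a'" "h \<in> weighted_multipliers a'"
      then show "\<rho> (\<lambda>x. g x + h x) = \<rho> g + \<rho> h" "\<rho> (\<lambda>x. g x * h x) = \<rho> g * \<rho> h"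
        by (simp_all add: \<rho>_def restr_def A'.R.multiplier_add A'.R.multiplier_mult \<Psi>)
    next
      fix c h assume "h \<in> weighted_multipliers a'"
      then show "\<rho> (\<lambda>x. c * h x) = c * \<rho> h"
        by (simp add: \<rho>_def restr_def A'.R.multiplier_scale \<Psi>)
    qed
    moreover have "\<rho> disc_coord = \<phi> w"
      using A'.coord_multiplier by (simp add: \<rho>_def \<phi>_def restr_def[of "weighted_multipliers a'"])
    ultimately have "\<rho> h = h (\<phi> w)" using fibre \<phi>(2)[OF w] h by blast
    then show ?thesis using h by (simp add: \<rho>_def restr_def)
  qed
  have \<psi>_mem: "\<psi> \<in> weighted_multipliers a'"
    using \<Phi>(1) A.coord_multiplier by (auto simp: \<psi>_def bij_betw_def)
  have "\<Psi> \<psi> = disc_coord"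
    unfolding \<Psi>_def \<psi>_def using \<Phi>(1) A.coord_multiplier by (auto simp: bij_betw_def)
  then have inv: "\<psi> (\<phi> w) = w" if "w \<in> \<D>" for w
    using comp[OF \<psi>_mem that] that by (simp add: restr_def)
  note auts = disc_automorphism_of_left_inverse[OF \<phi>(1) \<psi>(1) \<phi>(2) \<psi>(2) inv]
  have \<Psi>_eq: "\<Psi> h = restr \<D> (h \<circ> \<phi>)" if h: "h \<in> weighted_multipliers a'" for h
    using comp[OF h] multiplier_on_disc[OF \<Psi>_mem[OF h]] by (auto simp: restr_def functions_on_def)
  show ?thesis
  proof (intro equalityI subsetI)
    fix g assume "g \<in> weighted_multipliers a"
    then obtain h where "h \<in> weighted_multipliers a'" "g = \<Psi> h" using \<Psi>(1) by (auto simp: bij_betw_def)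
    then show "g \<in> weighted_multipliers a'" using aut[OF auts(1)] \<Psi>_eq by simp
  next
    fix h assume h: "h \<in> weighted_multipliers a'"
    have "restr \<D> (restr \<D> (h \<circ> \<psi>) \<circ> \<phi>) = h"
      using \<phi>(2) inv multiplier_on_disc[OF h] by (auto simp: restr_def functions_on_def)
    then have "h = \<Psi> (restr \<D> (h \<circ> \<psi>))" using \<Psi>_eq aut[OF auts(2) h] by simp
    then show "h \<in> weighted_multipliers a" using \<Psi>_mem[OF aut[OF auts(2) h]] by simp
  qed
qed

section \<open>Bounded analytic functions\<close>

lemma has_integral_cis_orthogonal:
  "((\<lambda>t. cis (real n * t) * cnj (cis (real m * t))) has_integral (if n = m then of_real (2 * pi) else 0)) {0..2*pi}"
proof (cases "n = m")
  case True
  have "cis (real n * t) * cnj (cis (real m * t)) = 1" for t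
    using True by (simp add: cis_cnj cis_mult)
  then show ?thesis using True has_integral_const_real[of "1::complex" 0 "2*pi"] by (simp add: scaleR_conv_of_real)
next
  case False
  define k :: real where "k = real n - real m"
  have k: "k \<noteq> 0" "k \<in> \<int>" using False by (auto simp: k_def)
  have "((\<lambda>t. cis (k * t)) has_integral (exp (\<i> * of_real k * of_real (2*pi)) / (\<i> * of_real k) - exp (\<i> * of_real k * of_real 0) / (\<i> * of_real k))) {0..2*pi}"
  proof (rule fundamental_theorem_of_calculus)
    fix t :: real
    have "((\<lambda>z. exp (\<i> * of_real k * z) / (\<i> * of_real k)) has_field_derivative cis (k * t)) (at (of_real t))"
      using k by (auto intro!: derivative_eq_intros simp: cis_conv_exp mult_ac)
    then show "((\<lambda>t. exp (\<i> * of_real k * of_real t) / (\<i> * of_real k)) has_vector_derivative cis (k * t)) (at t within {0..2*pi})"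
      by (rule has_vector_derivative_real_field)
  qed simp
  moreover have "exp (\<i> * of_real k * of_real (2*pi)) = 1"
    using cis_multiple_2pi[OF k(2)] by (simp add: cis_conv_exp mult_ac)
  moreover have "cis (real n * t) * cnj (cis (real m * t)) = cis (k * t)" for t
    by (simp add: cis_cnj cis_mult k_def left_diff_distrib)
  ultimately show ?thesis using False by simp
qed

text \<open>Orthogonality gives the identity for the partial sums of the power series, which are uniformly
  bounded on the circle; dominated convergence gives it for \<open>G\<close>.\<close>

lemma parseval:
  assumes G: "G holomorphic_on \<D>" and r: "0 \<le> r" "r < 1"
  shows "(\<lambda>t. (cmod (G (of_real r * cis t)))\<^sup>2) integrable_on {0..2*pi}"
    and "(\<lambda>n. 2 * pi * ((cmod (taylor G n))\<^sup>2 * r ^ (2 * n))) sums integral {0..2*pi} (\<lambda>t. (cmod (G (of_real r * cis t)))\<^sup>2)"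
proof -
  define g where "g = taylor G"
  have z: "of_real r * cis t \<in> \<D>" for t using r by (simp add: norm_mult)
  define P where "P N t = (\<Sum>n<N. g n * (of_real r * cis t) ^ n)" for N t
  have lim: "(\<lambda>N. P N t) \<longlonglongrightarrow> G (of_real r * cis t)" for t
    using taylor_sums[OF G z, of t] by (simp add: P_def g_def sums_def)
  have int: "((\<lambda>t. (cmod (P N t))\<^sup>2) has_integral (\<Sum>n<N. 2 * pi * ((cmod (g n))\<^sup>2 * r ^ (2 * n)))) {0..2*pi}" for N
  proof -
    have sq: "of_real ((cmod (P N t))\<^sup>2) = (\<Sum>n<N. \<Sum>m<N. (g n * of_real (r ^ n) * cnj (g m * of_real (r ^ m))) *
        (cis (real n * t) * cnj (cis (real m * t))))" for t
    proof -
      have "(of_real r * cis t) ^ n = of_real (r ^ n) * cis (real n * t)" for n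
        unfolding power_mult_distrib of_real_power Complex.DeMoivre ..
      then have P: "P N t = (\<Sum>n<N. g n * of_real (r ^ n) * cis (real n * t))"
        by (simp only: P_def mult.assoc)
      show ?thesis
        unfolding complex_norm_square P cnj_sum sum_product complex_cnj_mult
        by (intro sum.cong refl) (simp only: mult_ac)
    qed
    have "((\<lambda>t. \<Sum>n<N. \<Sum>m<N. (g n * of_real (r ^ n) * cnj (g m * of_real (r ^ m))) *
        (cis (real n * t) * cnj (cis (real m * t)))) has_integral
        (\<Sum>n<N. \<Sum>m<N. (g n * of_real (r ^ n) * cnj (g m * of_real (r ^ m))) * (if n = m then of_real (2 * pi) else 0))) {0..2*pi}"
      by (rule has_integral_sum, simp, rule has_integral_sum, simp, rule has_integral_mult_right, rule has_integral_cis_orthogonal)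
    also have "(\<Sum>n<N. \<Sum>m<N. (g n * of_real (r ^ n) * cnj (g m * of_real (r ^ m))) * (if n = m then of_real (2 * pi) else 0))
        = (\<Sum>n<N. (g n * of_real (r ^ n) * cnj (g n * of_real (r ^ n))) * of_real (2 * pi))"
      by (intro sum.cong refl) (simp add: if_distrib[of "\<lambda>x. _ * x"] cong: if_cong)
    also have "\<dots> = of_real (\<Sum>n<N. 2 * pi * ((cmod (g n))\<^sup>2 * r ^ (2 * n)))"
    proof -
      have "(cmod (g n * of_real (r ^ n)))\<^sup>2 = (cmod (g n))\<^sup>2 * r ^ (2 * n)" for n
        unfolding power_even_eq norm_mult power_mult_distrib norm_of_real using r by simp
      then show ?thesis
        unfolding complex_norm_square[symmetric] of_real_sum of_real_mult
        by (intro sum.cong refl) (simp only: of_real_mult mult_ac)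
    qed
    finally have "((\<lambda>t. complex_of_real ((cmod (P N t))\<^sup>2)) has_integral of_real (\<Sum>n<N. 2 * pi * ((cmod (g n))\<^sup>2 * r ^ (2 * n)))) {0..2*pi}"
      unfolding sq .
    from has_integral_Re[OF this] show ?thesis by (simp only: Re_complex_of_real)
  qed
  obtain x :: real where x: "r < x" "x < 1" using r dense by blast
  have "complex_of_real x \<in> \<D>" using x r by simp
  then have "summable (\<lambda>n. g n * complex_of_real x ^ n)" using taylor_sums[OF G] sums_summable unfolding g_def by blast
  then have as: "summable (\<lambda>n. norm (g n * of_real r ^ n))"
    by (rule powser_insidea) (use x r in simp)
  define B where "B = (\<Sum>n. norm (g n * of_real r ^ n))"
  have PB: "cmod (P N t) \<le> B" for N t
  proof -
    have "cmod (P N t) \<le> (\<Sum>n<N. norm (g n * of_real r ^ n))"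
      unfolding P_def by (intro order_trans[OF norm_sum] sum_mono) (simp add: norm_mult norm_power)
    also have "\<dots> \<le> B" unfolding B_def by (intro sum_le_suminf as) auto
    finally show ?thesis .
  qed
  have fi: "(\<lambda>t. (cmod (P N t))\<^sup>2) integrable_on {0..2*pi}" for N using int by blast
  have hi: "(\<lambda>t. B\<^sup>2) integrable_on {0..2*pi}" by (rule integrable_const_ivl)
  have le: "norm ((cmod (P N t))\<^sup>2) \<le> B\<^sup>2" for N t using PB[of N t] by (simp add: power_mono)
  have cv: "(\<lambda>N. (cmod (P N t))\<^sup>2) \<longlonglongrightarrow> (cmod (G (of_real r * cis t)))\<^sup>2" for t
    by (rule tendsto_power[OF tendsto_norm[OF lim]])
  show "(\<lambda>t. (cmod (G (of_real r * cis t)))\<^sup>2) integrable_on {0..2*pi}"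
    by (rule dominated_convergence(1)[OF fi hi le cv])
  have "(\<lambda>N. integral {0..2*pi} (\<lambda>t. (cmod (P N t))\<^sup>2)) \<longlonglongrightarrow> integral {0..2*pi} (\<lambda>t. (cmod (G (of_real r * cis t)))\<^sup>2)"
    by (rule dominated_convergence(2)[OF fi hi le cv])
  then show "(\<lambda>n. 2 * pi * ((cmod (taylor G n))\<^sup>2 * r ^ (2 * n))) sums integral {0..2*pi} (\<lambda>t. (cmod (G (of_real r * cis t)))\<^sup>2)"
    unfolding sums_def integral_unique[OF int] g_def .
qed

lemma renewal_weight_one: "renewal_weight (\<lambda>n. 1)"
  by unfold_locales (simp_all add: summable_geometric)

text \<open>On each circle the mean square of \<open>h * F\<close> is at most \<open>C\<^sup>2\<close> times that of \<open>F\<close>; express both by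
  Taylor coefficients and let the radius tend to one.\<close>

lemma bounded_holomorphic_multiplier:
  assumes h: "h \<in> functions_on \<D>" "h holomorphic_on \<D>" and C: "\<And>z. z \<in> \<D> \<Longrightarrow> cmod (h z) \<le> C"
  shows "h \<in> weighted_multipliers (\<lambda>n. 1)"
proof -
  interpret renewal_weight "\<lambda>n. 1" by (rule renewal_weight_one)
  have "(\<lambda>z. h z * F z) \<in> weighted_hardy (\<lambda>n. 1)" if "F \<in> weighted_hardy (\<lambda>n. 1)" for F
  proof -
    note F = weighted_hardyD[OF that]
    define G where "G = (\<lambda>z. h z * F z)"
    have G: "G holomorphic_on \<D>" unfolding G_def by (intro holomorphic_intros h F)
    define B where "B = C\<^sup>2 * (\<Sum>n. (cmod (taylor F n))\<^sup>2)"
    have Fs: "summable (\<lambda>n. (cmod (taylor F n))\<^sup>2)" using F(2) by simp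
    have le: "(\<Sum>n<N. (cmod (taylor G n))\<^sup>2 * r ^ (2 * n)) \<le> B" if r: "0 \<le> r" "r < 1" for r N
    proof -
      have z: "of_real r * cis t \<in> \<D>" for t using r by (simp add: norm_mult)
      note pG = parseval[OF G r] and pF = parseval[OF F(1) r]
      let ?IG = "integral {0..2*pi} (\<lambda>t. (cmod (G (of_real r * cis t)))\<^sup>2)"
      let ?IF = "integral {0..2*pi} (\<lambda>t. (cmod (F (of_real r * cis t)))\<^sup>2)"
      have "?IG \<le> integral {0..2*pi} (\<lambda>t. C\<^sup>2 * (cmod (F (of_real r * cis t)))\<^sup>2)"
      proof (rule integral_le[OF pG(1)])
        show "(\<lambda>t. C\<^sup>2 * (cmod (F (of_real r * cis t)))\<^sup>2) integrable_on {0..2*pi}"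
          by (rule integrable_on_mult_right[OF pF(1)])
        fix t
        have "cmod (G (of_real r * cis t)) \<le> C * cmod (F (of_real r * cis t))"
          unfolding G_def norm_mult by (intro mult_right_mono C z) auto
        then have "(cmod (G (of_real r * cis t)))\<^sup>2 \<le> (C * cmod (F (of_real r * cis t)))\<^sup>2" by (rule power_mono) simp
        then show "(cmod (G (of_real r * cis t)))\<^sup>2 \<le> C\<^sup>2 * (cmod (F (of_real r * cis t)))\<^sup>2"
          by (simp add: power_mult_distrib)
      qed
      also have "\<dots> = C\<^sup>2 * ?IF" by (rule integral_mult_right)
      finally have IGF: "?IG \<le> C\<^sup>2 * ?IF" .
      have "?IF \<le> 2 * pi * (\<Sum>n. (cmod (taylor F n))\<^sup>2)"
      proof -
        have "?IF = (\<Sum>n. 2 * pi * ((cmod (taylor F n))\<^sup>2 * r ^ (2 * n)))" by (rule sums_unique[OF pF(2)])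
        also have "\<dots> \<le> (\<Sum>n. 2 * pi * (cmod (taylor F n))\<^sup>2)"
          using r by (intro suminf_le sums_summable[OF pF(2)] summable_mult Fs) (simp add: mult_left_le power_le_one)
        also have "\<dots> = 2 * pi * (\<Sum>n. (cmod (taylor F n))\<^sup>2)" by (rule suminf_mult[OF Fs])
        finally show ?thesis .
      qed
      then have "C\<^sup>2 * ?IF \<le> C\<^sup>2 * (2 * pi * (\<Sum>n. (cmod (taylor F n))\<^sup>2))"
        by (rule mult_left_mono) simp
      also have "\<dots> = 2 * pi * B" by (simp add: B_def)
      finally have IG: "?IG \<le> 2 * pi * B" using IGF by linarith
      have "(\<Sum>n<N. 2 * pi * ((cmod (taylor G n))\<^sup>2 * r ^ (2 * n))) \<le> ?IG"
        unfolding sums_unique[OF pG(2)] using r by (intro sum_le_suminf sums_summable[OF pG(2)]) auto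
      then have "2 * pi * (\<Sum>n<N. (cmod (taylor G n))\<^sup>2 * r ^ (2 * n)) \<le> 2 * pi * B"
        using IG by (simp add: sum_distrib_left)
      then show ?thesis by simp
    qed
    have part: "(\<Sum>n<N. (cmod (taylor G n))\<^sup>2) \<le> B" for N
    proof (rule tendsto_upperbound)
      have "((\<lambda>r. \<Sum>n<N. (cmod (taylor G n))\<^sup>2 * r ^ (2 * n)) \<longlongrightarrow> (\<Sum>n<N. (cmod (taylor G n))\<^sup>2 * 1 ^ (2 * n))) (at_left (1::real))"
        by (intro tendsto_intros)
      then show "((\<lambda>r. \<Sum>n<N. (cmod (taylor G n))\<^sup>2 * r ^ (2 * n)) \<longlongrightarrow> (\<Sum>n<N. (cmod (taylor G n))\<^sup>2)) (at_left (1::real))"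
        by simp
      have "eventually (\<lambda>r. r \<in> {0<..<1::real}) (at_left 1)" by (rule eventually_at_left_real) simp
      then show "eventually (\<lambda>r. (\<Sum>n<N. (cmod (taylor G n))\<^sup>2 * r ^ (2 * n)) \<le> B) (at_left 1)"
        by (rule eventually_mono) (use le in auto)
    qed simp
    have "(\<Sum>n\<le>N. (cmod (taylor G n))\<^sup>2) \<le> B" for N
      using part[of "Suc N"] by (simp only: lessThan_Suc_atMost)
    then have "summable (\<lambda>n. (cmod (taylor G n))\<^sup>2)"
      by (intro bounded_imp_summable[where B = B]) simp_all
    then have "G \<in> weighted_hardy (\<lambda>n. 1)" using G h by (simp add: weighted_hardy_def functions_on_def G_def)
    then show ?thesis by (simp add: G_def)
  qed
  then show ?thesis using h(1) by (simp add: multiplier_algebra_def)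
qed

text \<open>For the constant weight the kernel is \<open>1 / (1 - z * cnj w)\<close>, which has nonnegative real part,
  so multipliers are bounded.\<close>

lemma multipliers_one_eq_H_infinity: "weighted_multipliers (\<lambda>n. 1) = H_infinity"
proof (intro equalityI subsetI)
  interpret renewal_weight "\<lambda>n. 1" by (rule renewal_weight_one)
  fix h assume h: "h \<in> weighted_multipliers (\<lambda>n. 1)"
  have K: "weighted_kernel (\<lambda>n. 1) z w = 1 / (1 - z * cnj w)" "cmod (z * cnj w) < 1" if "z \<in> \<D>" "w \<in> \<D>" for z w
  proof -
    have "cmod z * cmod w < 1 * 1" using that by (intro mult_strict_mono) auto
    then show "cmod (z * cnj w) < 1" by (simp add: norm_mult)
    then show "weighted_kernel (\<lambda>n. 1) z w = 1 / (1 - z * cnj w)"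
      using suminf_geometric by (simp add: weighted_kernel_def)
  qed
  have "bounded (h ` \<D>)"
  proof (rule R.multiplier_bounded[OF _ _ h])
    fix z w :: complex assume zw: "z \<in> \<D>" "w \<in> \<D>"
    have "Re (z * cnj w) \<le> 1" using complex_Re_le_cmod[of "z * cnj w"] K(2)[OF zw] by linarith
    then show "0 \<le> Re (weighted_kernel (\<lambda>n. 1) z w)"
      unfolding K(1)[OF zw] by (simp add: Re_divide)
  next
    fix z :: complex assume "z \<in> \<D>"
    then show "weighted_kernel (\<lambda>n. 1) z z \<noteq> 0" using K[of z z] by auto
  qed
  then show "h \<in> H_infinity"
    using weighted_hardyD[OF multiplier_mem[OF h]] by (simp add: H_infinity_def)
next
  fix h assume "h \<in> H_infinity"
  then have h: "h \<in> functions_on \<D>" "h holomorphic_on \<D>" "bounded (h ` \<D>)" by (auto simp: H_infinity_def)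
  then obtain C where "\<And>z. z \<in> \<D> \<Longrightarrow> cmod (h z) \<le> C" unfolding bounded_iff by blast
  then show "h \<in> weighted_multipliers (\<lambda>n. 1)" by (intro bounded_holomorphic_multiplier h)
qed

lemma H_infinity_composition:
  assumes \<theta>: "disc_automorphism \<theta>" and h: "h \<in> H_infinity"
  shows "restr \<D> (h \<circ> \<theta>) \<in> H_infinity"
proof -
  have im: "\<theta> ` \<D> = \<D>" and hol: "\<theta> holomorphic_on \<D>"
    using \<theta> by (auto simp: disc_automorphism_def bij_betw_def)
  have "(h \<circ> \<theta>) holomorphic_on \<D>"
    by (rule holomorphic_on_compose_gen[OF hol]) (use h im in \<open>auto simp: H_infinity_def\<close>)
  then have "restr \<D> (h \<circ> \<theta>) holomorphic_on \<D>"
    by (rule holomorphic_transform) (simp add: restr_def)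
  moreover have "restr \<D> (h \<circ> \<theta>) ` \<D> = h ` \<theta> ` \<D>" by (auto simp: restr_def)
  ultimately show ?thesis using h by (simp add: H_infinity_def im) (simp add: functions_on_def restr_def)
qed

text \<open>A bounded analytic function with a zero at \<open>l\<close> is divisible by \<open>z - l\<close> in the algebra, so a
  character that annihilates \<open>z - l\<close> annihilates it.\<close>

lemma H_infinity_fibre:
  assumes \<rho>: "\<rho> \<in> characters H_infinity" and l: "\<rho> disc_coord = l" "l \<in> \<D>" and h: "h \<in> H_infinity"
  shows "\<rho> h = h l"
proof -
  interpret renewal_weight "\<lambda>n. 1" by (rule renewal_weight_one)
  note eq = multipliers_one_eq_H_infinity
  note one = R.multiplier_one[unfolded eq] and coord = coord_multiplier[unfolded eq]
    and scale = R.multiplier_scale[unfolded eq] and add = R.multiplier_add[unfolded eq]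
  have hf: "h \<in> functions_on \<D>" "h holomorphic_on \<D>" "bounded (h ` \<D>)" using h by (auto simp: H_infinity_def)
  define q where "q z = (if z = l then deriv h l else (h z - h l) / (z - l))" for z
  have q: "q holomorphic_on \<D>" unfolding q_def by (rule pole_lemma_open[OF hf(2)]) simp
  obtain C where C: "\<And>z. z \<in> \<D> \<Longrightarrow> cmod (h z) \<le> C" using hf(3) unfolding bounded_iff by blast
  define \<delta> where "\<delta> = (1 - cmod l) / 2"
  have \<delta>: "0 < \<delta>" "\<delta> < 1 - cmod l" using l(2) by (auto simp: \<delta>_def)
  have sub: "cball l \<delta> \<subseteq> \<D>"
  proof
    fix z assume "z \<in> cball l \<delta>"
    then have "cmod (z - l) \<le> \<delta>" by (simp add: dist_norm norm_minus_commute)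
    then show "z \<in> \<D>" using \<delta> norm_triangle_sub[of z l] by simp
  qed
  have "bounded (q ` cball l \<delta>)"
    by (intro compact_imp_bounded compact_continuous_image holomorphic_on_imp_continuous_on holomorphic_on_subset[OF q sub]) auto
  then obtain B where B: "\<And>z. z \<in> cball l \<delta> \<Longrightarrow> cmod (q z) \<le> B" unfolding bounded_iff by blast
  have "cmod (q z) \<le> max B (2 * C / \<delta>)" if z: "z \<in> \<D>" for z
  proof (cases "z \<in> cball l \<delta>")
    case False
    then have d: "\<delta> < cmod (z - l)" by (simp add: dist_norm norm_minus_commute)
    have "cmod (h z - h l) \<le> 2 * C" using norm_triangle_ineq4[of "h z" "h l"] C[OF z] C[OF l(2)] by simp
    then have "cmod (h z - h l) / cmod (z - l) \<le> 2 * C / \<delta>"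
      using d \<delta> order_trans[OF norm_ge_zero C[OF z]] by (intro frac_le) auto
    moreover have "z \<noteq> l" using d \<delta> by auto
    ultimately show ?thesis by (simp add: q_def norm_divide)
  qed (use B in \<open>simp add: max.coboundedI1\<close>)
  then have "\<forall>y\<in>restr \<D> q ` \<D>. norm y \<le> max B (2 * C / \<delta>)" by (simp add: restr_def)
  then have "bounded (restr \<D> q ` \<D>)" unfolding bounded_iff by blast
  moreover have "restr \<D> q holomorphic_on \<D>"
    by (rule holomorphic_transform[OF q]) (simp add: restr_def)
  ultimately have qm: "restr \<D> q \<in> H_infinity"
    by (simp add: H_infinity_def functions_on_def) (simp add: restr_def)
  define p where "p = (\<lambda>z. disc_coord z + (- l) * disc_one z)"
  have p: "p \<in> H_infinity" unfolding p_def by (intro add scale one coord)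
  have \<rho>1: "\<rho> disc_one = 1"
    by (rule character_unit[OF \<rho> one]) (auto simp: H_infinity_def disc_one_mult)
  have "\<rho> p = \<rho> disc_coord + (- l) * \<rho> disc_one"
    unfolding p_def using charactersD(2)[OF \<rho> coord scale[OF one], of "- l"] charactersD(3)[OF \<rho> one, of "- l"] by simp
  then have \<rho>p: "\<rho> p = 0" using l(1) \<rho>1 by simp
  have "h = (\<lambda>z. h l * disc_one z + p z * restr \<D> q z)"
  proof
    fix z show "h z = h l * disc_one z + p z * restr \<D> q z"
      using hf(1) by (cases "z \<in> \<D>"; cases "z = l") (auto simp: p_def restr_def q_def functions_on_def)
  qed
  then have "\<rho> h = \<rho> (\<lambda>z. h l * disc_one z + p z * restr \<D> q z)" by simp
  also have "\<dots> = h l * \<rho> disc_one + \<rho> p * \<rho> (restr \<D> q)"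
    using charactersD(2)[OF \<rho> scale[OF one] R.multiplier_mult[unfolded eq, OF p qm], of "h l"]
      charactersD(3)[OF \<rho> one, of "h l"] charactersD(4)[OF \<rho> p qm] by simp
  finally show ?thesis using \<rho>1 \<rho>p by simp
qed

section \<open>Multiplier algebras of embedded discs\<close>

text \<open>One embedded disc with its renewal sequence; the final proof uses two instances.\<close>

locale disc_variety =
  fixes H :: "((nat \<Rightarrow> complex) \<Rightarrow> complex) set"
    and ip :: "((nat \<Rightarrow> complex) \<Rightarrow> complex) \<Rightarrow> ((nat \<Rightarrow> complex) \<Rightarrow> complex) \<Rightarrow> complex"
    and b :: "nat \<Rightarrow> complex" and a :: "nat \<Rightarrow> real"
  assumes DA: "drury_arveson H ip"
    and b: "b \<in> ell2" "ell2_norm b = 1" "b 0 \<noteq> 0"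
    and a: "renewal_coeffs b a"
begin

abbreviation V :: "(nat \<Rightarrow> complex) set" where "V \<equiv> embedded_disc b"

abbreviation M :: "((nat \<Rightarrow> complex) \<Rightarrow> complex) set" where "M \<equiv> multipliers_on H ip V"

definition pullback :: "((nat \<Rightarrow> complex) \<Rightarrow> complex) \<Rightarrow> complex \<Rightarrow> complex" where
  "pullback h = restr \<D> (h \<circ> disc_embedding b)"

sublocale W: renewal_weight a
  by (rule renewal_weight_of_coeffs[OF b a])

lemma bij: "bij_betw (disc_embedding b) \<D> V"
  using inj_on_subset[OF inj_disc_embedding[of b, OF b(3)]] by (auto simp: bij_betw_def embedded_disc_def)

lemma embedding_mem: "z \<in> \<D> \<Longrightarrow> disc_embedding b z \<in> V"
  by (simp add: embedded_disc_def)

lemma param: "z \<in> \<D> \<Longrightarrow> disc_param b (disc_embedding b z) = z"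
  using bij by (simp add: disc_param_def bij_betw_def)

lemma space_subset: "space_on H ip V \<subseteq> functions_on V"
  using space_on_iff[OF DA embedded_disc_subset[OF b(1,2)]] by auto

lemma M_functions: "h \<in> M \<Longrightarrow> h \<in> functions_on V"
  by (simp add: multipliers_on_def multiplier_algebra_def)

lemma hardy_functions: "weighted_hardy a \<subseteq> functions_on \<D>"
  by (auto simp: weighted_hardy_def)

lemma pullback_mem: "h \<in> functions_on V \<Longrightarrow> h \<in> M \<longleftrightarrow> pullback h \<in> weighted_multipliers a"
  unfolding multipliers_on_def pullback_def
  by (rule algebra_iso_pullback(1)[OF bij space_subset hardy_functions space_on_embedded_disc[OF DA b a]])

lemma pullback_iso: "algebra_iso M (weighted_multipliers a) pullback"
  unfolding multipliers_on_def pullback_def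
  by (rule algebra_iso_pullback(2)[OF bij space_subset hardy_functions space_on_embedded_disc[OF DA b a]])

lemma closed_M: "closed_algebra M"
proof -
  note A = W.closed_multipliers[unfolded closed_algebra_def]
  have eq: "pullback (\<lambda>x. g x + h x) = (\<lambda>z. pullback g z + pullback h z)"
    "pullback (\<lambda>x. g x * h x) = (\<lambda>z. pullback g z * pullback h z)"
    "pullback (\<lambda>x. c * h x) = (\<lambda>z. c * pullback h z)" for g h c
    by (auto simp: pullback_def restr_def)
  have fn: "(\<lambda>x. g x + h x) \<in> functions_on V" "(\<lambda>x. g x * h x) \<in> functions_on V"
    if "g \<in> M" "h \<in> M" for g h
    using M_functions[OF that(1)] M_functions[OF that(2)] by (simp_all add: functions_on_def)
  have fn_scale: "(\<lambda>x. c * h x) \<in> functions_on V" if "h \<in> M" for h c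
    using M_functions[OF that] by (simp add: functions_on_def)
  have mem: "pullback h \<in> weighted_multipliers a" if "h \<in> M" for h
    using pullback_mem M_functions that by blast
  show ?thesis
    unfolding closed_algebra_def
  proof (intro conjI ballI allI)
    fix g h assume gh: "g \<in> M" "h \<in> M"
    show "(\<lambda>x. g x + h x) \<in> M" "(\<lambda>x. g x * h x) \<in> M"
      unfolding pullback_mem[OF fn(1)[OF gh]] pullback_mem[OF fn(2)[OF gh]] eq
      using A mem gh by blast+
  next
    fix c h assume h: "h \<in> M"
    show "(\<lambda>x. c * h x) \<in> M"
      unfolding pullback_mem[OF fn_scale[OF h]] eq(3) using A mem h by blast
  qed
qed

text \<open>A character \<open>\<rho>\<close> of the algebra on the disc induces the character \<open>\<sigma>\<close> of the algebra on \<open>V\<close>.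
  The coordinate \<open>Z\<^sub>i\<close> pulls back to \<open>b\<^sub>i z\<^sup>i\<close>, so \<open>\<sigma>\<close> lies over the image of \<open>\<rho>(z)\<close> in \<open>V\<close>.\<close>

lemma fibre_pullback:
  assumes fib: "\<forall>l\<in>V. {\<rho> \<in> characters M. char_proj V \<rho> = l} = {point_eval M l}"
    and \<rho>: "\<rho> \<in> characters (weighted_multipliers a)" and l: "\<rho> disc_coord = l" "l \<in> \<D>"
    and u: "u \<in> weighted_multipliers a"
  shows "\<rho> u = u l"
proof -
  note T = algebra_isoD[OF pullback_iso] and \<rho>' = charactersD[OF \<rho>]
  have Tm: "pullback h \<in> weighted_multipliers a" if "h \<in> M" for h using T(1) that by (auto simp: bij_betw_def)
  have Ts: "\<exists>h\<in>M. pullback h = u" if "u \<in> weighted_multipliers a" for u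
  proof -
    have "u \<in> pullback ` M" using that bij_betw_imp_surj_on[OF T(1)] by simp
    then show ?thesis by blast
  qed
  define \<sigma> where "\<sigma> = restr M (\<lambda>h. \<rho> (pullback h))"
  have \<sigma>: "\<sigma> h = \<rho> (pullback h)" if "h \<in> M" for h using that by (simp add: \<sigma>_def restr_def)
  have "\<sigma> \<in> characters M"
    unfolding characters_def
  proof (intro CollectI conjI ballI allI)
    show "\<sigma> \<in> functions_on M" by (simp add: \<sigma>_def functions_on_def restr_def)
    obtain k where "k \<in> weighted_multipliers a" "\<rho> k \<noteq> 0" using \<rho>'(1) by blast
    then show "\<exists>h\<in>M. \<sigma> h \<noteq> 0" using Ts \<sigma> by metis
  next
    fix g h assume gh: "g \<in> M" "h \<in> M"
    show "\<sigma> (\<lambda>x. g x + h x) = \<sigma> g + \<sigma> h" "\<sigma> (\<lambda>x. g x * h x) = \<sigma> g * \<sigma> h"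
      using gh closed_M by (simp_all add: closed_algebra_def \<sigma> T \<rho>' Tm)
  next
    fix c h assume "h \<in> M"
    then show "\<sigma> (\<lambda>x. c * h x) = c * \<sigma> h" using closed_M by (simp add: closed_algebra_def \<sigma> T \<rho>' Tm)
  qed
  moreover have "char_proj V \<sigma> = disc_embedding b l"
  proof
    fix i
    define Z where "Z = restr V (\<lambda>x. x i)"
    define m where "m n = restr \<D> (\<lambda>z. z ^ n)" for n :: nat
    have m: "m n \<in> weighted_multipliers a" for n
      unfolding m_def by (rule W.R.multiplier_power[OF W.coord_multiplier])
    have \<rho>m: "\<rho> (m n) = l ^ n" for n
    proof (induction n)
      case 0
      have "\<rho> disc_one = 1"
        by (rule character_unit[OF \<rho> W.R.multiplier_one]) (use multiplier_on_disc disc_one_mult(1) in blast)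
      then show ?case by (simp add: m_def)
    next
      case (Suc n)
      have "m (Suc n) = (\<lambda>z. disc_coord z * m n z)" by (auto simp: m_def restr_def)
      then show ?case using \<rho>'(4)[OF W.coord_multiplier m[of n]] Suc l(1) by simp
    qed
    have eq: "pullback Z = (\<lambda>z. b i * m (Suc i) z)"
      by (auto simp: pullback_def Z_def restr_def m_def disc_embedding_def embedded_disc_def)
    have "Z \<in> functions_on V" by (simp add: Z_def functions_on_def restr_def)
    then have "Z \<in> M" using pullback_mem W.R.multiplier_scale[OF m] by (simp add: eq)
    then have "\<sigma> Z = b i * l ^ Suc i" by (simp only: \<sigma> eq \<rho>'(3)[OF m] \<rho>m)
    then show "char_proj V \<sigma> i = disc_embedding b l i" by (simp add: char_proj_def Z_def disc_embedding_def)
  qed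
  ultimately have "\<sigma> = point_eval M (disc_embedding b l)"
    using fib embedding_mem[OF l(2)] by blast
  moreover obtain h where h: "h \<in> M" "pullback h = u" using Ts u by blast
  ultimately have "\<rho> u = h (disc_embedding b l)"
    using \<sigma>[OF h(1)] h by (simp add: point_eval_def restr_def)
  then show ?thesis using h(2) l(2) by (auto simp: pullback_def restr_def)
qed

lemma automorphism_pullback:
  assumes inv: "automorphism_invariant b M" and \<theta>: "disc_automorphism \<theta>" and u: "u \<in> weighted_multipliers a"
  shows "restr \<D> (u \<circ> \<theta>) \<in> weighted_multipliers a"
proof -
  have \<theta>D: "\<theta> z \<in> \<D>" if "z \<in> \<D>" for z using \<theta> that by (auto simp: disc_automorphism_def bij_betw_def)
  obtain h where h: "h \<in> M" "pullback h = u"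
  proof -
    have "u \<in> pullback ` M" using u bij_betw_imp_surj_on[OF algebra_isoD(1)[OF pullback_iso]] by simp
    then show thesis using that by blast
  qed
  define k where "k = restr V (h \<circ> (disc_embedding b \<circ> \<theta> \<circ> disc_param b))"
  have "algebra_iso M M (\<lambda>h. restr V (h \<circ> (disc_embedding b \<circ> \<theta> \<circ> disc_param b)))"
    using inv \<theta> by (simp add: automorphism_invariant_def)
  then have "k \<in> M" using algebra_isoD(1) h(1) unfolding k_def bij_betw_def by blast
  then have "pullback k \<in> weighted_multipliers a" using pullback_mem M_functions by blast
  moreover have "pullback k = restr \<D> (u \<circ> \<theta>)"
  proof
    show "pullback k z = restr \<D> (u \<circ> \<theta>) z" for z
      unfolding h(2)[symmetric] using param[of z] embedding_mem[of z] \<theta>D[of z]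
      by (cases "z \<in> \<D>") (simp_all add: pullback_def k_def restr_def)
  qed
  ultimately show ?thesis by simp
qed

end

theorem proposition7p5:
  fixes H :: "((nat \<Rightarrow> complex) \<Rightarrow> complex) set"
    and ip :: "((nat \<Rightarrow> complex) \<Rightarrow> complex) \<Rightarrow> ((nat \<Rightarrow> complex) \<Rightarrow> complex) \<Rightarrow> complex"
    and b b' :: "nat \<Rightarrow> complex"
    and a a' :: "nat \<Rightarrow> real"
    and V V' :: "(nat \<Rightarrow> complex) set"
    and M M' :: "((nat \<Rightarrow> complex) \<Rightarrow> complex) set"
  assumes DA: "drury_arveson H ip"
    and b: "b \<in> ell2" "ell2_norm b = 1" "b 0 \<noteq> 0"
    and b': "b' \<in> ell2" "ell2_norm b' = 1" "b' 0 \<noteq> 0"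
    and V: "V = embedded_disc b" and V': "V' = embedded_disc b'"
    and M: "M = multipliers_on H ip V" and M': "M' = multipliers_on H ip V'"
    and a: "renewal_coeffs b a" and a': "renewal_coeffs b' a'"
  shows "variety H V \<and> variety H V'
    \<and> (algebra_iso M M' (natural_map b b') \<longleftrightarrow> comparable a a')
    \<and> ((\<forall>l\<in>V'. {\<rho> \<in> characters M'. char_proj V' \<rho> = l} = {point_eval M' l})
        \<and> automorphism_invariant b' M'
       \<longrightarrow> (isomorphic_algebras M M' \<longleftrightarrow> comparable a a'))
    \<and> (isomorphic_algebras M H_infinity \<longleftrightarrow> (\<exists>c>0. \<forall>n. c \<le> a n))"
proof -
  interpret X: disc_variety H ip b a by unfold_locales (fact DA b a)+
  interpret Y: disc_variety H ip b' a' by unfold_locales (fact DA b' a')+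
  let ?A = "weighted_multipliers a" and ?A' = "weighted_multipliers a'"
  let ?N = "natural_map b b'"
  note wa = X.W.renewal_weight_axioms and wa' = Y.W.renewal_weight_axioms
  have MX: "M = X.M" and MY: "M' = Y.M" by (simp_all add: M M' V V')
  note TX = algebra_isoD[OF X.pullback_iso, folded MX] and TY = algebra_isoD[OF Y.pullback_iso, folded MY]
  have pull_nat: "Y.pullback (?N h) = X.pullback h" for h
    by (intro ext) (auto simp: Y.pullback_def X.pullback_def natural_map_def restr_def Y.param Y.embedding_mem)
  \<comment> \<open>On the disc the natural map is the identity.\<close>
  have natural: "algebra_iso M M' ?N \<longleftrightarrow> ?A = ?A'"
  proof
    assume "algebra_iso M M' ?N"
    then have "?N ` M = M'" using algebra_isoD(1) by (auto simp: bij_betw_def)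
    then have "Y.pullback ` M' = X.pullback ` M" using pull_nat by (metis (no_types, lifting) image_cong image_image)
    then show "?A = ?A'" using TX(1) TY(1) by (simp add: bij_betw_def)
  next
    assume eq: "?A = ?A'"
    have N_mem: "?N h \<in> M'" if "h \<in> M" for h
    proof -
      have "X.pullback h \<in> ?A'" using TX(1) that eq by (auto simp: bij_betw_def)
      moreover have "?N h \<in> functions_on Y.V" by (simp add: natural_map_def functions_on_def restr_def)
      ultimately show ?thesis using Y.pullback_mem pull_nat MY by simp
    qed
    have "inj_on ?N M" using TX(1) pull_nat by (metis bij_betw_def inj_on_def)
    moreover have "k \<in> ?N ` M" if k: "k \<in> M'" for k
    proof -
      have "Y.pullback k \<in> ?A" using TY(1) k eq by (auto simp: bij_betw_def)
      then obtain h where h: "h \<in> M" "Y.pullback k = X.pullback h" using TX(1) by (auto simp: bij_betw_def)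
      then have "Y.pullback k = Y.pullback (?N h)" by (simp add: pull_nat)
      then have "k = ?N h" using TY(1) k N_mem[OF h(1)] by (auto simp: bij_betw_def inj_on_def)
      then show ?thesis using h(1) by blast
    qed
    ultimately have "bij_betw ?N M M'" using N_mem by (auto simp: bij_betw_def)
    then show "algebra_iso M M' ?N"
      unfolding algebra_iso_def by (auto simp: natural_map_def restr_def)
  qed
  have first: "algebra_iso M M' ?N \<longleftrightarrow> comparable a a'"
    using natural multipliers_eq_iff_comparable[OF wa wa'] by blast
  \<comment> \<open>Abstract isomorphisms between the algebras on the varieties become isomorphisms between the algebras on the disc.\<close>
  have to_disc: "algebra_iso ?A M (inv_into M X.pullback)"
    unfolding MX by (rule algebra_iso_inverse[OF X.closed_M X.pullback_iso])
  have second: "isomorphic_algebras M M' \<longleftrightarrow> comparable a a'"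
    if fib: "\<forall>l\<in>V'. {\<rho> \<in> characters M'. char_proj V' \<rho> = l} = {point_eval M' l}"
      and aut: "automorphism_invariant b' M'"
  proof
    assume "comparable a a'"
    then show "isomorphic_algebras M M'" using first unfolding isomorphic_algebras_def by blast
  next
    assume "isomorphic_algebras M M'"
    then obtain \<Phi> where "algebra_iso M M' \<Phi>" unfolding isomorphic_algebras_def by blast
    then have "algebra_iso ?A ?A' (Y.pullback \<circ> (\<Phi> \<circ> inv_into M X.pullback))"
      using Y.pullback_iso[folded MY] to_disc by (intro algebra_iso_compose)
    then have "?A = ?A'"
      by (rule iso_imp_multipliers_eq[OF wa wa'])
        (use Y.fibre_pullback[OF fib[unfolded MY V']] Y.automorphism_pullback[OF aut[unfolded MY]] in blast)+
    then show "comparable a a'" using multipliers_eq_iff_comparable[OF wa wa'] by blast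
  qed
  have below: "comparable a (\<lambda>n. 1) \<longleftrightarrow> (\<exists>c>0. \<forall>n. c \<le> a n)"
  proof
    assume "comparable a (\<lambda>n. 1)"
    then obtain C where C: "C > 0" "\<And>n. 1 \<le> C * a n" unfolding comparable_def by blast
    then have "1 / C \<le> a n" for n by (simp add: divide_le_eq mult.commute)
    then show "\<exists>c>0. \<forall>n. c \<le> a n" using C(1) by (intro exI[of _ "1 / C"]) auto
  next
    assume "\<exists>c>0. \<forall>n. c \<le> a n"
    then obtain c where c: "c > 0" "\<And>n. c \<le> a n" by blast
    then have "1 * a n \<le> 1 \<and> 1 \<le> 1 / c * a n" for n using X.W.le_one by (simp add: divide_le_eq le_divide_eq)
    then show "comparable a (\<lambda>n. 1)"
      unfolding comparable_def using c(1) by (intro exI[of _ 1] exI[of _ "1 / c"] conjI) auto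
  qed
  have third: "isomorphic_algebras M H_infinity \<longleftrightarrow> (\<exists>c>0. \<forall>n. c \<le> a n)"
  proof
    assume "isomorphic_algebras M H_infinity"
    then obtain \<Phi> where "algebra_iso M H_infinity \<Phi>" unfolding isomorphic_algebras_def by blast
    then have "algebra_iso ?A (weighted_multipliers (\<lambda>n. 1)) (\<Phi> \<circ> inv_into M X.pullback)"
      unfolding multipliers_one_eq_H_infinity using to_disc by (intro algebra_iso_compose)
    then have "?A = weighted_multipliers (\<lambda>n. 1)"
    proof (rule iso_imp_multipliers_eq[OF wa renewal_weight_one])
      show "\<rho> h = h l" if "\<rho> \<in> characters (weighted_multipliers (\<lambda>n. 1))" "\<rho> disc_coord = l" "l \<in> \<D>"
        "h \<in> weighted_multipliers (\<lambda>n. 1)" for \<rho> l h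
        using that H_infinity_fibre unfolding multipliers_one_eq_H_infinity by simp
      show "restr \<D> (h \<circ> \<theta>) \<in> weighted_multipliers (\<lambda>n. 1)"
        if "disc_automorphism \<theta>" "h \<in> weighted_multipliers (\<lambda>n. 1)" for \<theta> h
        using that H_infinity_composition unfolding multipliers_one_eq_H_infinity by simp
    qed
    then show "\<exists>c>0. \<forall>n. c \<le> a n"
      using multipliers_eq_iff_comparable[OF wa renewal_weight_one] below by blast
  next
    assume "\<exists>c>0. \<forall>n. c \<le> a n"
    then have "?A = H_infinity"
      using multipliers_eq_iff_comparable[OF wa renewal_weight_one] below multipliers_one_eq_H_infinity by blast
    then show "isomorphic_algebras M H_infinity"
      using X.pullback_iso MX unfolding isomorphic_algebras_def by auto
  qed
  show ?thesis
    using embedded_disc_variety[OF DA b] embedded_disc_variety[OF DA b'] first second third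
    unfolding V V' by blast
qed

end
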